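(* Let $p\ge3$ be an integer and let $T$ be a contraction on a Banach space with spectrum $\operatorname{Sp}T\subseteq E_{1/p}$ (so $T$ is invertible). Suppose that for some $\alpha<\dfrac{\log p-\log2}{2\log p-\log2}$, $$\limsup_{n\to\infty}\frac{\log^+\|T^{-n}\|}{n^\alpha}<+\infty .$$ Then $\sup_{n\ge1}\|T^{-n}\|<+\infty$.
   Context: $\Gamma$ is the unit circle. A contraction is a bounded linear operator $T$ with $\|T\|\le1$. $\log^+x=\max(\log x,0)$. $E_{1/p}=\{e^{2\pi i x}: x=(1-1/p)\sum_{k\ge1}\varepsilon_k p^{-(k-1)},\ \varepsilon_k\in\{0,1\}\}$ is the perfect symmetric set of constant ratio $1/p$. *)

theory Defs
  imports "HOL-Analysis.Analysis"
begin

text \<open>A complex Banach space is modelled as a real Banach space together with a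
bounded real-linear operator J (multiplication by i) such that the induced
complex scalar multiplication (a + i b) x = a x + b J x is a genuine complex
vector space structure with absolutely homogeneous norm.\<close>

definition cscal :: "('a::real_normed_vector \<Rightarrow>\<^sub>L 'a) \<Rightarrow> complex \<Rightarrow> ('a \<Rightarrow>\<^sub>L 'a)" where
  "cscal J z = Re z *\<^sub>R id_blinfun + Im z *\<^sub>R J"

definition complex_structure :: "('a::real_normed_vector \<Rightarrow>\<^sub>L 'a) \<Rightarrow> bool" where
  "complex_structure J \<longleftrightarrow> J o\<^sub>L J = - id_blinfun \<and>
     (\<forall>z x. norm (blinfun_apply (cscal J z) x) = cmod z * norm x)"

definition clinear_op :: "('a::real_normed_vector \<Rightarrow>\<^sub>L 'a) \<Rightarrow> ('a \<Rightarrow>\<^sub>L 'a) \<Rightarrow> bool" where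
  "clinear_op J T \<longleftrightarrow> T o\<^sub>L J = J o\<^sub>L T"

definition invertible_op :: "('a::real_normed_vector \<Rightarrow>\<^sub>L 'a) \<Rightarrow> bool" where
  "invertible_op A \<longleftrightarrow> (\<exists>B. B o\<^sub>L A = id_blinfun \<and> A o\<^sub>L B = id_blinfun)"

definition op_spectrum :: "('a::real_normed_vector \<Rightarrow>\<^sub>L 'a) \<Rightarrow> ('a \<Rightarrow>\<^sub>L 'a) \<Rightarrow> complex set" where
  "op_spectrum J T = {z. \<not> invertible_op (T - cscal J z)}"

definition op_pow :: "('a::real_normed_vector \<Rightarrow>\<^sub>L 'a) \<Rightarrow> nat \<Rightarrow> ('a \<Rightarrow>\<^sub>L 'a)" where
  "op_pow S n = ((\<lambda>A. S o\<^sub>L A) ^^ n) id_blinfun"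

definition log_plus :: "real \<Rightarrow> real" where
  "log_plus x = max (ln x) 0"

text \<open>Perfect symmetric set of constant ratio 1/p (index k starting from 0).\<close>
definition E_set :: "nat \<Rightarrow> complex set" where
  "E_set p = {cis (2 * pi * x) | x. \<exists>\<epsilon>::nat \<Rightarrow> bool.
      x = (1 - 1 / real p) * (\<Sum>k. (if \<epsilon> k then 1 else 0) * (1 / real p) ^ k)}"

end

theory Submission
  imports Defs "HOL-Complex_Analysis.Complex_Analysis" "HOL-Real_Asymp.Real_Asymp"
begin

text \<open>
Since \<open>T\<close> is a contraction, the norms of \<open>T\<^sup>-\<^sup>n\<close> increase with \<open>n\<close>, so it suffices to bound them for
\<open>n = q = p\<^sup>k\<close>. The set \<open>E\<close> is invariant under \<open>z \<mapsto> z\<^sup>q\<close>. Let \<open>F(z) = \<Sum>\<^sub>n \<beta>\<^sub>n z\<^sup>n\<close> be a function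
with \<open>\<Sum>\<^sub>n |\<beta>\<^sub>n|\<close> finite, \<open>F(0) \<noteq> 0\<close>, which is so small near \<open>E\<close> that it annihilates every operator with
spectrum in \<open>E\<close> and the given growth. Then \<open>F(T\<^sup>q) = 0\<close> reads
\<open>F(0) T\<^sup>-\<^sup>q = - \<Sum>\<^sub>n \<beta>\<^sub>n\<^sub>+\<^sub>1 T\<^sup>q\<^sup>n\<close>, which is bounded independently of \<open>q\<close>.

In place of a single outer function we use \<open>F\<^sub>l = exp (- H\<^sub>l)\<close>, where \<open>H\<^sub>l\<close> is a finite sum of simple
fractions with poles just outside the disc, at distance \<open>p\<^sup>-\<^sup>k\<close> from the endpoints of the intervals of
order \<open>k \<le> l\<close> and with weights \<open>s\<^sup>k\<close>. As there are at most \<open>2\<^sup>k\<close> such endpoints, \<open>H\<^sub>l(0)\<close> is bounded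
when \<open>s < 1/2\<close>, whereas \<open>Re H\<^sub>l\<close> is of size \<open>(s p)\<^sup>k\<close> at distance \<open>p\<^sup>-\<^sup>k\<close> from \<open>E\<close>. With
\<open>\<beta> = \<alpha> / (1 - \<alpha>)\<close>, the resolvent is at most \<open>exp (C \<delta>\<^sup>-\<^sup>\<beta>)\<close> at distance \<open>\<delta>\<close> from the circle, and
the hypothesis on \<open>\<alpha>\<close> says exactly that \<open>p\<^sup>\<beta> < s p\<close> for some \<open>s < 1/2\<close>. In the coordinate
\<open>z = exp (2 \<pi> \<i> w)\<close>, the value of \<open>F\<^sub>l(T\<^sup>q)\<close> is a sum of integrals over the boundaries of boxes of size
\<open>p\<^sup>-\<^sup>l\<^sup>-\<^sup>k\<close>, which vanish for the boxes that do not meet \<open>E\<close> and tend to \<open>0\<close> for the others.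
\<close>

section \<open>The Cantor set and its finite approximations\<close>

lemma norm_cis_diff_le: "norm (cis a - cis b) \<le> \<bar>a - b\<bar>"
proof -
  have "cis a - cis b = cis b * (exp (\<i> * of_real (a - b)) - 1)"
    by (simp add: cis_conv_exp algebra_simps flip: exp_add)
  then have "norm (cis a - cis b) = norm (exp (\<i> * of_real (a - b)) - 1)"
    by (simp add: norm_mult)
  also have "\<dots> = 2 * \<bar>sin ((a - b) / 2)\<bar>"
    by (rule dist_exp_i_1)
  also have "\<dots> \<le> \<bar>a - b\<bar>"
    using abs_sin_x_le_abs_x[of "(a - b) / 2"] by simp
  finally show ?thesis .
qed

text \<open>Prepending a digit, rather than appending one, makes both the inclusion of the scales and the
action of \<open>x \<mapsto> p x\<close> immediate.\<close>

primrec cantor_ends :: "nat \<Rightarrow> nat \<Rightarrow> real set" where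
  "cantor_ends p 0 = {0}"
| "cantor_ends p (Suc k) = (\<lambda>x. x / p) ` cantor_ends p k \<union> (\<lambda>x. (real p - 1 + x) / p) ` cantor_ends p k"

text \<open>A closed set containing \<open>E_set p\<close> which retains the two properties of the latter that matter. The
half-plane condition keeps the odd multiples of \<open>1 / (2 p\<^sup>k)\<close> away from it (in the angular variable).\<close>

definition cantor_hull :: "nat \<Rightarrow> complex set" where
  "cantor_hull p = {z. norm z = 1 \<and> (\<forall>k. Re (z ^ (p ^ k)) \<ge> - 1 / 2 \<and>
     (\<exists>x\<in>cantor_ends p k. norm (z - cis (2 * pi * x)) \<le> 2 * pi / real p ^ k))}"

lemma finite_cantor_ends: "finite (cantor_ends p k)"
  by (induction k) auto

lemma card_cantor_ends: "card (cantor_ends p k) \<le> 2 ^ k"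
proof (induction k)
  case (Suc k)
  have "card (cantor_ends p (Suc k)) \<le> card ((\<lambda>x. x / p) ` cantor_ends p k) + card ((\<lambda>x. (real p - 1 + x) / p) ` cantor_ends p k)"
    by (simp add: card_Un_le)
  also have "\<dots> \<le> card (cantor_ends p k) + card (cantor_ends p k)"
    by (intro add_mono card_image_le finite_cantor_ends)
  finally show ?case using Suc by simp
qed simp

lemma cantor_ends_SucE:
  assumes "x \<in> cantor_ends p (Suc k)"
  obtains e y where "y \<in> cantor_ends p k" "x = (e + y) / p" "e = 0 \<or> e = real p - 1"
  using assms that[of _ 0] that[of _ "real p - 1"] by auto

lemma cantor_ends_subset: 
  assumes "p \<ge> 1" shows "cantor_ends p k \<subseteq> {0..1}"
  using assms by (induction k) (auto simp: field_simps)

text \<open>Stripping the leading digit from the finer point reduces both orders by one, and putting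
  it back divides the error by \<open>p\<close>. At order 0 everything lies in the unit interval, so
  the error is at most 1.\<close>

lemma cantor_ends_coarsen:
  assumes "p \<ge> 1" "k \<le> l" "x \<in> cantor_ends p l"
  shows "\<exists>y\<in>cantor_ends p k. \<bar>x - y\<bar> \<le> 1 / real p ^ k"
  using assms(2,3)
proof (induction k arbitrary: l x)
  case 0
  then show ?case using cantor_ends_subset[OF assms(1), of l] by auto
next
  case (Suc k)
  then obtain l' where l: "l = Suc l'" "k \<le> l'" by (cases l) auto
  from Suc.prems(2)[unfolded l] obtain e x' where x: "x' \<in> cantor_ends p l'" "x = (e + x') / p" "e = 0 \<or> e = real p - 1"
    by (rule cantor_ends_SucE)
  from Suc.IH[OF l(2) x(1)] obtain y where y: "y \<in> cantor_ends p k" "\<bar>x' - y\<bar> \<le> 1 / real p ^ k" by auto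
  have "(e + y) / p \<in> cantor_ends p (Suc k)" using x(3) y(1) by auto
  moreover have "\<bar>x - (e + y) / p\<bar> = \<bar>x' - y\<bar> / p" 
    by (simp add: x(2) flip: diff_divide_distrib)
  then have "\<bar>x - (e + y) / p\<bar> \<le> 1 / real p ^ Suc k"
    using y(2) assms(1) by (simp add: field_simps)
  ultimately show ?case by blast
qed

text \<open>The \<open>p\<close>-th power turns the leading digit into an integer multiple of a full
  turn, so it acts on angles as the shift of digits.\<close>

lemma cis_digit_power:
  assumes "p \<ge> 1" "e = 0 \<or> e = real p - 1"
  shows "cis (2 * pi * ((e + x) / p)) ^ p = cis (2 * pi * x)"
proof -
  have "cis (2 * pi * ((e + x) / p)) ^ p = cis (2 * pi * (e + x))"
    using assms(1) by (simp add: Complex.DeMoivre)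
  also have "\<dots> = cis (2 * pi * e) * cis (2 * pi * x)"
    by (simp add: cis_mult algebra_simps)
  also have "cis (2 * pi * e) = 1"
  proof -
    have "e \<in> \<int>" using assms by auto
    then show ?thesis by (rule cis_multiple_2pi)
  qed
  finally show ?thesis by simp
qed

text \<open>Each \<open>p\<close>-th power removes one digit. Hence
  \<open>z \<mapsto> z ^ (p ^ k)\<close> turns the endpoints of order \<open>k + l\<close> into
  endpoints of order \<open>l\<close>, which are the points near which the damping function of level
  \<open>l\<close> is small.\<close>

lemma cantor_ends_power:
  assumes "p \<ge> 1" "x \<in> cantor_ends p (k + l)"
  shows "\<exists>y\<in>cantor_ends p l. cis (2 * pi * x) ^ (p ^ k) = cis (2 * pi * y)"
  using assms(2)
proof (induction k arbitrary: x)
  case (Suc k)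
  from Suc.prems[unfolded add_Suc] obtain e x' where x: "x' \<in> cantor_ends p (k + l)" "x = (e + x') / p" "e = 0 \<or> e = real p - 1"
    by (rule cantor_ends_SucE)
  from Suc.IH[OF x(1)] obtain y where y: "y\<in>cantor_ends p l" "cis (2 * pi * x') ^ (p ^ k) = cis (2 * pi * y)" by auto
  have "cis (2 * pi * x) ^ (p ^ Suc k) = (cis (2 * pi * x) ^ p) ^ (p ^ k)"
    by (simp flip: power_mult)
  also have "\<dots> = cis (2 * pi * y)"
    using cis_digit_power[OF assms(1) x(3)] x(2) y(2) by simp
  finally show ?case using y(1) by blast
qed auto

lemma closed_cantor_hull: "closed (cantor_hull p)"
proof -
  have "cantor_hull p = {z. norm z = 1} \<inter> (\<Inter>k. {z. Re (z ^ (p ^ k)) \<ge> - 1 / 2} \<inter>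
     (\<Union>x\<in>cantor_ends p k. {z. norm (z - cis (2 * pi * x)) \<le> 2 * pi / real p ^ k}))"
    by (auto simp: cantor_hull_def)
  also have "closed \<dots>"
    by (intro closed_Int closed_INT ballI closed_UN finite_cantor_ends closed_Collect_eq closed_Collect_le continuous_intros)
  finally show ?thesis .
qed

section \<open>The set of angles, its self-similarity and its inclusion in the closed hull\<close>

definition cantor_set :: "nat \<Rightarrow> real set" where
  "cantor_set p = {(1 - 1 / real p) * (\<Sum>k. (if \<epsilon> k then 1 else 0) * (1 / real p) ^ k) | \<epsilon>. True}"

lemma summable_digits:
  assumes "p \<ge> 2"
  shows "summable (\<lambda>k. (if \<epsilon> k then 1 else 0) * (1 / real p) ^ k)"
  by (rule summable_comparison_test'[where g = "\<lambda>k. (1 / real p) ^ k" and N = 0])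
     (use assms in \<open>auto intro!: summable_geometric\<close>)

lemma cantor_set_bounds:
  assumes "p \<ge> 2" "x \<in> cantor_set p"
  shows "0 \<le> x \<and> x \<le> 1"
proof -
  from assms(2) obtain \<epsilon> where x: "x = (1 - 1 / real p) * (\<Sum>k. (if \<epsilon> k then 1 else 0) * (1 / real p) ^ k)"
    by (auto simp: cantor_set_def)
  have "(\<Sum>k. (if \<epsilon> k then 1 else 0) * (1 / real p) ^ k) \<le> (\<Sum>k. (1 / real p) ^ k)"
    by (intro suminf_le summable_digits assms summable_geometric) (use assms in auto)
  also have "\<dots> = 1 / (1 - 1 / real p)"
    by (rule suminf_geometric) (use assms in auto)
  finally have "x \<le> 1" using assms(1) by (simp add: x field_simps)
  moreover have "(\<Sum>k. (if \<epsilon> k then 1 else 0) * (1 / real p) ^ k) \<ge> 0"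
    by (intro suminf_nonneg summable_digits assms) auto
  then have "x \<ge> 0" using assms(1) by (simp add: x)
  ultimately show ?thesis by simp
qed

text \<open>The term of index 0 of the series is the digit, contributing 0 or
  \<open>(p - 1) / p\<close>, and the remaining terms are \<open>1 / p\<close> times the series of
  the shifted digits. This self-similarity drives the inductions on the scale.\<close>

lemma cantor_set_first_digit:
  assumes "p \<ge> 2" "x \<in> cantor_set p"
  obtains e y where "e = 0 \<or> e = real p - 1" "y \<in> cantor_set p" "x = (e + y) / p"
proof -
  from assms(2) obtain \<epsilon> where x: "x = (1 - 1 / real p) * (\<Sum>k. (if \<epsilon> k then 1 else 0) * (1 / real p) ^ k)"
    by (auto simp: cantor_set_def)
  let ?S = "\<Sum>k. (if \<epsilon> (Suc k) then 1 else 0) * (1 / real p) ^ k"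
  let ?d = "if \<epsilon> 0 then 1 else 0 :: real"
  have "(\<Sum>k. (if \<epsilon> k then 1 else 0) * (1 / real p) ^ k) = 
      (\<Sum>k. (if \<epsilon> (Suc k) then 1 else 0) * (1 / real p) ^ Suc k) + ?d"
    using suminf_split_head[OF summable_digits[OF assms(1), of \<epsilon>]] by simp
  also have "(\<Sum>k. (if \<epsilon> (Suc k) then 1 else 0) * (1 / real p) ^ Suc k) = (\<Sum>k. (1 / p) * ((if \<epsilon> (Suc k) then 1 else 0) * (1 / real p) ^ k))"
    by (intro suminf_cong) auto
  also have "\<dots> = (1 / p) * ?S"
    by (intro suminf_mult summable_digits assms)
  finally have "x = (1 - 1 / real p) * ((1 / p) * ?S + ?d)" by (simp add: x)
  also have "\<dots> = ((real p - 1) * ?d + (1 - 1 / real p) * ?S) / p"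
    using assms(1) by (simp add: field_simps)
  finally show ?thesis
    by (intro that[of "(real p - 1) * ?d" "(1 - 1 / real p) * ?S"]) (auto simp: cantor_set_def)
qed

lemma cantor_set_near_ends:
  assumes "p \<ge> 2" "x \<in> cantor_set p"
  shows "\<exists>y\<in>cantor_ends p k. \<bar>x - y\<bar> \<le> 1 / real p ^ k"
  using assms(2)
proof (induction k arbitrary: x)
  case 0
  then show ?case using cantor_set_bounds[OF assms(1)] by auto
next
  case (Suc k)
  obtain e x' where x: "e = 0 \<or> e = real p - 1" "x' \<in> cantor_set p" "x = (e + x') / p"
    using cantor_set_first_digit[OF assms(1) Suc.prems] .
  from Suc.IH[OF x(2)] obtain y where y: "y \<in> cantor_ends p k" "\<bar>x' - y\<bar> \<le> 1 / real p ^ k" by auto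
  have "(e + y) / p \<in> cantor_ends p (Suc k)" using x(1) y(1) by auto
  moreover have "\<bar>x - (e + y) / p\<bar> = \<bar>x' - y\<bar> / p" 
    by (simp add: x(3) flip: diff_divide_distrib)
  then have "\<bar>x - (e + y) / p\<bar> \<le> 1 / real p ^ Suc k"
    using y(2) assms(1) by (simp add: field_simps)
  ultimately show ?case by blast
qed

text \<open>According to the first digit, the angle is within \<open>1 / p\<close> of 0 or of 1,
  hence within one third of a turn of the positive axis because \<open>p \<ge> 3\<close>; and
  \<open>cos (2 * pi / 3) = - 1 / 2\<close>.\<close>

lemma Re_cis_cantor_set:
  assumes "p \<ge> 3" "x \<in> cantor_set p"
  shows "Re (cis (2 * pi * x)) \<ge> - 1 / 2"
proof -
  have p: "p \<ge> 2" using assms by simp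
  obtain e y where x: "e = 0 \<or> e = real p - 1" "y \<in> cantor_set p" "x = (e + y) / p"
    using cantor_set_first_digit[OF p assms(2)] .
  have y: "0 \<le> y" "y \<le> 1" using cantor_set_bounds[OF p x(2)] by auto
  have *: "cos (2 * pi * t) \<ge> - 1 / 2" if "\<bar>t\<bar> \<le> 1 / 3" for t
  proof -
    have "cos (2 * pi * t) = cos (2 * pi * \<bar>t\<bar>)" by (cases "t \<ge> 0") auto
    also have "\<dots> \<ge> cos (2 * pi / 3)"
      by (rule cos_monotone_0_pi_le) (use that in \<open>auto simp: field_simps\<close>)
    finally show ?thesis by (simp add: cos_120)
  qed
  from x(1) show ?thesis
  proof
    assume "e = 0"
    then have "x = y / p" using x by simp
    moreover have "y / p \<le> 1 / 3" using y assms(1) by (simp add: field_simps)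
    ultimately have "\<bar>x\<bar> \<le> 1 / 3" using y by simp
    then show ?thesis using * by simp
  next
    assume e: "e = real p - 1"
    then have "x - 1 = - (1 - y) / p" using x assms(1) by (simp add: field_simps)
    moreover have "(1 - y) / p \<le> 1 / 3" using y assms(1) by (simp add: field_simps)
    ultimately have "\<bar>x - 1\<bar> \<le> 1 / 3" using y by simp
    from *[OF this] have "cos (2 * pi * x - 2 * pi) \<ge> - 1 / 2" by (simp add: algebra_simps)
    then show ?thesis by (simp add: cos_diff)
  qed
qed

lemma E_set_eq: "E_set p = (\<lambda>x. cis (2 * pi * x)) ` cantor_set p"
  unfolding E_set_def cantor_set_def by blast

lemma E_set_subset_cantor_hull:
  assumes "p \<ge> 3"
  shows "E_set p \<subseteq> cantor_hull p"
proof
  fix z assume "z \<in> E_set p"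
  then obtain x where x: "x \<in> cantor_set p" "z = cis (2 * pi * x)" by (auto simp: E_set_eq)
  have p: "p \<ge> 2" using assms by simp
  \<comment> \<open>Invariance under the shift of digits carries the half-plane condition, known at
    scale 1, to every scale.\<close>
  have "\<exists>y\<in>cantor_set p. cis (2 * pi * x) ^ (p ^ k) = cis (2 * pi * y)" for k
    using x(1)
  proof (induction k arbitrary: x)
    case (Suc k)
    obtain e x' where x': "e = 0 \<or> e = real p - 1" "x' \<in> cantor_set p" "x = (e + x') / p"
      using cantor_set_first_digit[OF p Suc.prems] .
    have "cis (2 * pi * x) ^ (p ^ Suc k) = (cis (2 * pi * x) ^ p) ^ (p ^ k)"
      by (simp flip: power_mult)
    also have "\<dots> = cis (2 * pi * x') ^ (p ^ k)"
      using cis_digit_power[OF _ x'(1)] x'(3) assms by simp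
    finally show ?case using Suc.IH[OF x'(2)] by simp
  qed auto
  then have "Re (z ^ (p ^ k)) \<ge> - 1 / 2" for k
    unfolding x(2) using Re_cis_cantor_set[OF assms] by metis
  moreover have "\<exists>y\<in>cantor_ends p k. norm (z - cis (2 * pi * y)) \<le> 2 * pi / real p ^ k" for k
  proof -
    obtain y where y: "y\<in>cantor_ends p k" "\<bar>x - y\<bar> \<le> 1 / real p ^ k"
      using cantor_set_near_ends[OF p x(1)] by blast
    have "norm (z - cis (2 * pi * y)) \<le> \<bar>2 * pi * x - 2 * pi * y\<bar>"
      unfolding x(2) by (rule norm_cis_diff_le)
    also have "\<dots> = 2 * pi * \<bar>x - y\<bar>" by (simp add: abs_mult flip: right_diff_distrib)
    also have "\<dots> \<le> 2 * pi * (1 / real p ^ k)" using y(2) by (intro mult_left_mono) auto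
    finally show ?thesis using y(1) by auto
  qed
  ultimately show "z \<in> cantor_hull p" by (auto simp: cantor_hull_def x(2))
qed

section \<open>A damping function with uniformly summable Taylor coefficients\<close>

lemma power_div_fact_le_exp:
  assumes "0 \<le> (y::real)"
  shows "y ^ m / fact m \<le> exp y"
proof -
  have "(\<Sum>n\<in>{m}. y ^ n /\<^sub>R fact n) \<le> exp y"
    unfolding exp_def by (rule sum_le_suminf[OF summable_exp_generic]) (use assms in auto)
  then show ?thesis by (simp add: field_simps)
qed

text \<open>For \<open>m\<close> with \<open>b < a ^ m\<close>, the power \<open>b ^ k\<close> is at
  most a multiple of \<open>(c * a ^ k) ^ m\<close>, and one term of the exponential series absorbs
  the latter.\<close>

lemma power_exp_bounded:
  assumes "1 < (a::real)" "1 < b" "0 < c"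
  obtains C where "0 < C" "\<And>k::nat. b ^ k * exp (- c * a ^ k) \<le> C"
proof -
  obtain m where m: "b < a ^ m" using real_arch_pow[OF assms(1)] by blast
  show ?thesis
  proof
    show "(0::real) < fact m / c ^ m" using assms by simp
    fix k :: nat
    have "c ^ m * b ^ k \<le> c ^ m * (a ^ m) ^ k"
      using m assms by (intro mult_left_mono power_mono) auto
    also have "\<dots> = (c * a ^ k) ^ m"
      by (simp add: power_mult_distrib mult.commute flip: power_mult)
    also have "\<dots> \<le> fact m * exp (c * a ^ k)"
      using power_div_fact_le_exp[of "c * a ^ k" m] assms by (simp add: field_simps)
    finally have "c ^ m * b ^ k \<le> fact m * exp (c * a ^ k)" .
    then show "b ^ k * exp (- c * a ^ k) \<le> fact m / c ^ m"
      using assms by (simp add: exp_minus field_simps)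
  qed
qed

text \<open>Its only zero is \<open>(1 + 1 / p ^ k) * cis (2 * pi * x)\<close>, at distance
  \<open>1 / p ^ k\<close> from the endpoint. The rotation is put on \<open>v\<close>, so that the
  real part is positive on the whole closed disc.\<close>

definition pole_factor :: "nat \<Rightarrow> complex \<Rightarrow> nat \<times> real \<Rightarrow> complex" where
  "pole_factor p v = (\<lambda>(k, x). 1 + 1 / real p ^ k - cis (- (2 * pi * x)) * v)"

text \<open>Pairs are used because the same endpoint recurs at higher orders and then carries one
  pole for each order.\<close>

definition pole_index :: "nat \<Rightarrow> nat \<Rightarrow> (nat \<times> real) set" where
  "pole_index p l = (SIGMA k:{..l}. cantor_ends p k)"

text \<open>This is the function \<open>H\<^sub>l\<close> of the introduction.\<close>

definition pole_sum :: "nat \<Rightarrow> real \<Rightarrow> nat \<Rightarrow> complex \<Rightarrow> complex" where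
  "pole_sum p s l v = (\<Sum>i\<in>pole_index p l. s ^ fst i / pole_factor p v i)"

lemma finite_pole_index [simp]: "finite (pole_index p l)"
  by (auto simp: pole_index_def finite_cantor_ends)

lemma Re_pole_factor:
  "1 + 1 / real p ^ k - norm v \<le> Re (pole_factor p v (k, x))"
proof -
  have "Re (cis (- (2 * pi * x)) * v) \<le> norm (cis (- (2 * pi * x)) * v)" by (rule complex_Re_le_cmod)
  also have "\<dots> = norm v" by (simp add: norm_mult)
  finally show ?thesis 
    by (simp add: pole_factor_def flip: of_real_power of_real_divide)
qed

lemma norm_pole_factor_le:
  "norm (pole_factor p v (k, x)) \<le> 1 / real p ^ k + norm (v - cis (2 * pi * x))"
proof -
  have "pole_factor p v (k, x) = 1 / real p ^ k + cis (- (2 * pi * x)) * (cis (2 * pi * x) - v)"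
    by (simp add: pole_factor_def algebra_simps cis_mult)
  also have "norm \<dots> \<le> norm (1 / complex_of_real (real p ^ k)) + norm (cis (- (2 * pi * x)) * (cis (2 * pi * x) - v))"
    using norm_triangle_ineq by simp
  also have "\<dots> = 1 / real p ^ k + norm (v - cis (2 * pi * x))"
    by (simp add: norm_mult norm_divide norm_power norm_minus_commute)
  finally show ?thesis .
qed

lemma Re_of_real_divide: "Re (of_real r / z) = r * Re z / (norm z)\<^sup>2"
  by (simp add: Re_divide cmod_power2)

lemma inverse_power_antimono: "p \<ge> 1 \<Longrightarrow> k \<le> l \<Longrightarrow> 1 / real p ^ l \<le> 1 / real p ^ k"
  by (intro divide_left_mono power_increasing) auto

section \<open>Size of the pole sum on the disc and at the origin\<close>

context
  fixes p :: nat and s :: real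
  assumes p: "p \<ge> 2" and s: "1 / p < s" "s < 1 / 2"
begin

lemma s_pos: "s > 0" using p s by (smt (verit) divide_nonneg_nonneg of_nat_0_le_iff)

lemma sp_gt_1: "s * p > 1" using p s by (simp add: field_simps)

lemma Re_pole_factor_pos:
  assumes "i \<in> pole_index p l" "norm v < 1 + 1 / real p ^ l"
  shows "Re (pole_factor p v i) > 0"
proof -
  obtain k x where i: "i = (k, x)" by (cases i)
  have "k \<le> l" using assms by (auto simp: i pole_index_def)
  then have "1 / real p ^ l \<le> 1 / real p ^ k" using p by (intro inverse_power_antimono) auto
  with Re_pole_factor[of p k v x] show ?thesis using assms(2) unfolding i by linarith
qed

lemma pole_factor_nonzero:
  assumes "i \<in> pole_index p l" "norm v < 1 + 1 / real p ^ l"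
  shows "pole_factor p v i \<noteq> 0"
  using Re_pole_factor_pos[OF assms] by auto

text \<open>Every summand has nonnegative real part in this disc, so any single pole gives a lower
  bound.\<close>

lemma Re_pole_sum_ge:
  assumes "i \<in> pole_index p l" "norm v < 1 + 1 / real p ^ l"
  shows "s ^ fst i * Re (pole_factor p v i) / (norm (pole_factor p v i))\<^sup>2 \<le> Re (pole_sum p s l v)"
proof -
  have "Re (pole_sum p s l v) = (\<Sum>i\<in>pole_index p l. s ^ fst i * Re (pole_factor p v i) / (norm (pole_factor p v i))\<^sup>2)"
    by (simp add: pole_sum_def Re_of_real_divide flip: of_real_power)
  also have "\<dots> \<ge> s ^ fst i * Re (pole_factor p v i) / (norm (pole_factor p v i))\<^sup>2"
    using assms s_pos
    by (intro member_le_sum) (auto intro!: divide_nonneg_nonneg mult_nonneg_nonneg less_imp_le[OF Re_pole_factor_pos])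
  finally show ?thesis .
qed

lemma Re_pole_sum_nonneg:
  assumes "norm v < 1 + 1 / real p ^ l"
  shows "0 \<le> Re (pole_sum p s l v)"
proof -
  have "(0, 0) \<in> pole_index p l" by (auto simp: pole_index_def)
  from Re_pole_sum_ge[OF this assms] Re_pole_factor_pos[OF this assms] show ?thesis
    by (smt (verit) divide_nonneg_nonneg mult_nonneg_nonneg s_pos zero_le_power zero_le_power2)
qed

text \<open>At most \<open>2 ^ k\<close> poles of order \<open>k\<close>, each of weight
  \<open>s ^ k\<close>, are dominated by a geometric series of ratio
  \<open>2 * s < 1\<close>.\<close>

lemma sum_weights_le: "(\<Sum>i\<in>pole_index p l. s ^ fst i) \<le> 1 / (1 - 2 * s)"
proof -
  have "(\<Sum>i\<in>pole_index p l. s ^ fst i) = (\<Sum>k\<le>l. \<Sum>x\<in>cantor_ends p k. s ^ k)"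
    unfolding pole_index_def by (subst sum.Sigma) (auto simp: finite_cantor_ends case_prod_unfold)
  also have "\<dots> = (\<Sum>k\<le>l. real (card (cantor_ends p k)) * s ^ k)" by simp
  also have "\<dots> \<le> (\<Sum>k\<le>l. (2 * s) ^ k)"
  proof (rule sum_mono)
    fix k
    have "real (card (cantor_ends p k)) \<le> 2 ^ k"
      using card_cantor_ends[of p k] by (metis of_nat_le_iff of_nat_numeral of_nat_power)
    then show "real (card (cantor_ends p k)) * s ^ k \<le> (2 * s) ^ k"
      using s_pos by (simp add: power_mult_distrib mult_right_mono)
  qed
  also have "\<dots> \<le> (\<Sum>k. (2 * s) ^ k)"
    using s s_pos by (intro sum_le_suminf summable_geometric) auto
  also have "\<dots> = 1 / (1 - 2 * s)"
    using s s_pos by (intro suminf_geometric) auto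
  finally show ?thesis .
qed

text \<open>At the origin every factor has modulus at least 1, so only the total weight counts. This
  keeps the damping function away from 0 there, uniformly in \<open>l\<close>.\<close>

lemma norm_pole_sum_0: "norm (pole_sum p s l 0) \<le> 1 / (1 - 2 * s)"
proof -
  have "norm (pole_sum p s l 0) \<le> (\<Sum>i\<in>pole_index p l. norm (complex_of_real s ^ fst i / pole_factor p 0 i))"
    unfolding pole_sum_def by (rule norm_sum)
  also have "\<dots> \<le> (\<Sum>i\<in>pole_index p l. s ^ fst i)"
  proof (rule sum_mono)
    fix i assume "i \<in> pole_index p l"
    obtain k x where i: "i = (k, x)" by (cases i)
    have "1 \<le> Re (pole_factor p 0 i)" 
      using Re_pole_factor[of p k 0 x] by (simp add: i) (smt (verit) divide_nonneg_nonneg of_nat_0_le_iff zero_le_power)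
    also have "\<dots> \<le> norm (pole_factor p 0 i)" by (rule complex_Re_le_cmod)
    finally have "1 \<le> norm (pole_factor p 0 i)" .
    then have "s ^ fst i / norm (pole_factor p 0 i) \<le> s ^ fst i / 1"
      using s_pos by (intro divide_left_mono) auto
    then show "norm (complex_of_real s ^ fst i / pole_factor p 0 i) \<le> s ^ fst i"
      using s_pos by (simp add: norm_divide norm_power)
  qed
  also note sum_weights_le
  finally show ?thesis .
qed

section \<open>Derivatives of the pole sum and of its exponential\<close>

definition "pole_sum' l v = (\<Sum>i\<in>pole_index p l. s ^ fst i * cis (- (2 * pi * snd i)) / pole_factor p v i ^ 2)"
definition "pole_sum'' l v = (\<Sum>i\<in>pole_index p l. 2 * s ^ fst i * cis (- (2 * pi * snd i)) ^ 2 / pole_factor p v i ^ 3)"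

lemma pole_factor_deriv:
  "((\<lambda>v. pole_factor p v i) has_field_derivative - cis (- (2 * pi * snd i))) (at v)"
  unfolding pole_factor_def case_prod_unfold by (auto intro!: derivative_eq_intros)

lemma pole_sum_deriv:
  assumes "norm v < 1 + 1 / real p ^ l"
  shows "(pole_sum p s l has_field_derivative pole_sum' l v) (at v)"
  unfolding pole_sum_def pole_sum'_def
proof (rule DERIV_sum)
  fix i assume i: "i \<in> pole_index p l"
  note nz = pole_factor_nonzero[OF i assms]
  note [derivative_intros] = pole_factor_deriv
  show "((\<lambda>v. complex_of_real s ^ fst i / pole_factor p v i) has_field_derivative
     s ^ fst i * cis (- (2 * pi * snd i)) / pole_factor p v i ^ 2) (at v)"
    by (auto intro!: derivative_eq_intros simp: nz power2_eq_square)
qed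

lemma pole_sum'_deriv:
  assumes "norm v < 1 + 1 / real p ^ l"
  shows "(pole_sum' l has_field_derivative pole_sum'' l v) (at v)"
  unfolding pole_sum'_def pole_sum''_def
proof (rule DERIV_sum)
  fix i assume i: "i \<in> pole_index p l"
  note nz = pole_factor_nonzero[OF i assms]
  note [derivative_intros] = pole_factor_deriv
  show "((\<lambda>v. complex_of_real (s ^ fst i) * cis (- (2 * pi * snd i)) / pole_factor p v i ^ 2) has_field_derivative
     2 * s ^ fst i * cis (- (2 * pi * snd i)) ^ 2 / pole_factor p v i ^ 3) (at v)"
    by (auto intro!: derivative_eq_intros simp: nz field_simps power2_eq_square power3_eq_cube)
qed

lemma norm_pole_sum'_le:
  assumes "\<And>i. i \<in> pole_index p l \<Longrightarrow> norm (pole_factor p v i) \<ge> t" "t > 0"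
  shows "norm (pole_sum' l v) \<le> 1 / (1 - 2 * s) / t ^ 2"
    and "norm (pole_sum'' l v) \<le> 2 * (1 / (1 - 2 * s)) / t ^ 3"
proof -
  have le: "c / norm (pole_factor p v i) ^ n \<le> c / t ^ n" if "i \<in> pole_index p l" "c \<ge> 0" for i c n
    using assms(1)[OF that(1)] assms(2) that(2)
    by (intro divide_left_mono power_mono mult_pos_pos zero_less_power) auto
  have "norm (pole_sum' l v) \<le> (\<Sum>i\<in>pole_index p l. norm (s ^ fst i * cis (- (2 * pi * snd i)) / pole_factor p v i ^ 2))"
    unfolding pole_sum'_def by (rule norm_sum)
  also have "\<dots> \<le> (\<Sum>i\<in>pole_index p l. s ^ fst i / t ^ 2)"
    using s_pos assms by (intro sum_mono) (simp add: norm_divide norm_mult norm_power le)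
  also have "\<dots> \<le> 1 / (1 - 2 * s) / t ^ 2"
    unfolding sum_divide_distrib[symmetric] by (intro divide_right_mono sum_weights_le) auto
  finally show "norm (pole_sum' l v) \<le> 1 / (1 - 2 * s) / t ^ 2" .
  have "norm (pole_sum'' l v) \<le> (\<Sum>i\<in>pole_index p l. norm (2 * s ^ fst i * cis (- (2 * pi * snd i)) ^ 2 / pole_factor p v i ^ 3))"
    unfolding pole_sum''_def by (rule norm_sum)
  also have "\<dots> \<le> (\<Sum>i\<in>pole_index p l. s ^ fst i * 2 / t ^ 3)"
    using s_pos assms by (intro sum_mono) (simp add: norm_divide norm_mult norm_power mult.commute le)
  also have "\<dots> = (\<Sum>i\<in>pole_index p l. s ^ fst i) * 2 / t ^ 3"
    by (simp add: sum_divide_distrib sum_distrib_right)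
  also have "\<dots> \<le> 1 / (1 - 2 * s) * 2 / t ^ 3"
    using assms(2) by (intro divide_right_mono mult_right_mono sum_weights_le) auto
  finally show "norm (pole_sum'' l v) \<le> 2 * (1 / (1 - 2 * s)) / t ^ 3" by (simp add: mult.commute)
qed

text \<open>This is the function \<open>F\<^sub>l\<close> of the introduction.\<close>

definition "damping l v = exp (- pole_sum p s l v)"

definition "damping'' l v = (pole_sum' l v ^ 2 - pole_sum'' l v) * damping l v"

lemma damping_deriv:
  assumes "norm v < 1 + 1 / real p ^ l"
  shows "(damping l has_field_derivative - pole_sum' l v * damping l v) (at v)"
  using DERIV_chain2[OF DERIV_exp DERIV_minus[OF pole_sum_deriv[OF assms]]]
  by (simp add: damping_def[abs_def] mult.commute)

lemma damping_holomorphic: "damping l holomorphic_on ball 0 (1 + 1 / real p ^ l)"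
  unfolding holomorphic_on_open[OF open_ball] by (metis damping_deriv mem_ball_0)

lemma damping_deriv2:
  assumes "norm v < 1 + 1 / real p ^ l"
  shows "(deriv ^^ 2) (damping l) v = damping'' l v"
proof -
  have "(deriv ^^ 2) (damping l) v = deriv (deriv (damping l)) v" by (simp add: numeral_2_eq_2)
  also have "\<dots> = deriv (\<lambda>v. - pole_sum' l v * damping l v) v"
  proof (rule deriv_cong_ev)
    have "\<forall>\<^sub>F x in nhds v. x \<in> ball 0 (1 + 1 / real p ^ l)"
      using assms by (intro eventually_nhds_in_open) auto
    then show "\<forall>\<^sub>F x in nhds v. deriv (damping l) x = - pole_sum' l x * damping l x"
      by eventually_elim (simp add: DERIV_imp_deriv[OF damping_deriv])
  qed auto
  also have "\<dots> = damping'' l v"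
    by (rule DERIV_imp_deriv)
       (auto intro!: derivative_eq_intros pole_sum'_deriv[OF assms] damping_deriv[OF assms] simp: damping''_def algebra_simps power2_eq_square)
  finally show ?thesis .
qed

lemma norm_damping: "norm (damping l v) = exp (- Re (pole_sum p s l v))"
  by (simp add: damping_def)

lemma norm_damping_le_1:
  assumes "norm v < 1 + 1 / real p ^ l"
  shows "norm (damping l v) \<le> 1"
  using Re_pole_sum_nonneg[OF assms] by (simp add: norm_damping)

lemma norm_damping_0: "norm (damping l 0) \<ge> exp (- (1 / (1 - 2 * s)))"
  using norm_pole_sum_0[of l] complex_Re_le_cmod[of "pole_sum p s l 0"] by (simp add: norm_damping)

text \<open>The pole of order \<open>l\<close> at \<open>x\<close> suffices. With
  \<open>t = 1 / p ^ l\<close>, its factor has modulus at most \<open>(20 + 1) * t\<close> and real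
  part at least \<open>t / 2\<close>, since \<open>v\<close> leaves the disc by at most half the
  distance to the poles of order \<open>l\<close>; and \<open>882 = 2 * 21\<^sup>2\<close>.\<close>

lemma norm_damping_near:
  assumes "x \<in> cantor_ends p l" "norm v \<le> 1 + 1 / (2 * real p ^ l)" "norm (v - cis (2 * pi * x)) \<le> 20 / real p ^ l"
  shows "norm (damping l v) \<le> exp (- ((s * p) ^ l / 882))"
proof -
  define t where "t = 1 / real p ^ l"
  have t: "t > 0" using p by (simp add: t_def)
  define d where "d = pole_factor p v (l, x)"
  have v: "norm v < 1 + 1 / real p ^ l" using assms(2) t unfolding t_def by (simp add: field_simps)
  have i: "(l, x) \<in> pole_index p l" using assms(1) by (auto simp: pole_index_def)
  have 1: "norm d \<le> 21 * t" using norm_pole_factor_le[of p v l x] assms(3) by (simp add: d_def t_def)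
  have 2: "Re d \<ge> t / 2" using Re_pole_factor[of p l v x] assms(2) by (simp add: d_def t_def)
  have "(s * p) ^ l / 882 = s ^ l * (t / 2) / (21 * t)\<^sup>2"
    using t by (simp add: t_def power_mult_distrib power2_eq_square field_simps)
  also have "\<dots> \<le> s ^ l * Re d / (norm d)\<^sup>2"
    using 1 2 t s_pos by (intro frac_le mult_left_mono power_mono zero_less_power) 
       (auto intro!: mult_nonneg_nonneg)
  also have "\<dots> \<le> Re (pole_sum p s l v)"
    using Re_pole_sum_ge[OF i v] by (simp add: d_def)
  finally show ?thesis by (simp add: norm_damping)
qed

text \<open>The scale \<open>p\<^sup>-\<^sup>k\<close> is the distance of \<open>v\<close> to the poles. For \<open>k > 0\<close> a single pole of order \<open>k\<close>, the
ancestor of the nearest one, already makes the real part large.\<close>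

lemma pole_scale:
  assumes "norm v \<le> 1"
  obtains k where "\<And>i. i \<in> pole_index p l \<Longrightarrow> norm (pole_factor p v i) \<ge> 1 / real p ^ k"
    and "k = 0 \<or> Re (pole_sum p s l v) \<ge> (s * p) ^ k / (81 * p\<^sup>2)"
proof -
  have v: "norm v < 1 + 1 / real p ^ l" using assms p by (auto intro: le_less_trans)
  have "(0, 0) \<in> pole_index p l" by (auto simp: pole_index_def)
  then have "pole_index p l \<noteq> {}" by blast
  from ex_is_arg_min_if_finite[OF finite_pole_index this, of "\<lambda>i. norm (pole_factor p v i)"]
  obtain j where j: "j \<in> pole_index p l" "\<And>i. i \<in> pole_index p l \<Longrightarrow> norm (pole_factor p v j) \<le> norm (pole_factor p v i)"
    unfolding is_arg_min_linorder by blast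
  obtain k' x' where j': "j = (k', x')" "k' \<le> l" "x' \<in> cantor_ends p k'" using j(1) by (auto simp: pole_index_def)
  define t where "t = norm (pole_factor p v j)"
  have tk': "1 / real p ^ k' \<le> t"
    using Re_pole_factor[of p k' v x'] complex_Re_le_cmod[of "pole_factor p v j"] assms unfolding t_def j' by linarith
  \<comment> \<open>Such a \<open>k\<close> exists because the order \<open>k'\<close> of the
    nearest pole qualifies. Minimality will give \<open>t < p / p ^ k\<close> when
    \<open>k > 0\<close>, so \<open>1 / p ^ k\<close> measures the distance up to a factor
    \<open>p\<close>.\<close>
  define k where "k = (LEAST k. 1 / real p ^ k \<le> t)"
  have k: "1 / real p ^ k \<le> t" unfolding k_def by (rule LeastI[of _ k'], rule tk')
  have kk': "k \<le> k'" unfolding k_def by (rule Least_le, rule tk')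
  show ?thesis
  proof (rule that)
    show "norm (pole_factor p v i) \<ge> 1 / real p ^ k" if "i \<in> pole_index p l" for i
      using j(2)[OF that] k unfolding t_def by linarith
    show "k = 0 \<or> Re (pole_sum p s l v) \<ge> (s * p) ^ k / (81 * p\<^sup>2)"
    proof (cases k)
      case (Suc m)
      then have "m < k" by simp
      then have "\<not> 1 / real p ^ m \<le> t" unfolding k_def by (rule not_less_Least)
      define u where "u = 1 / real p ^ k"
      have u: "u > 0" using p by (simp add: u_def)
      have tu: "t < p * u" using \<open>\<not> 1 / real p ^ m \<le> t\<close> p Suc by (simp add: u_def)
      obtain y where y: "y \<in> cantor_ends p k" "\<bar>x' - y\<bar> \<le> u"
        using cantor_ends_coarsen[OF _ kk' j'(3)] p unfolding u_def by auto
      have i: "(k, y) \<in> pole_index p l" using y kk' j' by (auto simp: pole_index_def)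
      define d where "d = pole_factor p v (k, y)"
      have Red: "Re d \<ge> u" using Re_pole_factor[of p k v y] assms by (simp add: d_def u_def)
      \<comment> \<open>Passing from the nearest pole to its ancestor costs at most \<open>u\<close>
        radially and \<open>2 * pi * u \<le> 7 * u\<close> in angle. Together with
        \<open>t < p * u\<close> this gives \<open>norm d \<le> 9 * (p * u)\<close>, the source of
        the constant \<open>81 * p\<^sup>2\<close>.\<close>
      have "d - pole_factor p v j = (of_real u - of_real (1 / real p ^ k')) + (cis (- (2 * pi * x')) - cis (- (2 * pi * y))) * v"
        by (simp add: d_def j' pole_factor_def u_def algebra_simps)
      also have "norm \<dots> \<le> \<bar>u - 1 / real p ^ k'\<bar> + norm (cis (- (2 * pi * x')) - cis (- (2 * pi * y))) * norm v"
        by (metis (no_types, lifting) norm_mult norm_of_real norm_triangle_ineq of_real_diff)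
      also have "\<dots> \<le> u + norm (cis (- (2 * pi * x')) - cis (- (2 * pi * y))) * 1"
      proof (intro add_mono mult_left_mono assms)
        have "1 / real p ^ k' \<le> u" unfolding u_def using p kk' by (intro inverse_power_antimono) auto
        moreover have "1 / real p ^ k' \<ge> 0" by simp
        ultimately show "\<bar>u - 1 / real p ^ k'\<bar> \<le> u" by linarith
      qed auto
      also have "norm (cis (- (2 * pi * x')) - cis (- (2 * pi * y))) \<le> \<bar>- (2 * pi * x') - (- (2 * pi * y))\<bar>"
        by (rule norm_cis_diff_le)
      also have "\<dots> = 2 * pi * \<bar>x' - y\<bar>" by (simp add: abs_mult abs_minus_commute flip: right_diff_distrib)
      also have "2 * pi * \<bar>x' - y\<bar> \<le> 2 * pi * u" using y(2) by (intro mult_left_mono) auto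
      also have "\<dots> \<le> 7 * u" using u pi_less_4 pi_approx by (intro mult_right_mono) auto
      finally have "norm (d - pole_factor p v j) \<le> 8 * u" by simp
      then have "norm d \<le> t + 8 * u" unfolding t_def using norm_triangle_ineq2[of d "pole_factor p v j"] by linarith
      also have "\<dots> \<le> 9 * (p * u)" 
      proof -
        have "u \<le> p * u" using u p by simp
        then show ?thesis using tu by linarith
      qed
      finally have nd: "norm d \<le> 9 * (p * u)" .
      have "(s * p) ^ k / (81 * p\<^sup>2) = s ^ k * u / (9 * (p * u))\<^sup>2"
        using u p by (simp add: u_def power_mult_distrib power2_eq_square field_simps)
      also have "\<dots> \<le> s ^ k * Re d / (norm d)\<^sup>2"
      proof (intro frac_le mult_left_mono power_mono nd Red zero_less_power mult_nonneg_nonneg)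
        show "norm d > 0" using Red u complex_Re_le_cmod[of d] by linarith
      qed (use s_pos u Red in auto)
      also have "\<dots> \<le> Re (pole_sum p s l v)"
        using Re_pole_sum_ge[OF i v] by (simp add: d_def)
      finally show ?thesis by simp
    qed auto
  qed
qed

text \<open>At distance about \<open>p ^ - k\<close> from the poles, the rational factor is of size
  at most \<open>(p ^ 4) ^ k\<close>, while the exponential is at most
  \<open>exp (- c * (s * p) ^ k)\<close> up to a constant. Since \<open>s * p > 1\<close>, the
  exponential wins, with a bound that depends neither on \<open>k\<close> nor on
  \<open>l\<close>.\<close>

lemma damping''_bounded:
  obtains B where "0 < B" "\<And>l v. norm v \<le> 1 \<Longrightarrow> norm (damping'' l v) \<le> B"
proof -
  define c where "c = 1 / (81 * real p ^ 2)"
  have c: "c > 0" using p by (simp add: c_def)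
  have "real p ^ 4 > 1" using p by (intro one_less_power) auto
  obtain C where C: "C > 0" "\<And>k::nat. (real p ^ 4) ^ k * exp (- c * (s * p) ^ k) \<le> C"
    using power_exp_bounded[OF sp_gt_1 \<open>real p ^ 4 > 1\<close> c] by blast
  define Q where "Q = 1 / (1 - 2 * s)"
  have Q: "Q > 0" using s by (simp add: Q_def)
  show ?thesis
  proof
    show "(Q\<^sup>2 + 2 * Q) * (exp c * C) > 0" using Q C by (intro mult_pos_pos add_pos_pos) auto
    fix l v assume v: "norm (v::complex) \<le> 1"
    from pole_scale[OF v] obtain k where k: "\<And>i. i \<in> pole_index p l \<Longrightarrow> norm (pole_factor p v i) \<ge> 1 / real p ^ k"
      "k = 0 \<or> Re (pole_sum p s l v) \<ge> (s * p) ^ k / (81 * p\<^sup>2)" by blast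
    have v': "norm v < 1 + 1 / real p ^ l" using v p by (auto intro: le_less_trans)
    have pk: "1 / real p ^ k > 0" using p by simp
    have p1: "real p ^ k \<ge> 1" using p by simp
    have "norm (pole_sum' l v) \<le> Q * (real p ^ k) ^ 2"
      using norm_pole_sum'_le(1)[OF k(1) pk] by (simp add: Q_def field_simps)
    then have 1: "norm (pole_sum' l v ^ 2) \<le> (Q * (real p ^ k) ^ 2) ^ 2"
      unfolding norm_power by (intro power_mono) auto
    have 2: "norm (pole_sum'' l v) \<le> 2 * Q * (real p ^ k) ^ 3"
      using norm_pole_sum'_le(2)[OF k(1) pk] by (simp add: Q_def field_simps)
    also have "\<dots> \<le> 2 * Q * (real p ^ k) ^ 4"
      using Q p1 by (intro mult_left_mono power_increasing) auto
    finally have "norm (pole_sum' l v ^ 2 - pole_sum'' l v) \<le> (Q * (real p ^ k) ^ 2) ^ 2 + 2 * Q * (real p ^ k) ^ 4"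
      using 1 norm_triangle_ineq4[of "pole_sum' l v ^ 2" "pole_sum'' l v"] by linarith
    also have "\<dots> = (Q\<^sup>2 + 2 * Q) * (real p ^ 4) ^ k"
      by (simp add: power_mult_distrib algebra_simps flip: power_mult)
    finally have 3: "norm (pole_sum' l v ^ 2 - pole_sum'' l v) \<le> (Q\<^sup>2 + 2 * Q) * (real p ^ 4) ^ k" .
    have "k = 0 \<or> c * (s * p) ^ k \<le> Re (pole_sum p s l v)"
      using k(2) by (simp add: c_def)
    \<comment> \<open>Subtracting \<open>c\<close> also covers \<open>k = 0\<close>, where only
      nonnegativity of the real part is available.\<close>
    then have "c * (s * p) ^ k - c \<le> Re (pole_sum p s l v)"
      using Re_pole_sum_nonneg[OF v'] c by (elim disjE) simp_all
    then have 4: "norm (damping l v) \<le> exp (c + - c * (s * p) ^ k)" by (simp add: norm_damping)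
    have "norm (damping'' l v) \<le> ((Q\<^sup>2 + 2 * Q) * (real p ^ 4) ^ k) * exp (c + - c * (s * p) ^ k)"
      unfolding damping''_def norm_mult using Q by (intro mult_mono 3 4) auto
    also have "\<dots> = (Q\<^sup>2 + 2 * Q) * (exp c * ((real p ^ 4) ^ k * exp (- c * (s * p) ^ k)))"
      by (simp only: exp_add mult_ac)
    also have "\<dots> \<le> (Q\<^sup>2 + 2 * Q) * (exp c * C)"
      using Q C(2)[of k] by (intro mult_left_mono) auto
    finally show "norm (damping'' l v) \<le> (Q\<^sup>2 + 2 * Q) * (exp c * C)" .
  qed
qed

text \<open>A second derivative bounded on the unit circle makes the Taylor coefficients decay like
  the inverse square of their index. As the bound does not depend on \<open>l\<close>, neither does
  the sum.\<close>

lemma damping_coeffs: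
  obtains A where "\<And>l. summable (\<lambda>n. norm ((deriv ^^ Suc n) (damping l) 0 / fact (Suc n)))"
     "\<And>l. (\<Sum>n. norm ((deriv ^^ Suc n) (damping l) 0 / fact (Suc n))) \<le> A"
proof -
  obtain B where B: "0 < B" "\<And>l v. norm v \<le> 1 \<Longrightarrow> norm (damping'' l v) \<le> B" using damping''_bounded by blast
  \<comment> \<open>The index is shifted by one: \<open>g 0\<close> majorises the coefficient of
    order 1, for which \<open>norm (damping l v) \<le> 1\<close> suffices, and
    \<open>g (Suc m)\<close> that of order \<open>m + 2\<close>. The majorants telescope.\<close>
  define g where "g n = (case n of 0 \<Rightarrow> 1 | Suc m \<Rightarrow> B * (1 / real (Suc m) - 1 / real (Suc (Suc m))))" for n
  have "(\<lambda>m. 1 / real (Suc m) - 1 / real (Suc (Suc m))) sums (1 / real (Suc 0) - 0)"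
    by (rule telescope_sums') real_asymp
  then have "(\<lambda>m. g (Suc m)) sums (B * 1)" unfolding g_def using sums_mult by fastforce
  then have g: "g sums (B + 1)" by (subst (asm) sums_Suc_iff) (simp add: g_def)
  have le: "norm ((deriv ^^ Suc n) (damping l) 0 / fact (Suc n)) \<le> g n" for l n
  proof -
    have R: "1 < 1 + 1 / real p ^ l" using p by simp
    have hol: "damping l holomorphic_on ball 0 (1 + 1 / real p ^ l)" by (rule damping_holomorphic)
    have sub: "cball (0::complex) 1 \<subseteq> ball 0 (1 + 1 / real p ^ l)" 
    proof
      fix x :: complex assume "x \<in> cball 0 1"
      then have "norm x \<le> 1" by simp
      then have "norm x < 1 + 1 / real p ^ l" using R by (rule le_less_trans)
      then show "x \<in> ball 0 (1 + 1 / real p ^ l)" by simp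
    qed
    show ?thesis
    proof (cases n)
      case 0
      have "norm ((deriv ^^ 1) (damping l) 0) \<le> fact 1 * 1 / 1 ^ 1"
      proof (rule Cauchy_inequality)
        show "damping l holomorphic_on ball 0 1" by (rule holomorphic_on_subset[OF hol]) (use sub in auto)
        show "continuous_on (cball 0 1) (damping l)" 
          by (rule continuous_on_subset[OF holomorphic_on_imp_continuous_on[OF hol]]) (use sub in auto)
        show "norm (damping l x) \<le> 1" if "norm (0 - x) = 1" for x
          by (rule norm_damping_le_1) (use that R in auto)
      qed auto
      then show ?thesis by (simp add: 0 g_def)
    next
      case (Suc m)
      have hol2: "(deriv ^^ 2) (damping l) holomorphic_on ball 0 (1 + 1 / real p ^ l)"
        by (rule holomorphic_higher_deriv[OF hol]) auto
      \<comment> \<open>Order \<open>m\<close> for the second derivative is order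
        \<open>m + 2 = Suc n\<close> for the function itself; division by
        \<open>fact (m + 2)\<close> leaves \<open>B / ((m + 1) * (m + 2))\<close>.\<close>
      have "norm ((deriv ^^ m) ((deriv ^^ 2) (damping l)) 0) \<le> fact m * B / 1 ^ m"
      proof (rule Cauchy_inequality)
        show "(deriv ^^ 2) (damping l) holomorphic_on ball 0 1" by (rule holomorphic_on_subset[OF hol2]) (use sub in auto)
        show "continuous_on (cball 0 1) ((deriv ^^ 2) (damping l))" 
          by (rule continuous_on_subset[OF holomorphic_on_imp_continuous_on[OF hol2]]) (use sub in auto)
        show "norm ((deriv ^^ 2) (damping l) x) \<le> B" if "norm (0 - x) = 1" for x
          using that R B(2)[of x l] by (subst damping_deriv2) auto
      qed auto
      also have "(deriv ^^ m) ((deriv ^^ 2) (damping l)) = (deriv ^^ Suc n) (damping l)"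
        by (simp only: Suc flip: funpow_add comp_apply[of "deriv ^^ m" "deriv ^^ 2"]) simp
      finally have "norm ((deriv ^^ Suc n) (damping l) 0 / fact (Suc n)) \<le> fact m * B / fact (Suc n)"
        unfolding norm_divide by (simp add: divide_right_mono del: fact_Suc funpow.simps)
      also have "fact (Suc n) = (real (Suc m) * real (Suc (Suc m))) * fact m"
        by (simp add: Suc algebra_simps)
      also have "fact m * B / ((real (Suc m) * real (Suc (Suc m))) * fact m) = B / (real (Suc m) * real (Suc (Suc m)))"
        by simp
      also have "\<dots> = g n" by (simp add: g_def Suc field_simps)
      finally show ?thesis .
    qed
  qed
  show ?thesis
  proof
    fix l
    show 1: "summable (\<lambda>n. norm ((deriv ^^ Suc n) (damping l) 0 / fact (Suc n)))"
      by (rule summable_comparison_test'[OF sums_summable[OF g], of 0]) (simp only: real_norm_def abs_norm_cancel le)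
    show "(\<Sum>n. norm ((deriv ^^ Suc n) (damping l) 0 / fact (Suc n))) \<le> B + 1"
      unfolding sums_unique[OF g] by (rule suminf_le[OF le 1 sums_summable[OF g]])
  qed
qed

end

section \<open>Holomorphic functions across a line of singularities\<close>

text \<open>In the right half-plane the argument of \<open>w\<close> is below \<open>pi / 2\<close>
  in modulus, so that of the power \<open>- \<beta>\<close> is below
  \<open>\<beta> * pi / 2\<close>.\<close>

lemma Re_exp_neg_Ln_ge:
  assumes "Re w > 0" "0 < \<beta>" "\<beta> < 1"
  shows "norm w powr - \<beta> * cos (\<beta> * pi / 2) \<le> Re (exp (- (of_real \<beta> * Ln w)))"
proof -
  have w: "w \<noteq> 0" using assms by auto
  have "\<bar>Im (Ln w)\<bar> < pi / 2" using Re_Ln_pos_lt[OF w] assms by simp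
  then have "\<bar>\<beta> * Im (Ln w)\<bar> \<le> \<beta> * pi / 2" using assms by (simp add: abs_mult)
  moreover have "\<beta> * pi / 2 \<le> pi" using assms pi_gt_zero by (simp add: mult_le_cancel_right1)
  ultimately have "cos (\<beta> * pi / 2) \<le> cos \<bar>\<beta> * Im (Ln w)\<bar>"
    by (intro cos_monotone_0_pi_le) auto
  then have "norm w powr - \<beta> * cos (\<beta> * pi / 2) \<le> norm w powr - \<beta> * cos (\<beta> * Im (Ln w))"
    by (intro mult_left_mono) (auto simp: abs_if split: if_splits)
  also have "\<dots> = Re (exp (- (of_real \<beta> * Ln w)))"
    using w by (simp add: Re_exp powr_def)
  finally show ?thesis .
qed

lemma one_minus_square_sphere:
  assumes "norm z = 1"
  shows "norm (1 - z\<^sup>2) = 2 * \<bar>Im z\<bar>"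
proof -
  have "1 - z\<^sup>2 = z * (cnj z - z)"
    using assms complex_norm_square[of z] by (simp add: algebra_simps power2_eq_square)
  also have "norm \<dots> = norm (cnj z - z)" using assms by (simp add: norm_mult)
  also have "cnj z - z = - (2 * \<i> * Im z)" by (simp add: complex_eq_iff)
  finally show ?thesis by (simp add: norm_mult)
qed

lemma Re_one_minus_square_pos:
  assumes "norm z \<le> 1" "z\<^sup>2 \<noteq> 1"
  shows "Re (1 - z\<^sup>2) > 0"
proof (rule ccontr)
  assume "\<not> Re (1 - z\<^sup>2) > 0"
  then have 1: "Re (z\<^sup>2) \<ge> 1" by simp
  have n: "norm (z\<^sup>2) \<le> 1" using assms by (simp add: norm_power power_le_one)
  then have "(Re (z\<^sup>2))\<^sup>2 + (Im (z\<^sup>2))\<^sup>2 \<le> 1"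
    by (metis cmod_power2 norm_ge_zero power_le_one)
  moreover have "(Re (z\<^sup>2))\<^sup>2 \<ge> 1" using 1 by (simp add: one_le_power)
  ultimately have "(Im (z\<^sup>2))\<^sup>2 \<le> 0" by linarith
  then have "Im (z\<^sup>2) = 0" by simp
  moreover have "Re (z\<^sup>2) = 1" using 1 n complex_Re_le_cmod[of "z\<^sup>2"] by linarith
  ultimately have "z\<^sup>2 = 1" by (simp add: complex_eq_iff)
  with assms show False by simp
qed

text \<open>This is the majorant from which continuity of the multiplier at the two boundary points
  \<open>z = 1\<close> and \<open>z = - 1\<close> is deduced below.\<close>

lemma continuous_on_exp_neg_powr:
  assumes "0 < A" "0 < \<beta>"
  shows "continuous_on {0..} (\<lambda>x::real. if x = 0 then 0 else exp (- (A * x powr - \<beta>)))" (is "continuous_on _ ?g")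
  unfolding continuous_on_eq_continuous_within
proof
  fix x :: real assume "x \<in> {0..}"
  show "continuous (at x within {0..}) ?g"
  proof (cases "x = 0")
    case True
    have "((\<lambda>x. exp (- (A * x powr - \<beta>))) \<longlongrightarrow> 0) (at_right 0)"
      using assms by real_asymp
    moreover have "eventually (\<lambda>x. exp (- (A * x powr - \<beta>)) = ?g x) (at_right 0)"
      by (auto simp: eventually_at intro!: exI[of _ 1])
    ultimately have "(?g \<longlongrightarrow> 0) (at_right 0)" by (rule Lim_transform_eventually)
    then show ?thesis using True by (simp add: continuous_within at_within_Ici_at_right)
  next
    case False
    have e: "eventually (\<lambda>y. ?g y = exp (- (A * y powr - \<beta>))) (nhds x)"
      using eventually_nhds_in_open[of "- {0}" x] False by (auto elim: eventually_mono)
    have c: "isCont (\<lambda>y. exp (- (A * y powr - \<beta>))) x"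
      using False by (intro continuous_intros) auto
    have "isCont ?g x" using c isCont_cong[OF e] by blast
    then show ?thesis by (rule continuous_at_imp_continuous_at_within)
  qed
qed

text \<open>In the unit disc, \<open>(1 - z\<^sup>2)\<^sup>-\<^sup>\<beta>\<close> has positive real part, and on the unit circle that real part is
comparable with \<open>|Im z|\<^sup>-\<^sup>\<beta>\<close>. Multiplying by the exponential of a negative multiple of it therefore
allows the maximum principle to be applied.\<close>

lemma holomorphic_bound_across_real_line:
  fixes f :: "complex \<Rightarrow> complex"
  assumes hol: "f holomorphic_on ball (of_real x0) R" and \<rho>: "0 < \<rho>" "\<rho> < R"
    and \<beta>: "0 < \<beta>" "\<beta> < 1" and c: "0 \<le> c"
    and bound: "\<And>w. w \<in> ball (of_real x0) R \<Longrightarrow> Im w \<noteq> 0 \<Longrightarrow> norm (f w) \<le> exp (c * \<bar>Im w\<bar> powr - \<beta>)"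
    and w: "Re w = x0" "\<bar>Im w\<bar> < \<rho>"
  shows "norm (f w) \<le> exp ((c + 1) * (\<rho> / 2) powr - \<beta> / cos (\<beta> * pi / 2))"
proof -
  define \<kappa> where "\<kappa> = cos (\<beta> * pi / 2)"
  have \<kappa>: "\<kappa> > 0" unfolding \<kappa>_def by (intro cos_gt_zero_pi) (use \<beta> pi_gt_zero in \<open>auto simp: mult_less_cancel_right1 intro: less_trans[of _ 0]\<close>)
  \<comment> \<open>The disc has radius \<open>\<rho>\<close>, and the boundary point
    \<open>z\<close> corresponds to height \<open>\<rho> * \<bar>Im z\<bar> = (\<rho> / 2) * (2 *
    \<bar>Im z\<bar>)\<close>, where \<open>2 * \<bar>Im z\<bar> = norm (1 - z\<^sup>2)\<close>.
    This \<open>A\<close> makes the multiplier outweigh the growth of \<open>f\<close> there; the 1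
    keeps it positive when \<open>c = 0\<close>.\<close>
  define A where "A = (c + 1) * (\<rho> / 2) powr - \<beta> / \<kappa>"
  have A\<kappa>: "A * \<kappa> = (c + 1) * (\<rho> / 2) powr - \<beta>" using \<kappa> by (simp add: A_def)
  have A: "A > 0" using c \<rho> \<kappa> by (simp add: A_def)
  define V where "V z = exp (- (of_real \<beta> * Ln (1 - z\<^sup>2)))" for z
  \<comment> \<open>The value 0 is the continuous extension to \<open>1\<close> and
    \<open>- 1\<close>. It also disposes of these two boundary points, which map to the real line,
    where no bound on \<open>f\<close> is assumed.\<close>
  define h where "h z = (if z\<^sup>2 = 1 then 0 else exp (- (of_real A * V z)))" for z
  have Re_V: "norm (1 - z\<^sup>2) powr - \<beta> * \<kappa> \<le> Re (V z)" if "norm z \<le> 1" "z\<^sup>2 \<noteq> 1" for z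
    unfolding V_def \<kappa>_def using Re_exp_neg_Ln_ge[OF Re_one_minus_square_pos[OF that] \<beta>] .
  have norm_h: "norm (h z) \<le> exp (- (A * \<kappa> * norm (1 - z\<^sup>2) powr - \<beta>))" if "norm z \<le> 1" "z\<^sup>2 \<noteq> 1" for z
    using mult_left_mono[OF Re_V[OF that], of A] A that by (simp add: h_def mult_ac)
  have cont_h: "continuous_on (cball 0 1) h"
    unfolding continuous_on_eq_continuous_within
  proof
    fix z0 :: complex assume z0: "z0 \<in> cball 0 1"
    show "continuous (at z0 within cball 0 1) h"
    proof (cases "z0\<^sup>2 = 1")
      case False
      have nn: "1 - z0\<^sup>2 \<notin> \<real>\<^sub>\<le>\<^sub>0" 
        using Re_one_minus_square_pos[OF _ False] z0 by (auto simp: complex_nonpos_Reals_iff)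
      have c: "continuous (at z0) (\<lambda>z. exp (- (of_real A * V z)))"
        unfolding V_def by (intro continuous_intros nn)
      have e: "eventually (\<lambda>z. h z = exp (- (of_real A * V z))) (nhds z0)"
      proof -
        have "open {z::complex. z\<^sup>2 \<noteq> 1}" by (intro open_Collect_neq continuous_intros)
        then have "eventually (\<lambda>z. z \<in> {z::complex. z\<^sup>2 \<noteq> 1}) (nhds z0)"
          using False by (intro eventually_nhds_in_open) auto
        then show ?thesis by eventually_elim (simp add: h_def)
      qed
      have "isCont h z0" using c isCont_cong[OF e] by blast
      then show ?thesis by (rule continuous_at_imp_continuous_at_within)
    next
      case True
      let ?g = "\<lambda>x::real. if x = 0 then 0 else exp (- (A * \<kappa> * x powr - \<beta>))"
      have "continuous_on {0..} ?g" by (rule continuous_on_exp_neg_powr) (use A \<kappa> \<beta> in auto)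
      then have "continuous_on UNIV (\<lambda>z::complex. ?g (norm (1 - z\<^sup>2)))"
        by (rule continuous_on_compose2) (auto intro!: continuous_intros)
      then have "isCont (\<lambda>z::complex. ?g (norm (1 - z\<^sup>2))) z0"
        by (simp add: continuous_on_eq_continuous_at)
      then have "((\<lambda>z::complex. ?g (norm (1 - z\<^sup>2))) \<longlongrightarrow> ?g (norm (1 - z0\<^sup>2))) (at z0 within cball 0 1)"
        unfolding isCont_def by (rule tendsto_within_subset) auto
      then have lim: "((\<lambda>z::complex. ?g (norm (1 - z\<^sup>2))) \<longlongrightarrow> 0) (at z0 within cball 0 1)"
        using True by simp
      have "norm (h z) \<le> ?g (norm (1 - z\<^sup>2))" if "z \<in> cball 0 1" for z
        using norm_h[of z] that by (cases "z\<^sup>2 = 1") (auto simp: h_def)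
      then have "eventually (\<lambda>z. norm (h z) \<le> ?g (norm (1 - z\<^sup>2))) (at z0 within cball 0 1)"
        by (auto simp: eventually_at_filter)
      then have "(h \<longlongrightarrow> 0) (at z0 within cball 0 1)" using lim by (rule Lim_null_comparison)
      then show ?thesis using True by (simp add: continuous_within h_def)
    qed
  qed
  have hol_h: "h holomorphic_on ball 0 1"
  proof -
    have sq: "z\<^sup>2 \<noteq> 1" if "z \<in> ball 0 1" for z :: complex
      using that by (metis abs_square_less_1 abs_norm_cancel less_irrefl mem_ball_0 norm_one norm_power)
    have "(\<lambda>z. exp (- (of_real A * V z))) holomorphic_on ball 0 1"
      unfolding V_def 
    proof (intro holomorphic_intros)
      fix z :: complex assume "z \<in> ball 0 1"
      then show "1 - z\<^sup>2 \<notin> \<real>\<^sub>\<le>\<^sub>0"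
        using Re_one_minus_square_pos[of z] sq[of z] by (auto simp: complex_nonpos_Reals_iff)
    qed
    then show ?thesis by (rule holomorphic_transform) (use sq in \<open>auto simp: h_def\<close>)
  qed
  define \<phi> where "\<phi> z = of_real x0 + of_real \<rho> * z" for z :: complex
  have \<phi>: "\<phi> ` cball 0 1 \<subseteq> ball (of_real x0) R"
  proof
    fix v assume "v \<in> \<phi> ` cball 0 1"
    then obtain z where z: "norm z \<le> 1" "v = \<phi> z" by auto
    have "norm (of_real \<rho> * z) \<le> \<rho>" using z \<rho> by (simp add: norm_mult mult_left_le)
    then show "v \<in> ball (of_real x0) R" using \<rho> by (simp add: z \<phi>_def dist_norm)
  qed
  have "\<phi> holomorphic_on ball 0 1" unfolding \<phi>_def[abs_def] by (intro holomorphic_intros)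
  then have hol_f: "(f \<circ> \<phi>) holomorphic_on ball 0 1"
    by (rule holomorphic_on_compose_gen[OF _ hol]) (meson \<phi> ball_subset_cball image_mono subset_trans)
  have "continuous_on (cball 0 1) \<phi>" unfolding \<phi>_def[abs_def] by (intro continuous_intros)
  then have cont_f: "continuous_on (cball 0 1) (f \<circ> \<phi>)"
    by (rule continuous_on_compose) (rule continuous_on_subset[OF holomorphic_on_imp_continuous_on[OF hol] \<phi>])
  \<comment> \<open>The preimage of \<open>w\<close> is purely imaginary, so
    \<open>1 - \<xi>\<^sup>2\<close> is real and at least 1. Hence \<open>V \<xi> \<le> 1\<close>,
    and the multiplier costs at most \<open>exp A\<close> there.\<close>
  define \<xi> where "\<xi> = \<i> * of_real (Im w / \<rho>)"
  have \<xi>: "norm \<xi> < 1" using w \<rho> by (simp add: \<xi>_def norm_mult norm_divide)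
  have \<phi>\<xi>: "\<phi> \<xi> = w" using w \<rho> by (simp add: \<phi>_def \<xi>_def complex_eq_iff)
  have "norm (f (\<phi> \<xi>) * h \<xi>) \<le> 1"
  proof (rule maximum_modulus_frontier[where f = "\<lambda>z. f (\<phi> z) * h z" and S = "cball 0 1"])
    show "(\<lambda>z. f (\<phi> z) * h z) holomorphic_on interior (cball 0 1)"
      using holomorphic_on_mult[OF hol_f hol_h] by (simp add: comp_def)
    show "continuous_on (closure (cball 0 1)) (\<lambda>z. f (\<phi> z) * h z)"
      using continuous_on_mult[OF cont_f cont_h] by (simp add: comp_def)
    show "\<xi> \<in> cball 0 1" using \<xi> by simp
    fix z :: complex assume "z \<in> frontier (cball 0 1)"
    then have z: "norm z = 1" by (simp add: frontier_cball)
    show "norm (f (\<phi> z) * h z) \<le> 1"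
    proof (cases "z\<^sup>2 = 1")
      case False
      have Imz: "\<bar>Im z\<bar> > 0" using one_minus_square_sphere[OF z] False by auto
      have Im\<phi>: "\<bar>Im (\<phi> z)\<bar> = (\<rho> / 2) * (2 * \<bar>Im z\<bar>)" using \<rho> by (simp add: \<phi>_def abs_mult)
      have "norm (f (\<phi> z)) \<le> exp (c * \<bar>Im (\<phi> z)\<bar> powr - \<beta>)"
        using \<phi> z Imz by (intro bound) (auto simp: image_subset_iff \<phi>_def \<rho>(1)[THEN less_imp_neq, symmetric])
      also have "\<bar>Im (\<phi> z)\<bar> powr - \<beta> = (\<rho> / 2) powr - \<beta> * (2 * \<bar>Im z\<bar>) powr - \<beta>"
        unfolding Im\<phi> using \<rho> by (subst powr_mult) auto
      also have "c * \<dots> \<le> A * \<kappa> * (2 * \<bar>Im z\<bar>) powr - \<beta>"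
        unfolding A\<kappa> by (simp add: algebra_simps)
      finally have 1: "norm (f (\<phi> z)) \<le> exp (A * \<kappa> * (2 * \<bar>Im z\<bar>) powr - \<beta>)" by simp
      have 2: "norm (h z) \<le> exp (- (A * \<kappa> * (2 * \<bar>Im z\<bar>) powr - \<beta>))"
        using norm_h[of z] z False by (simp add: one_minus_square_sphere)
      have "norm (f (\<phi> z) * h z) \<le> exp (A * \<kappa> * (2 * \<bar>Im z\<bar>) powr - \<beta>) * exp (- (A * \<kappa> * (2 * \<bar>Im z\<bar>) powr - \<beta>))"
        unfolding norm_mult by (intro mult_mono 1 2) auto
      then show ?thesis by (simp add: exp_minus)
    qed (simp add: h_def)
  qed auto
  moreover have "norm (h \<xi>) \<ge> exp (- A)"
  proof -
    define u where "u = 1 + (Im w / \<rho>)\<^sup>2"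
    have u: "u \<ge> 1" by (simp add: u_def)
    have u': "1 - \<xi>\<^sup>2 = of_real u" by (simp add: \<xi>_def u_def power_mult_distrib power_divide)
    have "V \<xi> = of_real (u powr - \<beta>)"
      using u by (simp add: V_def u' Ln_of_real powr_def exp_of_real flip: of_real_mult of_real_minus)
    moreover have "u powr - \<beta> \<le> 1" using u \<beta> by (simp add: powr_minus inverse_le_1_iff ge_one_powr_ge_zero)
    moreover have "\<xi>\<^sup>2 \<noteq> 1"
    proof
      assume "\<xi>\<^sup>2 = 1" then have "of_real u = (0::complex)" using u' by simp
      then show False using u by simp
    qed
    ultimately show ?thesis using A by (simp add: h_def mult_left_le)
  qed
  then have "norm (f w) * exp (- A) \<le> norm (f (\<phi> \<xi>) * h \<xi>)"
    unfolding norm_mult \<phi>\<xi> by (intro mult_left_mono) auto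
  ultimately have "norm (f w) * exp (- A) \<le> 1" by linarith
  then show ?thesis by (simp add: A_def \<kappa>_def exp_minus field_simps)
qed

section \<open>Contour integrals over boxes and over one period\<close>

lemma contour_integral_linepath_shift:
  assumes "\<And>w. \<Phi> (w + 1) = \<Phi> w"
  shows "contour_integral (linepath (a + 1) (b + 1)) \<Phi> = contour_integral (linepath a b) \<Phi>"
proof -
  have "linepath (a + 1) (b + 1) t = linepath a b t + 1" for t
    by (simp add: linepath_def algebra_simps)
  then show ?thesis using assms by (simp add: contour_integral_integral)
qed

text \<open>A primitive exists on the convex box, so an integral depends only on the endpoints of
  the path.\<close>

lemma rectangle_integral_zero:
  assumes "\<Phi> holomorphic_on S" "cbox (Complex a c) (Complex b d) \<subseteq> S" "open S" "a \<le> b" "c \<le> d"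
  shows "contour_integral (linepath (Complex a c) (Complex b c)) \<Phi> + contour_integral (linepath (Complex b c) (Complex b d)) \<Phi>
    = contour_integral (linepath (Complex a c) (Complex a d)) \<Phi> + contour_integral (linepath (Complex a d) (Complex b d)) \<Phi>"
proof -
  let ?R = "cbox (Complex a c) (Complex b d)"
  have conv: "convex ?R" by (rule convex_box)
  obtain P where P: "\<And>x. x \<in> ?R \<Longrightarrow> (P has_field_derivative \<Phi> x) (at x within ?R)"
  proof (rule holomorphic_convex_primitive[OF conv, of "{}" \<Phi>])
    show "continuous_on ?R \<Phi>"
      using holomorphic_on_imp_continuous_on[OF assms(1)] assms(2) continuous_on_subset by blast
    show "\<Phi> field_differentiable at x" if "x \<in> interior ?R - {}" for x
      using that assms interior_subset holomorphic_on_imp_differentiable_at by blast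
  qed auto
  have "contour_integral (linepath u v) \<Phi> = P v - P u" if "u \<in> ?R" "v \<in> ?R" for u v
  proof -
    have "closed_segment u v \<subseteq> ?R" using that conv by (simp add: closed_segment_subset)
    then have "(\<Phi> has_contour_integral (P (pathfinish (linepath u v)) - P (pathstart (linepath u v)))) (linepath u v)"
      by (intro contour_integral_primitive[OF P]) auto
    then show ?thesis by (simp add: contour_integral_unique)
  qed
  then show ?thesis using assms by (simp add: in_cbox_complex_iff)
qed

text \<open>The strip over one period is cut into \<open>N\<close> boxes. In the sum of the boundary
  integrals the inner vertical sides cancel, and the two extreme ones cancel by periodicity. A box
  contained in \<open>S\<close> contributes nothing, any other at most \<open>\<epsilon>\<close>
  times its perimeter \<open>2 / N + 4 * \<eta>\<close>.\<close>

lemma strip_integral_bound: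
  fixes \<Phi> :: "complex \<Rightarrow> complex" and N :: nat
  assumes hol: "\<Phi> holomorphic_on S" "open S" and per: "\<And>w. \<Phi> (w + 1) = \<Phi> w"
    and N: "N > 0" and \<eta>: "\<eta> > 0" and \<epsilon>: "\<epsilon> \<ge> 0" and x: "\<And>m. x m = x 0 + real m / N"
    and horiz: "\<And>w. \<bar>Im w\<bar> = \<eta> \<Longrightarrow> w \<in> S"
    and vert: "\<And>w m. Re w = x m \<Longrightarrow> \<bar>Im w\<bar> \<le> \<eta> \<Longrightarrow> w \<in> S"
    and rect: "\<And>m. m < N \<Longrightarrow> cbox (Complex (x m) (- \<eta>)) (Complex (x (Suc m)) \<eta>) \<subseteq> S \<or>
       (\<forall>w\<in>cbox (Complex (x m) (- \<eta>)) (Complex (x (Suc m)) \<eta>).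
          \<bar>Im w\<bar> = \<eta> \<or> Re w = x m \<or> Re w = x (Suc m) \<longrightarrow> norm (\<Phi> w) \<le> \<epsilon>)"
  shows "norm (contour_integral (linepath (Complex (x 0) (- \<eta>)) (Complex (x 0 + 1) (- \<eta>))) \<Phi>
    - contour_integral (linepath (Complex (x 0) \<eta>) (Complex (x 0 + 1) \<eta>)) \<Phi>) \<le> \<epsilon> * (2 + 4 * \<eta> * N)"
proof -
  let ?I = "\<lambda>a b. contour_integral (linepath a b) \<Phi>"
  define P where "P m = Complex (x m) (- \<eta>)" for m
  define Q where "Q m = Complex (x m) \<eta>" for m
  have xm: "x m \<le> x (Suc m)" for m using x[of m] x[of "Suc m"] by (simp add: divide_right_mono)
  have xd: "x (Suc m) - x m = 1 / N" for m using x[of m] x[of "Suc m"] by (simp add: add_divide_distrib)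
  have contS: "continuous_on S \<Phi>" using hol by (simp add: holomorphic_on_imp_continuous_on)
  have segP: "closed_segment (P m) (P n) \<subseteq> S" for m n
    using \<eta> by (auto simp: P_def closed_segment_same_Im intro!: horiz)
  have segQ: "closed_segment (Q m) (Q n) \<subseteq> S" for m n
    using \<eta> by (auto simp: Q_def closed_segment_same_Im intro!: horiz)
  have segV: "closed_segment (P m) (Q m) \<subseteq> S" for m
    using \<eta> by (auto simp: P_def Q_def closed_segment_same_Re closed_segment_eq_real_ivl intro!: vert[of _ m])
  note cont = continuous_on_subset[OF contS]
  have bd: "norm (?I a b) \<le> \<epsilon> * norm (b - a)" if "closed_segment a b \<subseteq> S" "\<And>w. w \<in> closed_segment a b \<Longrightarrow> norm (\<Phi> w) \<le> \<epsilon>" for a b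
    by (rule contour_integral_bound_linepath[OF contour_integrable_continuous_linepath[OF cont[OF that(1)]] \<epsilon> that(2)])
  \<comment> \<open>The four sides of the box of index \<open>m\<close>, run
    counterclockwise.\<close>
  define D where "D m = ?I (P m) (P (Suc m)) - ?I (Q m) (Q (Suc m)) + ?I (P (Suc m)) (Q (Suc m)) - ?I (P m) (Q m)" for m
  have D: "norm (D m) \<le> \<epsilon> * (2 / N + 4 * \<eta>)" if m: "m < N" for m
    using rect[OF m]
  proof
    assume "cbox (Complex (x m) (- \<eta>)) (Complex (x (Suc m)) \<eta>) \<subseteq> S"
    from rectangle_integral_zero[OF hol(1) this hol(2) xm] \<eta> have "D m = 0"
      by (simp add: D_def P_def Q_def algebra_simps)
    then show ?thesis using \<epsilon> \<eta> by simp
  next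
    assume *: "\<forall>w\<in>cbox (Complex (x m) (- \<eta>)) (Complex (x (Suc m)) \<eta>).
          \<bar>Im w\<bar> = \<eta> \<or> Re w = x m \<or> Re w = x (Suc m) \<longrightarrow> norm (\<Phi> w) \<le> \<epsilon>"
    have nP: "norm (P (Suc m) - P m) = 1 / N" using xd[of m] xm[of m] by (simp add: P_def cmod_def)
    have nQ: "norm (Q (Suc m) - Q m) = 1 / N" using xd[of m] xm[of m] by (simp add: Q_def cmod_def)
    have nV: "norm (Q k - P k) = 2 * \<eta>" for k
    proof -
      have "Q k - P k = \<i> * of_real (2 * \<eta>)" by (simp add: P_def Q_def complex_eq_iff)
      then show ?thesis using \<eta> by (simp add: norm_mult)
    qed
    have "norm (?I (P m) (P (Suc m))) \<le> \<epsilon> * norm (P (Suc m) - P m)"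
      using \<eta> xm[of m] * by (intro bd segP) (auto simp: P_def closed_segment_same_Im closed_segment_eq_real_ivl in_cbox_complex_iff)
    moreover have "norm (?I (Q m) (Q (Suc m))) \<le> \<epsilon> * norm (Q (Suc m) - Q m)"
      using \<eta> xm[of m] * by (intro bd segQ) (auto simp: Q_def closed_segment_same_Im closed_segment_eq_real_ivl in_cbox_complex_iff)
    moreover have "norm (?I (P m) (Q m)) \<le> \<epsilon> * norm (Q m - P m)"
      using \<eta> xm[of m] * by (intro bd segV) (auto simp: P_def Q_def closed_segment_same_Re closed_segment_eq_real_ivl in_cbox_complex_iff)
    moreover have "norm (?I (P (Suc m)) (Q (Suc m))) \<le> \<epsilon> * norm (Q (Suc m) - P (Suc m))"
      using \<eta> xm[of m] * by (intro bd segV) (auto simp: P_def Q_def closed_segment_same_Re closed_segment_eq_real_ivl in_cbox_complex_iff)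
    moreover have "norm (D m) \<le> norm (?I (P m) (P (Suc m))) + norm (?I (Q m) (Q (Suc m))) + norm (?I (P (Suc m)) (Q (Suc m))) + norm (?I (P m) (Q m))"
      unfolding D_def by (smt (verit) norm_triangle_ineq norm_triangle_ineq4)
    ultimately have "norm (D m) \<le> 2 * (\<epsilon> * (1 / N)) + 2 * (\<epsilon> * (2 * \<eta>))"
      unfolding nP nQ nV by linarith
    also have "\<dots> = \<epsilon> * (2 / N + 4 * \<eta>)" by (simp add: distrib_left)
    finally show ?thesis .
  qed
  have split: "(\<Sum>m<n. ?I (P m) (P (Suc m))) = ?I (P 0) (P n) \<and> (\<Sum>m<n. ?I (Q m) (Q (Suc m))) = ?I (Q 0) (Q n)" for n
  proof (induction n)
    case (Suc n)
    have "x n \<in> closed_segment (x 0) (x (Suc n))"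
      using x[of n] x[of "Suc n"] by (simp add: closed_segment_eq_real_ivl divide_right_mono)
    then have "P n \<in> closed_segment (P 0) (P (Suc n))" "Q n \<in> closed_segment (Q 0) (Q (Suc n))"
      by (auto simp: P_def Q_def closed_segment_same_Im)
    then have "?I (P 0) (P (Suc n)) = ?I (P 0) (P n) + ?I (P n) (P (Suc n))"
        "?I (Q 0) (Q (Suc n)) = ?I (Q 0) (Q n) + ?I (Q n) (Q (Suc n))"
      by (simp_all add: contour_integral_split_linepath[OF cont[OF segP]] contour_integral_split_linepath[OF cont[OF segQ]])
    with Suc show ?case by (simp only: sum.lessThan_Suc)
  next
    case 0
    have "?I a a = 0" for a by (rule contour_integral_unique) (rule has_contour_integral_trivial)
    then show ?case by (simp only: lessThan_0 sum.empty simp_thms)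
  qed
  have PQN: "P N = P 0 + 1" "Q N = Q 0 + 1" using x[of N] N by (auto simp: P_def Q_def complex_eq_iff)
  have "(\<Sum>m<N. D m) = (\<Sum>m<N. ?I (P m) (P (Suc m))) - (\<Sum>m<N. ?I (Q m) (Q (Suc m)))
      + (\<Sum>m<N. ?I (P (Suc m)) (Q (Suc m)) - ?I (P m) (Q m))"
    by (simp add: D_def sum.distrib sum_subtractf)
  also have "(\<Sum>m<N. ?I (P (Suc m)) (Q (Suc m)) - ?I (P m) (Q m)) = ?I (P N) (Q N) - ?I (P 0) (Q 0)"
    by (rule sum_lessThan_telescope)
  also have "\<dots> = 0" unfolding PQN by (simp add: contour_integral_linepath_shift[of \<Phi>, OF per])
  finally have sumD: "(\<Sum>m<N. D m) = ?I (P 0) (P N) - ?I (Q 0) (Q N)" using split[of N] by simp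
  have "norm (\<Sum>m<N. D m) \<le> (\<Sum>m<N. \<epsilon> * (2 / N + 4 * \<eta>))"
    by (rule sum_norm_le) (use D in auto)
  also have "\<dots> = \<epsilon> * (2 + 4 * \<eta> * N)" using N by (simp add: field_simps)
  finally have b: "norm (?I (P 0) (P N) - ?I (Q 0) (Q N)) \<le> \<epsilon> * (2 + 4 * \<eta> * N)" unfolding sumD .
  have e: "Complex (x 0 + 1) (- \<eta>) = P N" "Complex (x 0 + 1) \<eta> = Q N"
    unfolding PQN by (simp_all add: P_def Q_def complex_eq_iff)
  show ?thesis using b unfolding e by (simp only: P_def Q_def)
qed

section \<open>Periodic functions on horizontal lines\<close>

text \<open>The monomial of degree \<open>n\<close> in the coordinate
  \<open>z = exp (2 * pi * \<i> * w)\<close>: the upper half-plane corresponds to the inside of the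
  circle, the lower one to the outside. Degrees are integers because \<open>1 - q\<close> occurs as
  an exponent.\<close>

definition char :: "int \<Rightarrow> complex \<Rightarrow> complex" where
  "char n w = exp (2 * of_real pi * \<i> * of_int n * w)"

lemma char_mult: "char m w * char n w = char (m + n) w"
  by (simp add: char_def algebra_simps flip: exp_add)

lemma char_0 [simp]: "char 0 w = 1"
  by (simp add: char_def)

lemma char_power: "char m w ^ k = char (int k * m) w"
  by (induction k) (simp_all add: char_mult algebra_simps)

lemma inverse_char: "inverse (char m w) = char (- m) w"
  by (rule inverse_unique) (simp add: char_mult)

lemma norm_char: "norm (char n w) = exp (- (2 * pi * of_int n * Im w))"
  by (simp add: char_def)

lemma char_of_real: "char n (of_real x) = cis (2 * pi * of_int n * x)"
  by (simp add: char_def cis_conv_exp mult_ac)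

lemma char_plus_1: "char n (w + 1) = char n w"
proof -
  have "char n (w + 1) = char n w * char n (of_real 1)"
    by (simp add: char_def distrib_left exp_add)
  also have "char n (of_real 1) = 1"
    unfolding char_of_real using cis_multiple_2pi[of "of_int n"] by simp
  finally show ?thesis by simp
qed

lemma char_holomorphic [holomorphic_intros]: "char n holomorphic_on S"
  unfolding char_def[abs_def] by (intro holomorphic_intros)

lemma char_continuous [continuous_intros]: "continuous_on S (char n)"
  using holomorphic_on_imp_continuous_on[OF char_holomorphic] .

lemma char_integral: "contour_integral (linepath a (a + 1)) (char n) = (if n = 0 then 1 else 0)"
proof (cases "n = 0")
  case True
  then have "char n = (\<lambda>_. 1)" by auto
  then show ?thesis using True by simp
next
  case False
  define k where "k = 2 * of_real pi * \<i> * of_int n"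
  have k: "k \<noteq> 0" using False by (simp add: k_def)
  have "((\<lambda>w. char n w / k) has_field_derivative char n w) (at w within UNIV)" for w
    unfolding char_def k_def[symmetric] using k by (auto intro!: derivative_eq_intros)
  then have "(char n has_contour_integral (char n (pathfinish (linepath a (a + 1))) / k - char n (pathstart (linepath a (a + 1))) / k)) (linepath a (a + 1))"
    by (rule contour_integral_primitive) auto
  then show ?thesis using False by (simp add: contour_integral_unique char_plus_1)
qed

section \<open>Termwise integration and the pairing with a power series in
  \<open>z ^ q\<close>\<close>

lemma contour_integral_linepath_sums:
  fixes h :: "nat \<Rightarrow> complex \<Rightarrow> complex"
  assumes cont: "\<And>n. continuous_on (closed_segment a b) (h n)"
    and bound: "\<And>n w. w \<in> closed_segment a b \<Longrightarrow> norm (h n w) \<le> B n" and B: "summable B"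
    and g: "\<And>w. w \<in> closed_segment a b \<Longrightarrow> (\<lambda>n. h n w) sums g w"
  shows "(\<lambda>n. contour_integral (linepath a b) (h n)) sums contour_integral (linepath a b) g"
    and "continuous_on (closed_segment a b) g"
proof -
  have u: "uniform_limit (closed_segment a b) (\<lambda>n w. \<Sum>i<n. h i w) (\<lambda>w. \<Sum>i. h i w) sequentially"
    by (rule Weierstrass_m_test[OF bound B])
  have u: "uniform_limit (closed_segment a b) (\<lambda>n w. \<Sum>i<n. h i w) g sequentially"
    by (rule uniform_limit_cong'[THEN iffD1, OF _ _ u]) (auto simp: sums_unique[OF g])
  have c: "continuous_on (closed_segment a b) (\<lambda>w. \<Sum>i<n. h i w)" for n
    by (intro continuous_on_sum cont)
  have "((\<lambda>n. contour_integral (linepath a b) (\<lambda>w. \<Sum>i<n. h i w)) \<longlongrightarrow> contour_integral (linepath a b) g) sequentially"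
  proof (rule contour_integral_uniform_limit(2)[where B = "norm (b - a)"])
    show "\<forall>\<^sub>F n in sequentially. (\<lambda>w. \<Sum>i<n. h i w) contour_integrable_on linepath a b"
      by (intro always_eventually allI contour_integrable_continuous_linepath c)
  qed (use u in auto)
  moreover have "contour_integral (linepath a b) (\<lambda>w. \<Sum>i<n. h i w) = (\<Sum>i<n. contour_integral (linepath a b) (h i))" for n
    by (intro contour_integral_sum contour_integrable_continuous_linepath cont) auto
  ultimately show "(\<lambda>n. contour_integral (linepath a b) (h n)) sums contour_integral (linepath a b) g"
    by (simp add: sums_def)
  show "continuous_on (closed_segment a b) g"
    by (rule uniform_limit_theorem[OF _ u]) (use c in auto)
qed

lemma Im_unit_segment: "w \<in> closed_segment a (a + 1) \<Longrightarrow> Im w = Im a"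
  by (simp add: closed_segment_same_Im)

text \<open>By orthogonality of the characters, multiplication by \<open>char j\<close> and
  integration over a period select the coefficient of degree \<open>- j\<close>.\<close>

lemma char_series_integral:
  assumes g: "\<And>w. Im w = Im a \<Longrightarrow> (\<lambda>m. c m * char (k m) w) sums g w"
    and sum: "summable (\<lambda>m. norm (c m) * exp (- (2 * pi * of_int (k m) * Im a)))"
  shows "(\<lambda>m. c m * (if j + k m = 0 then 1 else 0)) sums contour_integral (linepath a (a + 1)) (\<lambda>w. char j w * g w)"
    and "continuous_on (closed_segment a (a + 1)) g"
proof -
  have "(\<lambda>m. contour_integral (linepath a (a + 1)) (\<lambda>w. c m * char (j + k m) w)) sums contour_integral (linepath a (a + 1)) (\<lambda>w. char j w * g w)"
  proof (rule contour_integral_linepath_sums)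
    show "continuous_on (closed_segment a (a + 1)) (\<lambda>w. c n * char (j + k n) w)" for n
      by (intro continuous_intros)
    show "norm (c n * char (j + k n) w) \<le> exp (- (2 * pi * of_int j * Im a)) * (norm (c n) * exp (- (2 * pi * of_int (k n) * Im a)))"
      if "w \<in> closed_segment a (a + 1)" for n w
      by (simp add: norm_mult norm_char Im_unit_segment[OF that] algebra_simps flip: exp_add)
    show "summable (\<lambda>n. exp (- (2 * pi * of_int j * Im a)) * (norm (c n) * exp (- (2 * pi * of_int (k n) * Im a))))"
      by (intro summable_mult sum)
    show "(\<lambda>n. c n * char (j + k n) w) sums (char j w * g w)" if "w \<in> closed_segment a (a + 1)" for w
      using sums_mult[OF g[OF Im_unit_segment[OF that]], of "char j w"] by (simp add: mult.left_commute char_mult)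
  qed
  moreover have "contour_integral (linepath a (a + 1)) (\<lambda>w. c m * char (j + k m) w) = c m * (if j + k m = 0 then 1 else 0)" for m
    by (subst contour_integral_lmul) (auto intro!: contour_integrable_continuous_linepath continuous_intros simp: char_integral)
  ultimately show "(\<lambda>m. c m * (if j + k m = 0 then 1 else 0)) sums contour_integral (linepath a (a + 1)) (\<lambda>w. char j w * g w)"
    by simp
  show "continuous_on (closed_segment a (a + 1)) g"
  proof (rule contour_integral_linepath_sums(2))
    show "continuous_on (closed_segment a (a + 1)) (\<lambda>w. c n * char (k n) w)" for n
      by (intro continuous_intros)
    show "norm (c n * char (k n) w) \<le> norm (c n) * exp (- (2 * pi * of_int (k n) * Im a))"
      if "w \<in> closed_segment a (a + 1)" for n w
      by (simp add: norm_mult norm_char Im_unit_segment[OF that])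
    show "(\<lambda>n. c n * char (k n) w) sums g w" if "w \<in> closed_segment a (a + 1)" for w
      using g[OF Im_unit_segment[OF that]] .
  qed (rule sum)
qed

text \<open>Only \<open>F\<close> is expanded; \<open>g\<close> stays inside the integral, where it
  is bounded on the compact segment. What remains for each \<open>n\<close> is a Fourier coefficient
  of \<open>g\<close> along the arithmetic progression of step \<open>q\<close>.\<close>

lemma power_series_integral:
  assumes F: "\<And>w. Im w = Im a \<Longrightarrow> (\<lambda>n. \<beta> n * char (int q) w ^ n) sums F (char (int q) w)"
    and sum: "summable (\<lambda>n. norm (\<beta> n) * exp (- (2 * pi * real q * Im a)) ^ n)"
    and g: "continuous_on (closed_segment a (a + 1)) g"
  shows "(\<lambda>n. \<beta> n * contour_integral (linepath a (a + 1)) (\<lambda>w. char (int q * int n + (1 - int q)) w * g w)) sums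
    contour_integral (linepath a (a + 1)) (\<lambda>w. F (char (int q) w) * char (1 - int q) w * g w)"
proof -
  let ?seg = "closed_segment a (a + 1)"
  obtain G where G: "\<And>w. w \<in> ?seg \<Longrightarrow> norm (char (1 - int q) w * g w) \<le> G"
  proof -
    have "compact ((\<lambda>w. char (1 - int q) w * g w) ` ?seg)"
      by (intro compact_continuous_image continuous_intros g) auto
    then have "bounded ((\<lambda>w. char (1 - int q) w * g w) ` ?seg)" by (rule compact_imp_bounded)
    then show ?thesis using that unfolding bounded_iff by blast
  qed
  have "(\<lambda>n. contour_integral (linepath a (a + 1)) (\<lambda>w. \<beta> n * (char (int q * int n + (1 - int q)) w * g w))) sums
    contour_integral (linepath a (a + 1)) (\<lambda>w. F (char (int q) w) * char (1 - int q) w * g w)"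
  proof (rule contour_integral_linepath_sums)
    show "continuous_on ?seg (\<lambda>w. \<beta> n * (char (int q * int n + (1 - int q)) w * g w))" for n
      by (intro continuous_intros g)
    have split: "char (int q * int n + (1 - int q)) w = char (int q) w ^ n * char (1 - int q) w" for n w
      by (simp add: char_power char_mult algebra_simps)
    show "norm (\<beta> n * (char (int q * int n + (1 - int q)) w * g w)) \<le> (norm (\<beta> n) * exp (- (2 * pi * real q * Im a)) ^ n) * G" 
      if w: "w \<in> ?seg" for n w
    proof -
      have "norm (\<beta> n * (char (int q * int n + (1 - int q)) w * g w))
        = (norm (\<beta> n) * norm (char (int q) w) ^ n) * norm (char (1 - int q) w * g w)"
        unfolding split by (simp add: norm_mult norm_power)
      also have "norm (char (int q) w) = exp (- (2 * pi * real q * Im a))"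
        by (simp add: norm_char Im_unit_segment[OF w])
      also have "(norm (\<beta> n) * \<dots> ^ n) * norm (char (1 - int q) w * g w) \<le> (norm (\<beta> n) * exp (- (2 * pi * real q * Im a)) ^ n) * G"
        by (intro mult_left_mono G[OF w]) auto
      finally show ?thesis .
    qed
    show "summable (\<lambda>n. (norm (\<beta> n) * exp (- (2 * pi * real q * Im a)) ^ n) * G)"
      by (intro summable_mult2 sum)
    show "(\<lambda>n. \<beta> n * (char (int q * int n + (1 - int q)) w * g w)) sums (F (char (int q) w) * char (1 - int q) w * g w)"
      if w: "w \<in> ?seg" for w
      using sums_mult2[OF F[OF Im_unit_segment[OF w]], of "char (1 - int q) w * g w"] unfolding split by (simp add: mult_ac)
  qed
  moreover have "contour_integral (linepath a (a + 1)) (\<lambda>w. \<beta> n * (char (int q * int n + (1 - int q)) w * g w))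
     = \<beta> n * contour_integral (linepath a (a + 1)) (\<lambda>w. char (int q * int n + (1 - int q)) w * g w)" for n
    by (rule contour_integral_lmul) (intro contour_integrable_continuous_linepath continuous_intros g)
  ultimately show ?thesis by simp
qed

lemma holomorphic_coeffs_abs_summable:
  assumes "F holomorphic_on ball 0 R" "0 \<le> r" "r < R"
  shows "summable (\<lambda>n. norm ((deriv ^^ n) F 0 / fact n) * r ^ n)"
proof -
  obtain r' where r': "r < r'" "r' < R" using dense[OF assms(3)] by blast
  have "(\<lambda>n. (deriv ^^ n) F 0 / fact n * (of_real r' - 0) ^ n) sums F (of_real r')"
    by (rule holomorphic_power_series[OF assms(1)]) (use r' assms(2) in auto)
  then have "summable (\<lambda>n. (deriv ^^ n) F 0 / fact n * complex_of_real r' ^ n)" by (simp add: sums_iff)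
  then have "summable (\<lambda>n. norm ((deriv ^^ n) F 0 / fact n * complex_of_real r ^ n))"
    by (rule powser_insidea) (use r' assms(2) in auto)
  then show ?thesis using assms(2) by (simp add: norm_mult norm_power norm_divide)
qed

text \<open>Outside the circle only negative degrees occur in \<open>f\<close>, and degree
  \<open>q * n + (1 - q)\<close> selects \<open>c (q * (n - 1))\<close> for
  \<open>n \<ge> 1\<close>. The pairing is thus the series of the introduction that does not involve
  \<open>F 0\<close>, and its bound is independent of \<open>q\<close>.\<close>

lemma outer_pairing:
  assumes F: "F holomorphic_on ball 0 R" "exp (- (2 * pi * real q * Im a)) < R" and q: "q > 0" and a: "Im a < 0"
    and A: "summable (\<lambda>n. norm ((deriv ^^ Suc n) F 0 / fact (Suc n)))" "(\<Sum>n. norm ((deriv ^^ Suc n) F 0 / fact (Suc n))) \<le> A"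
    and f: "\<And>z. norm z > 1 \<Longrightarrow> (\<lambda>m. c m / z ^ Suc m) sums f z" and c: "\<And>m. norm (c m) \<le> M"
  shows "norm (contour_integral (linepath a (a + 1)) (\<lambda>w. F (char (int q) w) * char (1 - int q) w * f (char 1 w))) \<le> A * M"
proof -
  define \<beta> where "\<beta> n = (deriv ^^ n) F 0 / fact n" for n
  define r where "r = exp (2 * pi * Im a)"
  have r: "0 < r" "r < 1" using a by (simp_all add: r_def mult_less_0_iff)
  have M: "M \<ge> 0" using c[of 0] norm_ge_zero order_trans by blast
  have g: "(\<lambda>m. c m * char (- int (Suc m)) w) sums f (char 1 w)" if "Im w = Im a" for w
  proof -
    have "norm (char 1 w) > 1" using a that by (simp add: norm_char mult_less_0_iff)
    from f[OF this] show ?thesis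
      by (simp only: divide_inverse char_power inverse_char) (simp only: mult_1_right)
  qed
  have sum: "summable (\<lambda>m. norm (c m) * exp (- (2 * pi * of_int (- int (Suc m)) * Im a)))"
  proof (rule summable_comparison_test')
    show "summable (\<lambda>m. M * (r * r ^ m))" using r by (intro summable_mult summable_geometric) auto
    fix m :: nat
    have "exp (- (2 * pi * of_int (- int (Suc m)) * Im a)) = r ^ Suc m"
      unfolding r_def by (simp add: algebra_simps flip: exp_of_nat_mult exp_add)
    then show "norm (norm (c m) * exp (- (2 * pi * of_int (- int (Suc m)) * Im a))) \<le> M * (r * r ^ m)"
      using c[of m] r by (simp add: mult_right_mono)
  qed
  define I where "I j = contour_integral (linepath a (a + 1)) (\<lambda>w. char j w * f (char 1 w))" for j
  have I_sums: "(\<lambda>m. c m * (if j + - int (Suc m) = 0 then 1 else 0)) sums I j" for j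
    unfolding I_def by (rule char_series_integral(1)[OF g sum])
  \<comment> \<open>For \<open>n = 0\<close> the degree \<open>1 - q\<close> is at most 0, and no
    term of the outer expansion can compensate it.\<close>
  have I0: "I (int q * int 0 + (1 - int q)) = 0"
  proof -
    have "(\<lambda>m. c m * (if (int q * int 0 + (1 - int q)) + - int (Suc m) = 0 then 1 else 0)) = (\<lambda>m. 0)" using q by auto
    then show ?thesis using I_sums[of "int q * int 0 + (1 - int q)"] by (simp add: sums_iff)
  qed
  have IM: "norm (I j) \<le> M" for j
  proof (cases "j \<ge> 1")
    case True
    have "(\<lambda>m. c m * (if j + - int (Suc m) = 0 then 1 else 0)) = (\<lambda>m. if m = nat (j - 1) then c m else 0)" using True by (auto simp: fun_eq_iff)
    then have "I j = c (nat (j - 1))" using I_sums[of j] sums_single[of "nat (j - 1)" c] sums_unique2 by metis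
    then show ?thesis using c by simp
  next
    case False
    then have "(\<lambda>m. c m * (if j + - int (Suc m) = 0 then 1 else 0)) = (\<lambda>m. 0)" by auto
    then have "I j = 0" using I_sums[of j] by (simp add: sums_iff)
    then show ?thesis using M by simp
  qed
  have "(\<lambda>n. \<beta> n * I (int q * int n + (1 - int q))) sums
    contour_integral (linepath a (a + 1)) (\<lambda>w. F (char (int q) w) * char (1 - int q) w * f (char 1 w))"
    unfolding I_def
  proof (rule power_series_integral)
    show "(\<lambda>n. \<beta> n * char (int q) w ^ n) sums F (char (int q) w)" if "Im w = Im a" for w
      using holomorphic_power_series[OF F(1), of "char (int q) w"] F(2) that by (simp add: norm_char \<beta>_def)
    show "summable (\<lambda>n. norm (\<beta> n) * exp (- (2 * pi * real q * Im a)) ^ n)"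
      unfolding \<beta>_def by (rule holomorphic_coeffs_abs_summable[OF F(1) _ F(2)]) simp
    show "continuous_on (closed_segment a (a + 1)) (\<lambda>w. f (char 1 w))"
      by (rule char_series_integral(2)[OF g sum])
  qed
  then have sums: "(\<lambda>n. \<beta> (Suc n) * I (int q * int (Suc n) + (1 - int q))) sums
    contour_integral (linepath a (a + 1)) (\<lambda>w. F (char (int q) w) * char (1 - int q) w * f (char 1 w))"
    by (subst sums_Suc_iff) (simp only: I0 mult_zero_right add_0_right diff_zero)
  have le: "norm (\<beta> (Suc n) * I (int q * int (Suc n) + (1 - int q))) \<le> norm (\<beta> (Suc n)) * M" for n
    unfolding norm_mult by (intro mult_left_mono IM) auto
  have sM: "summable (\<lambda>n. norm (\<beta> (Suc n)) * M)" unfolding \<beta>_def by (intro summable_mult2 A)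
  have "norm (\<Sum>n. \<beta> (Suc n) * I (int q * int (Suc n) + (1 - int q))) \<le> (\<Sum>n. norm (\<beta> (Suc n)) * M)"
    by (rule norm_suminf_le[OF le sM])
  also have "\<dots> = (\<Sum>n. norm (\<beta> (Suc n))) * M" unfolding \<beta>_def by (intro suminf_mult2[symmetric] A)
  also have "\<dots> \<le> A * M" unfolding \<beta>_def by (intro mult_right_mono A M)
  finally show ?thesis unfolding sums_unique[OF sums, symmetric] .
qed

text \<open>Inside the circle only nonnegative degrees occur in \<open>f\<close>. Degree
  \<open>q * n + (1 - q)\<close> is at least 1 for \<open>n \<ge> 1\<close>, so only
  \<open>n = 0\<close> and \<open>m = q - 1\<close> survive.\<close>

lemma inner_pairing:
  assumes F: "F holomorphic_on ball 0 R" "1 \<le> R" and q: "q > 0" and a: "Im a > 0"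
    and f: "\<And>z. norm z < 1 \<Longrightarrow> (\<lambda>m. - b m * z ^ m) sums f z"
  shows "contour_integral (linepath a (a + 1)) (\<lambda>w. F (char (int q) w) * char (1 - int q) w * f (char 1 w)) = - F 0 * b (q - 1)"
proof -
  define \<beta> where "\<beta> n = (deriv ^^ n) F 0 / fact n" for n
  define r where "r = exp (- (2 * pi * Im a))"
  have r: "0 < r" "r < 1" using a by (simp_all add: r_def)
  have g: "(\<lambda>m. - b m * char (int m) w) sums f (char 1 w)" if "Im w = Im a" for w
  proof -
    have "norm (char 1 w) < 1" using a that by (simp add: norm_char)
    from f[OF this] show ?thesis
      by (simp only: char_power mult_1_right)
  qed
  have sum: "summable (\<lambda>m. norm (- b m) * exp (- (2 * pi * of_int (int m) * Im a)))"
  proof -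
    \<comment> \<open>No bound on \<open>b\<close> is assumed; absolute summability at radius
      \<open>r\<close> comes from convergence at a larger radius inside the disc.\<close>
    obtain r' where r': "r < r'" "r' < 1" using dense[OF r(2)] by blast
    have "norm (complex_of_real r') < 1" using r r' by simp
    from f[OF this] have "summable (\<lambda>m. - b m * complex_of_real r' ^ m)" by (simp add: sums_iff)
    then have "summable (\<lambda>m. norm (- b m * complex_of_real r ^ m))"
      by (rule powser_insidea) (use r' r in auto)
    moreover have "norm (- b m * complex_of_real r ^ m) = norm (- b m) * exp (- (2 * pi * of_int (int m) * Im a))" for m
    proof -
      have "exp (- (2 * pi * of_int (int m) * Im a)) = r ^ m"
        unfolding r_def by (simp add: algebra_simps flip: exp_of_nat_mult)
      then show ?thesis using r by (simp add: norm_mult norm_power)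
    qed
    ultimately show ?thesis by simp
  qed
  define I where "I j = contour_integral (linepath a (a + 1)) (\<lambda>w. char j w * f (char 1 w))" for j
  have I_sums: "(\<lambda>m. - b m * (if j + int m = 0 then 1 else 0)) sums I j" for j
    unfolding I_def by (rule char_series_integral(1)[OF g sum])
  have I0: "I (int q * int 0 + (1 - int q)) = - b (q - 1)"
  proof -
    have "(\<lambda>m. - b m * (if (int q * int 0 + (1 - int q)) + int m = 0 then 1 else 0)) = (\<lambda>m. if m = q - 1 then - b m else 0)"
      using q by (auto simp: fun_eq_iff)
    then show ?thesis using I_sums[of "int q * int 0 + (1 - int q)"] sums_single[of "q - 1" "\<lambda>m. - b m"] sums_unique2 by metis
  qed
  have ISuc: "I (int q * int (Suc n) + (1 - int q)) = 0" for n
  proof -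
    have "int q * int (Suc n) + (1 - int q) \<ge> 1" by (simp add: algebra_simps)
    then have "(\<lambda>m. - b m * (if (int q * int (Suc n) + (1 - int q)) + int m = 0 then 1 else 0)) = (\<lambda>m. 0)" by (auto simp: fun_eq_iff simp del: of_nat_Suc)
    then show ?thesis using I_sums[of "int q * int (Suc n) + (1 - int q)"] by (simp add: sums_iff del: of_nat_Suc)
  qed
  have 1: "exp (- (2 * pi * real q * Im a)) < R"
    using a q F(2) by (intro less_le_trans[OF _ F(2)]) simp
  have "(\<lambda>n. \<beta> n * I (int q * int n + (1 - int q))) sums
    contour_integral (linepath a (a + 1)) (\<lambda>w. F (char (int q) w) * char (1 - int q) w * f (char 1 w))"
    unfolding I_def
  proof (rule power_series_integral)
    show "(\<lambda>n. \<beta> n * char (int q) w ^ n) sums F (char (int q) w)" if "Im w = Im a" for w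
      using holomorphic_power_series[OF F(1), of "char (int q) w"] 1 that by (simp add: norm_char \<beta>_def)
    show "summable (\<lambda>n. norm (\<beta> n) * exp (- (2 * pi * real q * Im a)) ^ n)"
      unfolding \<beta>_def by (rule holomorphic_coeffs_abs_summable[OF F(1) _ 1]) simp
    show "continuous_on (closed_segment a (a + 1)) (\<lambda>w. f (char 1 w))"
      by (rule char_series_integral(2)[OF g sum])
  qed
  also have "(\<lambda>n. \<beta> n * I (int q * int n + (1 - int q))) = (\<lambda>n. if n = 0 then \<beta> 0 * - b (q - 1) else 0)"
  proof
    fix n show "\<beta> n * I (int q * int n + (1 - int q)) = (if n = 0 then \<beta> 0 * - b (q - 1) else 0)"
    proof (cases n)
      case 0 then show ?thesis using I0 by simp
    next
      case (Suc m) then show ?thesis using ISuc[of m] by simp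
    qed
  qed
  finally have "(\<lambda>n. if n = 0 then \<beta> 0 * - b (q - 1) else 0) sums
    contour_integral (linepath a (a + 1)) (\<lambda>w. F (char (int q) w) * char (1 - int q) w * f (char 1 w))" .
  from sums_unique2[OF this sums_single[of 0 "\<lambda>n. \<beta> 0 * - b (q - 1)"]] show ?thesis by (simp add: \<beta>_def)
qed

section \<open>The coefficient estimate\<close>

text \<open>At the centre of the ball the power \<open>p ^ n\<close> takes the value
  \<open>- 1\<close>. A deviation below \<open>1 / (7 * p ^ n)\<close> turns the power by less than
  \<open>2 * pi / 7 < pi / 3\<close>, so its real part stays below \<open>- 1 / 2\<close>. Off the
  real line the modulus is not 1.\<close>

lemma char_midpoint_notin_cantor_hull:
  assumes p: "p \<ge> 1" and w: "w \<in> ball (of_real ((real m - 1 / 2) / p ^ n)) (1 / (7 * real p ^ n))"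
  shows "char 1 w \<notin> cantor_hull p"
proof
  assume "char 1 w \<in> cantor_hull p"
  then have 1: "norm (char 1 w) = 1" and 2: "Re (char 1 w ^ (p ^ n)) \<ge> - 1 / 2"
    by (auto simp: cantor_hull_def)
  define N where "N = real p ^ n"
  have N: "N > 0" using p by (simp add: N_def)
  have "Im w = 0" using 1 by (simp add: norm_char)
  then have wr: "w = of_real (Re w)" by (simp add: complex_eq_iff)
  define u where "u = N * (Re w - (real m - 1 / 2) / N)"
  have "\<bar>Re w - (real m - 1 / 2) / N\<bar> < 1 / (7 * N)"
  proof -
    have "of_real ((real m - 1 / 2) / N) - w = of_real ((real m - 1 / 2) / N - Re w)"
      using \<open>Im w = 0\<close> by (simp add: complex_eq_iff)
    then have "dist (of_real ((real m - 1 / 2) / N)) w = \<bar>(real m - 1 / 2) / N - Re w\<bar>"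
      unfolding dist_norm by (simp only: norm_of_real)
    moreover have "dist (of_real ((real m - 1 / 2) / N)) w < 1 / (7 * N)"
      using w unfolding mem_ball N_def .
    ultimately show ?thesis by (simp only: abs_minus_commute)
  qed
  then have "N * \<bar>Re w - (real m - 1 / 2) / N\<bar> < N * (1 / (7 * N))" using N by (intro mult_strict_left_mono)
  then have u: "\<bar>u\<bar> < 1 / 7" using N by (simp add: u_def abs_mult)
  have Nw: "N * Re w = real m - 1 / 2 + u" using N by (simp add: u_def field_simps)
  have arg: "2 * pi * (N * Re w) = (2 * pi * real m + (- pi)) + 2 * pi * u"
    unfolding Nw by (simp add: algebra_simps)
  have "char 1 w ^ (p ^ n) = char (int (p ^ n)) w" using char_power[of 1 w "p ^ n"] by simp
  also have "\<dots> = char (int (p ^ n)) (of_real (Re w))" by (rule arg_cong[OF wr])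
  also have "\<dots> = cis (2 * pi * (N * Re w))" unfolding char_of_real by (simp add: N_def mult_ac)
  also have "\<dots> = - cis (2 * pi * u)"
    unfolding arg by (simp only: cis_mult[symmetric]) (simp add: cis_multiple_2pi flip: cis_inverse)
  finally have "cos (2 * pi * u) \<le> 1 / 2" using 2 by simp
  moreover have "cos (pi / 3) < cos (2 * pi * \<bar>u\<bar>)"
    by (rule cos_monotone_0_pi) (use u in \<open>auto simp: field_simps\<close>)
  moreover have "cos (2 * pi * \<bar>u\<bar>) = cos (2 * pi * u)" by (cases "u \<ge> 0") auto
  ultimately show False by (simp add: cos_60)
qed

lemma char_add_imaginary: "char n (u + \<i> * of_real y) = char n u * of_real (exp (- (2 * pi * of_int n * y)))"
proof -
  have "2 * of_real pi * \<i> * of_int n * (u + \<i> * of_real y) = 2 * of_real pi * \<i> * of_int n * u + of_real (- (2 * pi * of_int n * y))"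
    by (simp add: algebra_simps)
  then show ?thesis by (simp only: char_def exp_add exp_of_real)
qed

text \<open>The power \<open>p ^ k\<close> multiplies distances on the circle by at most
  \<open>p ^ k\<close> and lowers the order of the endpoint from \<open>l + k\<close> to
  \<open>l\<close>. In units of \<open>1 / p ^ l\<close>, the width of the hull and the horizontal
  offset cost \<open>2 * pi\<close> each and the height of \<open>w\<close> costs 2, in total at
  most 20.\<close>

lemma char_near_cantor_ends:
  fixes k l :: nat
  assumes p: "p \<ge> 1" and w1: "char 1 w1 \<in> cantor_hull p"
    and Re: "\<bar>Re w - Re w1\<bar> \<le> 1 / real p ^ (l + k)" and Im: "\<bar>Im w\<bar> \<le> 1 / (32 * real p ^ (l + k))"
  obtains x where "x \<in> cantor_ends p l" "norm (char (int (p ^ k)) w - cis (2 * pi * x)) \<le> 20 / real p ^ l"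
proof -
  define q where "q = p ^ k"
  define t where "t = 1 / real p ^ l"
  have t: "0 < t" "t \<le> 1" using p by (auto simp: t_def)
  have q0: "real q > 0" using p by (simp add: q_def)
  have qN: "real q * (1 / real p ^ (l + k)) = t" using p by (simp add: q_def t_def power_add)
  have "norm (char 1 w1) = 1" using w1 by (simp add: cantor_hull_def)
  then have "Im w1 = 0" by (simp add: norm_char)
  then have w1r: "w1 = of_real (Re w1)" by (simp add: complex_eq_iff)
  obtain x0 where x0: "x0 \<in> cantor_ends p (l + k)" "norm (char 1 w1 - cis (2 * pi * x0)) \<le> 2 * pi / real p ^ (l + k)"
    using w1 by (auto simp: cantor_hull_def)
  obtain x where x: "x \<in> cantor_ends p l" "cis (2 * pi * x0) ^ q = cis (2 * pi * x)"
    using cantor_ends_power[OF p, of x0 k l] x0(1) by (auto simp: q_def add.commute)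
  have "norm (char 1 w1 ^ q - cis (2 * pi * x0) ^ q) \<le> real q * norm (char 1 w1 - cis (2 * pi * x0))"
    using \<open>norm (char 1 w1) = 1\<close> by (intro norm_power_diff) auto
  also have "\<dots> \<le> real q * (2 * pi / real p ^ (l + k))" by (intro mult_left_mono x0(2)) auto
  also have "\<dots> = 2 * pi * (real q * (1 / real p ^ (l + k)))" by simp
  also have "\<dots> = 2 * pi * t" unfolding qN ..
  finally have d3: "norm (char (int q) w1 - cis (2 * pi * x)) \<le> 2 * pi * t" using x(2) by (simp add: char_power)
  have "norm (char (int q) (of_real (Re w)) - char (int q) w1) \<le> \<bar>2 * pi * real q * Re w - 2 * pi * real q * Re w1\<bar>"
    by (subst w1r) (simp only: char_of_real of_int_of_nat_eq norm_cis_diff_le)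
  also have "\<dots> = 2 * pi * (real q * \<bar>Re w - Re w1\<bar>)" 
  proof -
    have "2 * pi * real q * Re w - 2 * pi * real q * Re w1 = 2 * pi * (real q * (Re w - Re w1))"
      by (simp add: algebra_simps)
    then show ?thesis by (simp add: abs_mult)
  qed
  also have "\<dots> \<le> 2 * pi * (real q * (1 / real p ^ (l + k)))" using Re by (intro mult_left_mono) auto
  finally have d2: "norm (char (int q) (of_real (Re w)) - char (int q) w1) \<le> 2 * pi * t" unfolding qN .
  have "real q * \<bar>Im w\<bar> \<le> real q * (1 / (32 * real p ^ (l + k)))" using Im by (intro mult_left_mono) auto
  also have "\<dots> = t / 32" unfolding qN[symmetric] by simp
  finally have "\<bar>2 * pi * real q * Im w\<bar> \<le> 2 * pi * (t / 32)" by (simp add: abs_mult)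
  also have "\<dots> \<le> t" using pi_less_4 t by simp
  finally have y: "\<bar>2 * pi * real q * Im w\<bar> \<le> t" .
  have "char (int q) w = char (int q) (of_real (Re w)) * of_real (exp (- (2 * pi * real q * Im w)))"
    using char_add_imaginary[of "int q" "of_real (Re w)" "Im w"] by (simp flip: complex_eq)
  then have "norm (char (int q) w - char (int q) (of_real (Re w))) = norm (char (int q) (of_real (Re w)) * of_real (exp (- (2 * pi * real q * Im w)) - 1))"
    by (simp add: algebra_simps)
  also have "\<dots> = \<bar>exp (- (2 * pi * real q * Im w)) - 1\<bar>"
    by (simp only: norm_mult norm_of_real) (simp add: norm_char)
  also have "\<dots> \<le> 2 * t"
  proof -
    let ?v = "- (2 * pi * real q * Im w)"
    have "1 + ?v \<le> exp ?v" by (rule exp_ge_add_one_self)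
    moreover have "exp ?v \<le> exp t" using y by simp
    moreover have "exp t \<le> 1 + t + t\<^sup>2" by (rule exp_bound) (use t in auto)
    moreover have "t\<^sup>2 \<le> t" using t by (simp add: power2_eq_square mult_left_le)
    ultimately show ?thesis using y by linarith
  qed
  finally have d1: "norm (char (int q) w - char (int q) (of_real (Re w))) \<le> 2 * t" .
  have "norm (char (int q) w - cis (2 * pi * x)) \<le> 2 * t + 2 * pi * t + 2 * pi * t"
    using d1 d2 d3 norm_triangle_ineq[of "char (int q) w - char (int q) (of_real (Re w))" "char (int q) (of_real (Re w)) - char (int q) w1"]
      norm_triangle_ineq[of "char (int q) w - char (int q) w1" "char (int q) w1 - cis (2 * pi * x)"] by simp
  also have "\<dots> = (2 + 4 * pi) * t" by (simp add: algebra_simps)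
  also have "\<dots> \<le> 20 * t" using pi_less_4 t by (intro mult_right_mono) auto
  finally show ?thesis using x(1) that by (simp add: q_def t_def)
qed

lemma powr_of_nat_power:
  assumes "p > 0"
  shows "(real p ^ n) powr \<beta> = (real p powr \<beta>) ^ n"
  using assms by (simp add: powr_powr mult.commute flip: powr_realpow)

text \<open>Bounds the modulus of \<open>z ^ q\<close> on the strip by halfway to the poles of order
  \<open>l\<close>, when \<open>t = 1 / p ^ l\<close> and the strip has half-height
  \<open>t / (32 * q)\<close>.\<close>

lemma exp_small_le:
  assumes "0 \<le> t" "t \<le> (1::real)"
  shows "exp (2 * pi * (t / 32)) \<le> 1 + t / 2"
proof -
  define u where "u = 2 * pi * (t / 32)"
  have "pi * t \<le> 4 * t" using pi_less_4 assms by (intro mult_right_mono) auto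
  then have u: "0 \<le> u" "u \<le> t / 4" using assms by (auto simp: u_def)
  have "exp u \<le> 1 + u + u\<^sup>2" by (rule exp_bound) (use u assms in auto)
  also have "u\<^sup>2 \<le> u * 1" unfolding power2_eq_square using u assms by (intro mult_left_mono) auto
  finally show ?thesis using u unfolding u_def by linarith
qed

text \<open>The role of \<open>f\<close> is played by a scalar resolvent: \<open>c m\<close> and \<open>b m\<close> correspond to \<open>T\<^sup>m\<close> and \<open>T\<^sup>-\<^sup>m\<^sup>-\<^sup>1\<close>.\<close>

lemma hyperfunction_coefficient_bound:
  fixes p k :: nat and s :: real and f :: "complex \<Rightarrow> complex" and b c :: "nat \<Rightarrow> complex"
  assumes p: "p \<ge> 2" and s: "s < 1 / 2" and \<beta>: "0 < \<beta>" "\<beta> < 1" "real p powr \<beta> < s * p"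
    and A: "\<And>l. summable (\<lambda>n. norm ((deriv ^^ Suc n) (damping p s l) 0 / fact (Suc n)))"
      "\<And>l. (\<Sum>n. norm ((deriv ^^ Suc n) (damping p s l) 0 / fact (Suc n))) \<le> A"
    and hol: "f holomorphic_on - cantor_hull p"
    and outer: "\<And>z. norm z > 1 \<Longrightarrow> (\<lambda>m. c m / z ^ Suc m) sums f z" and c: "\<And>m. norm (c m) \<le> M"
    and inner: "\<And>z. norm z < 1 \<Longrightarrow> (\<lambda>m. - b m * z ^ m) sums f z"
    and C: "0 \<le> C" "\<And>w. 0 < \<bar>Im w\<bar> \<Longrightarrow> \<bar>Im w\<bar> \<le> 1 \<Longrightarrow> norm (f (char 1 w)) \<le> exp (C * \<bar>Im w\<bar> powr - \<beta>)"
  shows "norm (b (p ^ k - 1)) \<le> exp (1 / (1 - 2 * s)) * (A * M)"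
proof -
  define q where "q = p ^ k"
  define B where "B = real p powr \<beta>"
  define \<kappa> where "\<kappa> = cos (\<beta> * pi / 2)"
  \<comment> \<open>One constant serves all sides of the boxes: 32 comes from the height
    \<open>1 / (32 * N)\<close> of the horizontal ones, \<open>C + 1\<close> and
    \<open>\<kappa>\<close> from the estimate across the circle on the vertical ones.\<close>
  define C' where "C' = (C + 1) * 32 powr \<beta> / \<kappa>"
  have "1 \<le> B" using p \<beta> by (simp add: B_def ge_one_powr_ge_zero)
  then have "1 < s * p" using \<beta>(3) by (simp add: B_def)
  then have s1: "1 / p < s" using p by (simp add: field_simps)
  have q: "q > 0" using p by (simp add: q_def)
  have \<kappa>: "\<kappa> > 0" "\<kappa> \<le> 1" unfolding \<kappa>_def
    by (intro cos_gt_zero_pi) (use \<beta> pi_gt_zero in \<open>auto simp: mult_less_cancel_right1 intro: less_trans[of _ 0]\<close>)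
  \<comment> \<open>Bound for the integrand on the boxes meeting the hull: the three terms account
    for the monomial of degree \<open>1 - q\<close>, the growth of \<open>f\<close> at scale
    \<open>p ^ - (l + k)\<close>, and the damping function.\<close>
  define \<epsilon> where "\<epsilon> l = exp (1 + C' * B ^ (l + k) - (s * p) ^ l / 882)" for l
  have main: "exp (- (1 / (1 - 2 * s))) * norm (b (q - 1)) \<le> A * M + 3 * \<epsilon> l" for l
  proof -
    define N where "N = p ^ (l + k)"
    have N: "real N \<ge> 1" "N > 0" using p by (auto simp: N_def)
    define t where "t = 1 / real p ^ l"
    have t: "0 < t" "t \<le> 1" using p by (auto simp: t_def)
    \<comment> \<open>This height keeps \<open>z ^ q\<close> within \<open>1 + t / 2\<close>, and a
      vertical segment of half-length \<open>\<eta>\<close> fits into a ball of radius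
      \<open>1 / (7 * N)\<close> free of the hull.\<close>
    define \<eta> where "\<eta> = 1 / (32 * real N)"
    have \<eta>: "0 < \<eta>" "\<eta> \<le> 1" using N by (auto simp: \<eta>_def field_simps)
    have q\<eta>: "real q * \<eta> = t / 32" using p by (simp add: q_def \<eta>_def N_def t_def power_add)
    define F where "F = damping p s l"
    have holF: "F holomorphic_on ball 0 (1 + t)"
      unfolding F_def t_def by (rule damping_holomorphic[OF p s1 s])
    \<comment> \<open>The vertical lines cross the circle at the odd multiples of
      \<open>1 / (2 * N)\<close>, away from the hull.\<close>
    define x where "x m = (real m - 1 / 2) / N" for m :: nat
    \<comment> \<open>As \<open>dw\<close> is \<open>dz / (2 * pi * \<i> * z)\<close>, the exponent
      \<open>1 - q\<close> stands for \<open>z ^ - q\<close> against \<open>dz\<close>, which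
      selects the coefficient \<open>b (q - 1)\<close>.\<close>
    define \<Phi> where "\<Phi> w = F (char (int q) w) * char (1 - int q) w * f (char 1 w)" for w
    define S where "S = char 1 -` (- cantor_hull p) \<inter> {w. norm (char (int q) w) < 1 + t}"
    have norm_q: "norm (char (int q) w) \<le> 1 + t / 2" if "\<bar>Im w\<bar> \<le> \<eta>" for w
    proof -
      have "norm (char (int q) w) = exp (2 * pi * (real q * - Im w))" by (simp add: norm_char mult_ac)
      also have "real q * - Im w \<le> real q * \<eta>" using that by (intro mult_left_mono) auto
      then have "exp (2 * pi * (real q * - Im w)) \<le> exp (2 * pi * (real q * \<eta>))"
        unfolding exp_le_cancel_iff by (rule mult_left_mono) simp
      also have "\<dots> \<le> 1 + t / 2" unfolding q\<eta> by (rule exp_small_le) (use t in auto)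
      finally show ?thesis .
    qed
    have norm_q': "norm (char (int q) w) < 1 + t" if "\<bar>Im w\<bar> \<le> \<eta>" for w
      using norm_q[OF that] t by linarith
    have openS: "open S"
      unfolding S_def by (intro open_Int open_vimage open_Collect_less continuous_intros) (simp add: closed_cantor_hull open_Compl)
    have holS: "\<Phi> holomorphic_on S"
    proof -
      have "(F \<circ> char (int q)) holomorphic_on S"
        by (rule holomorphic_on_compose_gen[OF _ holF]) (auto intro!: holomorphic_intros simp: S_def)
      moreover have "(f \<circ> char 1) holomorphic_on S"
        by (rule holomorphic_on_compose_gen[OF _ hol]) (auto intro!: holomorphic_intros simp: S_def)
      ultimately show ?thesis unfolding \<Phi>_def[abs_def] comp_def by (intro holomorphic_intros)
    qed
    have ball_notin: "char 1 w \<notin> cantor_hull p" if "w \<in> ball (of_real (x m)) (1 / (7 * real N))" for w m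
      using char_midpoint_notin_cantor_hull[of p w m "l + k"] that p by (simp add: x_def N_def)
    have in_ball: "w \<in> ball (of_real (x m)) (1 / (7 * real N))" if "Re w = x m" "\<bar>Im w\<bar> \<le> \<eta>" for w m
    proof -
      have "w - of_real (x m) = \<i> * of_real (Im w)" using that by (simp add: complex_eq_iff)
      then have "dist (of_real (x m)) w = \<bar>Im w\<bar>" by (simp add: dist_norm norm_minus_commute norm_mult)
      also have "\<dots> < 1 / (7 * real N)" using that N by (simp add: \<eta>_def field_simps)
      finally show ?thesis by simp
    qed
    have f_bound: "norm (f (char 1 w)) \<le> exp (C' * B ^ (l + k))"
      if w: "\<bar>Im w\<bar> \<le> \<eta>" "\<bar>Im w\<bar> = \<eta> \<or> Re w = x m" for w m
    proof -
      have Npow: "real N powr \<beta> = B ^ (l + k)"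
        unfolding N_def B_def of_nat_power by (rule powr_of_nat_power) (use p in simp)
      have inv: "(1 / (r * real N)) powr - \<beta> = r powr \<beta> * B ^ (l + k)" if "r > 0" for r
        using that N by (simp add: powr_minus_divide powr_divide powr_mult Npow)
      from w(2) show ?thesis
      proof
        assume "\<bar>Im w\<bar> = \<eta>"
        then have "norm (f (char 1 w)) \<le> exp (C * \<eta> powr - \<beta>)" using C(2)[of w] \<eta> by simp
        also have "C * \<eta> powr - \<beta> = C * 32 powr \<beta> * B ^ (l + k)" by (simp add: \<eta>_def inv)
        also have "\<dots> \<le> C' * B ^ (l + k)"
        proof (rule mult_right_mono)
          have "C * 32 powr \<beta> * \<kappa> \<le> (C + 1) * 32 powr \<beta> * 1"
            using C(1) \<kappa> by (intro mult_mono) auto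
          then show "C * 32 powr \<beta> \<le> C'" using \<kappa> by (simp add: C'_def field_simps)
        qed (use \<open>1 \<le> B\<close> in auto)
        finally show ?thesis by simp
      next
        assume Re: "Re w = x m"
        have hol': "(\<lambda>w. f (char 1 w)) holomorphic_on ball (of_real (x m)) (1 / (7 * real N))"
        proof -
          have "(f \<circ> char 1) holomorphic_on ball (of_real (x m)) (1 / (7 * real N))"
            by (rule holomorphic_on_compose_gen[OF _ hol]) (use ball_notin in \<open>auto intro!: holomorphic_intros\<close>)
          then show ?thesis by (simp add: comp_def)
        qed
        \<comment> \<open>A vertical side crosses the circle, where the growth hypothesis gives
          nothing. The radius \<open>1 / (8 * N)\<close> lies strictly between \<open>\<eta>\<close>
          and the radius \<open>1 / (7 * N)\<close> of the ball avoiding the hull.\<close>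
        have "norm (f (char 1 w)) \<le> exp ((C + 1) * (1 / (8 * real N) / 2) powr - \<beta> / cos (\<beta> * pi / 2))"
        proof (rule holomorphic_bound_across_real_line[OF hol' _ _ \<beta>(1,2) C(1)])
          fix v assume v: "v \<in> ball (of_real (x m)) (1 / (7 * real N))" "Im v \<noteq> 0"
          have "\<bar>Im v\<bar> = \<bar>Im (v - of_real (x m))\<bar>" by simp
          also have "\<dots> \<le> norm (v - of_real (x m))" by (rule abs_Im_le_cmod)
          also have "\<dots> < 1 / (7 * real N)" using v(1) by (simp add: dist_norm norm_minus_commute)
          also have "\<dots> \<le> 1" using N by (simp add: field_simps)
          finally show "norm (f (char 1 v)) \<le> exp (C * \<bar>Im v\<bar> powr - \<beta>)" using v(2) by (intro C(2)) auto
        next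
          show "\<bar>Im w\<bar> < 1 / (8 * real N)" using w(1) N by (simp add: \<eta>_def field_simps)
        qed (use N Re in \<open>auto simp: field_simps\<close>)
        also have "(C + 1) * (1 / (8 * real N) / 2) powr - \<beta> / cos (\<beta> * pi / 2) = (C + 1) * 16 powr \<beta> / \<kappa> * B ^ (l + k)"
          using inv[of 16] by (simp add: \<kappa>_def)
        also have "\<dots> \<le> C' * B ^ (l + k)"
          unfolding C'_def using \<open>1 \<le> B\<close> \<kappa> C(1) \<beta>
          by (intro mult_right_mono divide_right_mono mult_left_mono powr_mono2) auto
        finally show ?thesis by simp
      qed
    qed
    have "norm (contour_integral (linepath (Complex (x 0) (- \<eta>)) (Complex (x 0 + 1) (- \<eta>))) \<Phi>
      - contour_integral (linepath (Complex (x 0) \<eta>) (Complex (x 0 + 1) \<eta>)) \<Phi>) \<le> \<epsilon> l * (2 + 4 * \<eta> * N)"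
    proof (rule strip_integral_bound[OF holS openS])
      show "\<Phi> (w + 1) = \<Phi> w" for w by (simp add: \<Phi>_def char_plus_1)
      show "x m = x 0 + real m / N" for m by (simp add: x_def diff_divide_distrib)
      show "w \<in> S" if "\<bar>Im w\<bar> = \<eta>" for w
      proof -
        have "norm (char 1 w) \<noteq> 1" using that \<eta> by (auto simp: norm_char)
        then show ?thesis using norm_q'[of w] that by (auto simp: S_def cantor_hull_def)
      qed
      show "w \<in> S" if "Re w = x m" "\<bar>Im w\<bar> \<le> \<eta>" for w m
        using ball_notin[OF in_ball[OF that]] norm_q'[of w] that by (auto simp: S_def)
      fix m assume "m < N"
      let ?R = "cbox (Complex (x m) (- \<eta>)) (Complex (x (Suc m)) \<eta>)"
      have ImR: "\<bar>Im w\<bar> \<le> \<eta>" if "w \<in> ?R" for w using that by (auto simp: in_cbox_complex_iff)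
      \<comment> \<open>A box meeting the hull has width only \<open>1 / N\<close>, so on all of it
        \<open>z ^ q\<close> is close to an endpoint of order \<open>l\<close>, where the damping
        acts.\<close>
      show "?R \<subseteq> S \<or> (\<forall>w\<in>?R. \<bar>Im w\<bar> = \<eta> \<or> Re w = x m \<or> Re w = x (Suc m) \<longrightarrow> norm (\<Phi> w) \<le> \<epsilon> l)"
      proof (cases "\<exists>w1\<in>?R. char 1 w1 \<in> cantor_hull p")
        case False
        then have "?R \<subseteq> S" using norm_q' ImR by (auto simp: S_def)
        then show ?thesis ..
      next
        case True
        then obtain w1 where w1: "w1 \<in> ?R" "char 1 w1 \<in> cantor_hull p" by blast
        have "norm (\<Phi> w) \<le> \<epsilon> l" if w: "w \<in> ?R" "\<bar>Im w\<bar> = \<eta> \<or> Re w = x m \<or> Re w = x (Suc m)" for w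
        proof -
          have xd: "x (Suc m) - x m = 1 / real N" by (simp add: x_def flip: diff_divide_distrib)
          have Re: "\<bar>Re w - Re w1\<bar> \<le> 1 / real p ^ (l + k)"
            using w(1) w1(1) xd by (auto simp: in_cbox_complex_iff N_def)
          have Im: "\<bar>Im w\<bar> \<le> 1 / (32 * real p ^ (l + k))" using ImR[OF w(1)] by (simp add: \<eta>_def N_def)
          obtain y where y: "y \<in> cantor_ends p l" "norm (char (int (p ^ k)) w - cis (2 * pi * y)) \<le> 20 / real p ^ l"
            using char_near_cantor_ends[OF _ w1(2) Re Im] p by auto
          have 1: "norm (F (char (int q) w)) \<le> exp (- ((s * p) ^ l / 882))"
            unfolding F_def
          proof (rule norm_damping_near[OF p s1 s y(1)])
            show "norm (char (int q) w) \<le> 1 + 1 / (2 * real p ^ l)" using norm_q[OF ImR[OF w(1)]] by (simp add: t_def)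
          qed (use y(2) in \<open>simp add: q_def\<close>)
          have "norm (char (1 - int q) w) = exp (2 * pi * ((real q - 1) * Im w))"
            by (simp add: norm_char algebra_simps)
          also have "(real q - 1) * Im w \<le> real q * \<eta>"
          proof -
            have "(real q - 1) * Im w \<le> (real q - 1) * \<eta>" using q ImR[OF w(1)] by (intro mult_left_mono) auto
            also have "\<dots> \<le> real q * \<eta>" using \<eta> by (intro mult_right_mono) auto
            finally show ?thesis .
          qed
          then have "exp (2 * pi * ((real q - 1) * Im w)) \<le> exp (2 * pi * (t / 32))"
            unfolding q\<eta> exp_le_cancel_iff by (rule mult_left_mono) simp
          also have "\<dots> \<le> 1 + t / 2" by (rule exp_small_le) (use t in auto)
          also have "\<dots> \<le> exp 1" using t exp_ge_add_one_self[of 1] by linarith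
          finally have 2: "norm (char (1 - int q) w) \<le> exp 1" .
          have 3: "norm (f (char 1 w)) \<le> exp (C' * B ^ (l + k))"
            using w(2) f_bound[OF ImR[OF w(1)]] by blast
          have "norm (\<Phi> w) \<le> (exp (- ((s * p) ^ l / 882)) * exp 1) * exp (C' * B ^ (l + k))"
            unfolding \<Phi>_def norm_mult by (intro mult_mono 1 2 3 mult_nonneg_nonneg) auto
          also have "\<dots> = \<epsilon> l" 
            unfolding \<epsilon>_def exp_add[symmetric] by (rule arg_cong[where f = exp]) simp
          finally show ?thesis .
        qed
        then show ?thesis by blast
      qed
    qed (use N \<eta> in \<open>auto simp: \<epsilon>_def\<close>)
    \<comment> \<open>The choice of \<open>\<eta>\<close> gives
      \<open>4 * \<eta> * N = 1 / 8\<close>.\<close>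
    also have "\<dots> \<le> \<epsilon> l * 3" unfolding \<eta>_def \<epsilon>_def using N by (intro mult_left_mono) auto
    finally have diff: "norm (contour_integral (linepath (Complex (x 0) (- \<eta>)) (Complex (x 0 + 1) (- \<eta>))) \<Phi>
      - contour_integral (linepath (Complex (x 0) \<eta>) (Complex (x 0 + 1) \<eta>)) \<Phi>) \<le> \<epsilon> l * 3" .
    define Io where "Io = contour_integral (linepath (Complex (x 0) (- \<eta>)) (Complex (x 0 + 1) (- \<eta>))) \<Phi>"
    define Ii where "Ii = contour_integral (linepath (Complex (x 0) \<eta>) (Complex (x 0 + 1) \<eta>)) \<Phi>"
    have shift: "Complex (x 0 + 1) y = Complex (x 0) y + 1" for y by (simp add: complex_eq_iff)
    have "norm Io \<le> A * M"
      unfolding Io_def \<Phi>_def shift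
    proof (rule outer_pairing[OF holF _ q _ _ _ outer c])
      show "exp (- (2 * pi * real q * Im (Complex (x 0) (- \<eta>)))) < 1 + t"
        using norm_q'[of "Complex (x 0) (- \<eta>)"] \<eta> by (simp add: norm_char)
    qed (use \<eta> A in \<open>auto simp: F_def simp del: funpow.simps\<close>)
    moreover have "norm Ii \<le> norm Io + norm (Io - Ii)"
      using norm_triangle_ineq4[of Io "Io - Ii"] by simp
    moreover have "norm (Io - Ii) \<le> \<epsilon> l * 3" using diff by (simp only: Io_def Ii_def)
    moreover have "norm Ii = norm (F 0 * b (q - 1))"
    proof -
      have "Ii = - F 0 * b (q - 1)"
        unfolding Ii_def \<Phi>_def shift by (rule inner_pairing[OF holF _ q _ inner]) (use t \<eta> in auto)
      then show ?thesis by simp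
    qed
    ultimately have "norm (F 0 * b (q - 1)) \<le> A * M + \<epsilon> l * 3" by linarith
    moreover have "exp (- (1 / (1 - 2 * s))) * norm (b (q - 1)) \<le> norm (F 0 * b (q - 1))"
      unfolding norm_mult F_def by (intro mult_right_mono norm_damping_0[OF p s1 s]) auto
    ultimately show ?thesis by linarith
  qed
  \<comment> \<open>Here \<open>k\<close> is fixed and \<open>B = p powr \<beta> < s * p\<close>, so
    the damping term \<open>(s * p) ^ l\<close> eventually dominates the growth term
    \<open>B ^ (l + k)\<close>.\<close>
  have "\<epsilon> \<longlonglongrightarrow> 0"
  proof -
    have sp: "s * p > 0" using \<open>1 < s * p\<close> by linarith
    have "B / (s * p) < 1" unfolding pos_divide_less_eq[OF sp] using \<beta>(3) by (simp add: B_def)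
    moreover have "0 \<le> B / (s * p)" using \<open>1 \<le> B\<close> sp by (intro divide_nonneg_nonneg) linarith+
    ultimately have "norm (B / (s * p)) < 1" by (simp only: real_norm_def abs_of_nonneg)
    then have "(\<lambda>l. (B / (s * p)) ^ l) \<longlonglongrightarrow> 0" by (rule LIMSEQ_power_zero)
    then have lim: "(\<lambda>l. 1 / 882 - C' * B ^ k * (B / (s * p)) ^ l) \<longlonglongrightarrow> 1 / 882 - C' * B ^ k * 0"
      by (intro tendsto_diff tendsto_mult tendsto_const)
    have top: "filterlim (\<lambda>l. (s * p) ^ l) at_top sequentially"
      by (rule filterlim_at_infinity_imp_filterlim_at_top[OF filterlim_realpow_sequentially_gt1])
         (use \<open>1 < s * p\<close> sp in \<open>auto simp del: zero_less_mult_iff intro!: always_eventually zero_less_power\<close>)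
    have "filterlim (\<lambda>l. (1 / 882 - C' * B ^ k * (B / (s * p)) ^ l) * (s * p) ^ l) at_top sequentially"
      by (rule filterlim_tendsto_pos_mult_at_top[OF lim _ top]) simp
    moreover have "(1 / 882 - C' * B ^ k * (B / (s * p)) ^ l) * (s * p) ^ l = (s * p) ^ l / 882 - C' * B ^ (l + k)" for l
    proof -
      have "s \<noteq> 0" "p \<noteq> 0" using sp p by auto
      then show ?thesis by (simp add: left_diff_distrib power_divide power_add)
    qed
    ultimately have "filterlim (\<lambda>l. (s * p) ^ l / 882 - C' * B ^ (l + k)) at_top sequentially" by simp
    then have "filterlim (\<lambda>l. -1 + ((s * p) ^ l / 882 - C' * B ^ (l + k))) at_top sequentially"
      by (rule filterlim_tendsto_add_at_top[OF tendsto_const])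
    then have "filterlim (\<lambda>l. - (- 1 + ((s * p) ^ l / 882 - C' * B ^ (l + k)))) at_bot sequentially"
      by (simp only: filterlim_uminus_at_top)
    moreover have "- (- 1 + ((s * p) ^ l / 882 - C' * B ^ (l + k))) = 1 + C' * B ^ (l + k) - (s * p) ^ l / 882" for l
      by simp
    ultimately have "filterlim (\<lambda>l. 1 + C' * B ^ (l + k) - (s * p) ^ l / 882) at_bot sequentially"
      by (simp only:)
    then show ?thesis unfolding \<epsilon>_def by (rule filterlim_compose[OF exp_at_bot])
  qed
  then have "(\<lambda>l. A * M + 3 * \<epsilon> l) \<longlonglongrightarrow> A * M + 3 * 0" by (intro tendsto_intros)
  then have "exp (- (1 / (1 - 2 * s))) * norm (b (q - 1)) \<le> A * M + 3 * 0"
    by (rule LIMSEQ_le_const) (use main in auto)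
  then show ?thesis by (simp add: q_def exp_minus field_simps)
qed

section \<open>Norming functionals\<close>

text \<open>The one-step extension in the proof of the Hahn-Banach theorem; functionals on subspaces are
represented by their graphs.\<close>

lemma dominated_graph_extend:
  fixes G :: "('a::real_normed_vector \<times> real) set"
  assumes sub: "subspace G" and dom: "\<And>y r. (y, r) \<in> G \<Longrightarrow> r \<le> norm y"
  shows "\<exists>G'. subspace G' \<and> G \<subseteq> G' \<and> (\<forall>(y, r)\<in>G'. r \<le> norm y) \<and> (\<exists>c. (y0, c) \<in> G')"
proof -
  define B where "B = (\<lambda>(y, r). r - norm (y - y0)) ` G"
  have zero: "(0, 0) \<in> G" using subspace_0[OF sub] by (simp add: zero_prod_def)
  have le: "r - norm (y - y0) \<le> norm (y' + y0) - r'" if "(y, r) \<in> G" "(y', r') \<in> G" for y r y' r'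
  proof -
    have "(y + y', r + r') \<in> G" using subspace_add[OF sub that] by simp
    then have "r + r' \<le> norm (y + y')" by (rule dom)
    also have "\<dots> = norm ((y - y0) + (y' + y0))" by simp
    also have "\<dots> \<le> norm (y - y0) + norm (y' + y0)" by (rule norm_triangle_ineq)
    finally show ?thesis by simp
  qed
  \<comment> \<open>The admissible values at \<open>y0\<close> are those between all
    \<open>r - norm (y - y0)\<close> and all \<open>norm (y' + y0) - r'\<close>. By the inequality
    just proved such values exist, and the least one is taken.\<close>
  define c where "c = Sup B"
  have bdd: "bdd_above B"
    unfolding bdd_above_def B_def using le[OF _ zero] by (intro exI[of _ "norm (0 + y0) - 0"]) auto
  have c1: "r - norm (y - y0) \<le> c" if "(y, r) \<in> G" for y r
    unfolding c_def by (rule cSup_upper[OF _ bdd]) (use that in \<open>force simp: B_def\<close>)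
  have c2: "c \<le> norm (y + y0) - r" if "(y, r) \<in> G" for y r
    unfolding c_def by (rule cSup_least) (use zero le[OF _ that] in \<open>auto simp: B_def\<close>)
  define G' where "G' = {(y + t *\<^sub>R y0, r + t * c) | y r t. (y, r) \<in> G}"
  have "subspace G'"
    unfolding subspace_def
  proof (intro conjI ballI allI)
    have "(0 + 0 *\<^sub>R y0, 0 + 0 * c) \<in> G'" unfolding G'_def using zero by blast
    then show "0 \<in> G'" by (simp add: zero_prod_def)
  next
    fix u v assume "u \<in> G'" "v \<in> G'"
    then obtain y r t y' r' t' where uv: "(y, r) \<in> G" "u = (y + t *\<^sub>R y0, r + t * c)"
       "(y', r') \<in> G" "v = (y' + t' *\<^sub>R y0, r' + t' * c)" unfolding G'_def by blast
    have "(y + y', r + r') \<in> G" using subspace_add[OF sub uv(1,3)] by simp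
    moreover have "u + v = ((y + y') + (t + t') *\<^sub>R y0, (r + r') + (t + t') * c)"
      by (simp add: uv algebra_simps)
    ultimately show "u + v \<in> G'" unfolding G'_def by blast
  next
    fix k :: real and u assume "u \<in> G'"
    then obtain y r t where u: "(y, r) \<in> G" "u = (y + t *\<^sub>R y0, r + t * c)" unfolding G'_def by blast
    have "(k *\<^sub>R y, k * r) \<in> G" using subspace_scale[OF sub u(1), of k] by simp
    moreover have "k *\<^sub>R u = (k *\<^sub>R y + (k * t) *\<^sub>R y0, k * r + (k * t) * c)"
      by (simp add: u algebra_simps)
    ultimately show "k *\<^sub>R u \<in> G'" unfolding G'_def by blast
  qed
  moreover have "G \<subseteq> G'"
  proof
    fix u assume "u \<in> G"
    obtain y r where u: "u = (y, r)" by (cases u)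
    have "(y + 0 *\<^sub>R y0, r + 0 * c) \<in> G'" unfolding G'_def using \<open>u \<in> G\<close> u by blast
    then show "u \<in> G'" by (simp add: u)
  qed
  moreover have "(0 + 1 *\<^sub>R y0, 0 + 1 * c) \<in> G'" unfolding G'_def using zero by blast
  then have "(y0, c) \<in> G'" by simp
  \<comment> \<open>By homogeneity only \<open>t = 1\<close> and \<open>t = - 1\<close> matter, and
    these are the two inequalities for \<open>c\<close>.\<close>
  moreover have "r + t * c \<le> norm (y + t *\<^sub>R y0)" if G: "(y, r) \<in> G" for y r t
  proof -
    have scaled: "(k *\<^sub>R y, k * r) \<in> G" for k using subspace_scale[OF sub G, of k] by simp
    consider "t = 0" | "t > 0" | "t < 0" by linarith
    then show ?thesis
    proof cases
      case 1 then show ?thesis using dom[OF G] by simp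
    next
      case 2
      have "c \<le> norm ((1 / t) *\<^sub>R y + y0) - (1 / t) * r" by (rule c2[OF scaled])
      then have "t * ((1 / t) * r + c) \<le> t * norm ((1 / t) *\<^sub>R y + y0)" using 2 by (intro mult_left_mono) auto
      also have "\<dots> = norm (t *\<^sub>R ((1 / t) *\<^sub>R y + y0))" using 2 by simp
      finally show ?thesis using 2 by (simp add: algebra_simps)
    next
      case 3
      have "(1 / - t) * r - norm ((1 / - t) *\<^sub>R y - y0) \<le> c" by (rule c1[OF scaled])
      then have "- t * ((1 / - t) * r - c) \<le> - t * norm ((1 / - t) *\<^sub>R y - y0)" using 3 by (intro mult_left_mono) auto
      also have "\<dots> = norm (- t *\<^sub>R ((1 / - t) *\<^sub>R y - y0))" using 3 by simp
      finally show ?thesis using 3 by (simp add: algebra_simps)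
    qed
  qed
  then have "\<forall>(y, r)\<in>G'. r \<le> norm y" unfolding G'_def by blast
  ultimately show ?thesis by blast
qed

text \<open>Zorn's lemma is applied to the dominated graphs that contain \<open>(x, norm x)\<close>,
  starting from the line it spans. A maximal one is total by the one-step extension.\<close>

lemma exists_norming_functional:
  fixes x :: "'a::real_normed_vector"
  shows "\<exists>f. linear f \<and> (\<forall>y. f y \<le> norm y) \<and> f x = norm x"
proof -
  define \<A> where "\<A> = {G :: ('a \<times> real) set. subspace G \<and> (x, norm x) \<in> G \<and> (\<forall>(y, r)\<in>G. r \<le> norm y)}"
  have "\<exists>M\<in>\<A>. \<forall>X\<in>\<A>. M \<subseteq> X \<longrightarrow> X = M"
  proof (rule subset_Zorn_nonempty)
    have "t * norm x \<le> norm (t *\<^sub>R x)" for t by (simp add: mult_right_mono)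
    then have "\<forall>(y, r)\<in>span {(x, norm x)}. r \<le> norm y" by (auto simp: span_singleton)
    then have "span {(x, norm x)} \<in> \<A>" by (simp add: \<A>_def span_base)
    then show "\<A> \<noteq> {}" by blast
  next
    fix \<C> assume "\<C> \<noteq> {}" and chain: "subset.chain \<A> \<C>"
    then have C: "G \<in> \<A>" if "G \<in> \<C>" for G using that by (auto simp: subset.chain_def)
    have "subspace (\<Union>\<C>)"
      unfolding subspace_def
    proof (intro conjI ballI allI)
      show "0 \<in> \<Union>\<C>" using C \<open>\<C> \<noteq> {}\<close> subspace_0 by (fastforce simp: \<A>_def)
      fix u v assume "u \<in> \<Union>\<C>" "v \<in> \<Union>\<C>"
      then obtain G H where "G \<in> \<C>" "u \<in> G" "H \<in> \<C>" "v \<in> H" by blast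
      moreover from this have "G \<subseteq> H \<or> H \<subseteq> G" using chain subset_chain_def by metis
      ultimately obtain F where F: "F \<in> \<C>" "u \<in> F" "v \<in> F" by blast
      then have "u + v \<in> F" using C by (auto simp: \<A>_def intro: subspace_add)
      then show "u + v \<in> \<Union>\<C>" using F by blast
    next
      fix k :: real and u assume "u \<in> \<Union>\<C>"
      then show "k *\<^sub>R u \<in> \<Union>\<C>" using C by (auto simp: \<A>_def intro: subspace_scale)
    qed
    then show "\<Union>\<C> \<in> \<A>" using C \<open>\<C> \<noteq> {}\<close> by (fastforce simp: \<A>_def)
  qed
  then obtain G where G: "G \<in> \<A>" and max: "\<And>X. X \<in> \<A> \<Longrightarrow> G \<subseteq> X \<Longrightarrow> X = G" by blast
  have sub: "subspace G" and xG: "(x, norm x) \<in> G" and dom: "\<And>y r. (y, r) \<in> G \<Longrightarrow> r \<le> norm y"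
    using G by (auto simp: \<A>_def)
  have total: "\<exists>r. (y, r) \<in> G" for y
  proof -
    obtain G' where "subspace G'" "G \<subseteq> G'" "\<forall>(y, r)\<in>G'. r \<le> norm y" "\<exists>c. (y, c) \<in> G'"
      using dominated_graph_extend[OF sub dom, of y] by blast
    moreover from this have "G' = G" using xG by (intro max) (auto simp: \<A>_def)
    ultimately show ?thesis by blast
  qed
  \<comment> \<open>Domination alone makes the graph single-valued: both \<open>(0, r - r')\<close>
    and \<open>(0, r' - r)\<close> lie in it.\<close>
  have unique: "r = r'" if "(y, r) \<in> G" "(y, r') \<in> G" for y r r'
  proof -
    have "(y - y, r - r') \<in> G" "(y - y, r' - r) \<in> G"
      using subspace_diff[OF sub] that by (metis diff_Pair)+
    from dom[OF this(1)] dom[OF this(2)] show ?thesis by simp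
  qed
  define f where "f y = (THE r. (y, r) \<in> G)" for y
  have f: "(y, f y) \<in> G" for y
    unfolding f_def using total[of y] unique by (metis the_equality)
  have f_eq: "f y = r" if "(y, r) \<in> G" for y r using unique[OF f that] .
  have "linear f"
  proof (rule linearI)
    show "f (a + b) = f a + f b" for a b using subspace_add[OF sub f[of a] f[of b]] by (intro f_eq) simp
    show "f (k *\<^sub>R a) = k *\<^sub>R f a" for k a using subspace_scale[OF sub f[of a], of k] by (intro f_eq) simp
  qed
  then show ?thesis using f_eq[OF xG] dom[OF f] by blast
qed

section \<open>The resolvent\<close>

lemma blinfun_compose_assoc: "(A o\<^sub>L B) o\<^sub>L C = A o\<^sub>L (B o\<^sub>L C)"
  by (rule blinfun_eqI) simp

lemma blinfun_compose_id [simp]: "A o\<^sub>L id_blinfun = A" "id_blinfun o\<^sub>L A = A"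
  by (rule blinfun_eqI, simp)+

lemma op_pow_0 [simp]: "op_pow A 0 = id_blinfun"
  by (simp add: op_pow_def)

lemma op_pow_Suc: "op_pow A (Suc n) = A o\<^sub>L op_pow A n"
  by (simp add: op_pow_def)

lemma op_pow_Suc_apply: "blinfun_apply (op_pow A (Suc n)) y = blinfun_apply A (blinfun_apply (op_pow A n) y)"
  by (simp add: op_pow_Suc)

lemma op_pow_Suc_apply': "blinfun_apply (op_pow A (Suc n)) y = blinfun_apply (op_pow A n) (blinfun_apply A y)"
  by (induction n) (simp_all add: op_pow_Suc)

lemma norm_op_pow_le:
  assumes "norm A \<le> 1"
  shows "norm (blinfun_apply (op_pow A n) y) \<le> norm y"
proof (induction n)
  case (Suc n)
  have "norm (blinfun_apply (op_pow A (Suc n)) y) \<le> norm A * norm (blinfun_apply (op_pow A n) y)"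
    unfolding op_pow_Suc_apply by (rule norm_blinfun)
  also have "\<dots> \<le> 1 * norm (blinfun_apply (op_pow A n) y)"
    using assms by (intro mult_right_mono) auto
  finally show ?case using Suc by simp
qed simp

text \<open>Each power of \<open>S\<close> is recovered from the next one by applying the
  contraction \<open>T\<close>.\<close>

lemma norm_op_pow_inverse_mono:
  assumes "S o\<^sub>L T = id_blinfun" "T o\<^sub>L S = id_blinfun" "norm T \<le> 1" "m \<le> n"
  shows "norm (op_pow S m) \<le> norm (op_pow S n)"
  using assms(4)
proof (induction rule: dec_induct)
  case (step n)
  have "T o\<^sub>L op_pow S (Suc n) = op_pow S n"
    using assms(2) by (simp add: op_pow_Suc flip: blinfun_compose_assoc)
  then have "norm (op_pow S n) \<le> norm T * norm (op_pow S (Suc n))"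
    by (metis norm_blinfun_compose)
  also have "\<dots> \<le> 1 * norm (op_pow S (Suc n))" using assms(3) by (intro mult_right_mono) auto
  finally show ?case using step by simp
qed simp

section \<open>Complex functionals and the resolvent of an operator commuting with
  \<open>J\<close>\<close>

context
  fixes J :: "'a::real_normed_vector \<Rightarrow>\<^sub>L 'a"
  assumes J: "complex_structure J"
begin

lemma J_J: "blinfun_apply J (blinfun_apply J y) = - y"
proof -
  have "blinfun_apply (J o\<^sub>L J) y = blinfun_apply (- id_blinfun) y" using J by (simp add: complex_structure_def)
  then show ?thesis by (simp add: uminus_blinfun.rep_eq)
qed

lemma cscal_apply: "blinfun_apply (cscal J z) y = Re z *\<^sub>R y + Im z *\<^sub>R blinfun_apply J y"
  by (simp add: cscal_def blinfun.add_left blinfun.scaleR_left)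

lemma norm_cscal: "norm (blinfun_apply (cscal J z) y) = cmod z * norm y"
  using J by (simp add: complex_structure_def)

lemma norm_J: "norm (blinfun_apply J y) = norm y"
  using norm_cscal[of \<i> y] by (simp add: cscal_apply)

lemma cscal_commute:
  assumes "clinear_op J A"
  shows "blinfun_apply A (blinfun_apply (cscal J z) y) = blinfun_apply (cscal J z) (blinfun_apply A y)"
proof -
  have "blinfun_apply (A o\<^sub>L J) y = blinfun_apply (J o\<^sub>L A) y" using assms by (simp add: clinear_op_def)
  then have "blinfun_apply A (blinfun_apply J y) = blinfun_apply J (blinfun_apply A y)" by simp
  then show ?thesis by (simp add: cscal_apply blinfun.add_right blinfun.scaleR_right)
qed

lemma cscal_cscal_commute:
  "blinfun_apply (cscal J w) (blinfun_apply (cscal J z) y) = blinfun_apply (cscal J z) (blinfun_apply (cscal J w) y)"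
  by (simp add: cscal_apply blinfun.add_right blinfun.scaleR_right algebra_simps)

lemma cscal_diff: "blinfun_apply (cscal J (w - z)) y = blinfun_apply (cscal J w) y - blinfun_apply (cscal J z) y"
  by (simp add: cscal_apply algebra_simps)

lemma clinear_op_inverse:
  assumes "clinear_op J T" "S o\<^sub>L T = id_blinfun" "T o\<^sub>L S = id_blinfun"
  shows "clinear_op J S"
proof -
  have "S o\<^sub>L J = S o\<^sub>L (J o\<^sub>L (T o\<^sub>L S))" using assms by simp
  also have "\<dots> = S o\<^sub>L ((T o\<^sub>L J) o\<^sub>L S)" using assms(1) by (simp add: clinear_op_def blinfun_compose_assoc)
  also have "\<dots> = (S o\<^sub>L T) o\<^sub>L (J o\<^sub>L S)" by (simp add: blinfun_compose_assoc)
  also have "\<dots> = J o\<^sub>L S" using assms by simp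
  finally show ?thesis by (simp add: clinear_op_def)
qed

lemma clinear_op_pow: "clinear_op J A \<Longrightarrow> clinear_op J (op_pow A n)"
proof (induction n)
  case (Suc n)
  then show ?case unfolding clinear_op_def op_pow_Suc by (metis blinfun_compose_assoc)
qed (simp add: clinear_op_def)

text \<open>The complex-linear functional whose real part is \<open>f\<close>.\<close>

definition "cfunctional f y = Complex (f y) (- f (blinfun_apply J y))"

lemma cfunctional_add: "linear f \<Longrightarrow> cfunctional f (y + z) = cfunctional f y + cfunctional f z"
  by (simp add: cfunctional_def linear_add blinfun.add_right complex_eq_iff)

lemma cfunctional_minus: "linear f \<Longrightarrow> cfunctional f (- y) = - cfunctional f y"
  by (simp add: cfunctional_def linear_neg blinfun.minus_right complex_eq_iff)

lemma cfunctional_diff: "linear f \<Longrightarrow> cfunctional f (y - z) = cfunctional f y - cfunctional f z"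
  by (simp add: cfunctional_def linear_diff blinfun.diff_right complex_eq_iff)

lemma cfunctional_cscal: "linear f \<Longrightarrow> cfunctional f (blinfun_apply (cscal J z) y) = z * cfunctional f y"
  by (simp add: cfunctional_def cscal_apply linear_add linear_diff linear_scale linear_neg blinfun.add_right blinfun.scaleR_right J_J complex_eq_iff algebra_simps)

lemma norm_cfunctional_le:
  assumes "linear f" "\<And>y. f y \<le> norm y"
  shows "norm (cfunctional f y) \<le> 2 * norm y"
proof -
  have abs: "\<bar>f y\<bar> \<le> norm y" for y using assms(2)[of y] assms(2)[of "- y"] by (simp add: linear_neg[OF assms(1)])
  have "norm (cfunctional f y) \<le> \<bar>f y\<bar> + \<bar>f (blinfun_apply J y)\<bar>"
    using cmod_le[of "cfunctional f y"] by (simp add: cfunctional_def)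
  also have "\<dots> \<le> norm y + norm y" using abs[of y] abs[of "blinfun_apply J y"] by (simp add: norm_J)
  finally show ?thesis by simp
qed

text \<open>The inverse of \<open>T - z\<close>, not of \<open>z - T\<close>, whence the minus signs
  below. On the spectrum the value is arbitrary.\<close>

definition "resolvent T z = (SOME B. B o\<^sub>L (T - cscal J z) = id_blinfun \<and> (T - cscal J z) o\<^sub>L B = id_blinfun)"

lemma resolvent_inverse:
  assumes "z \<notin> op_spectrum J T"
  shows "resolvent T z o\<^sub>L (T - cscal J z) = id_blinfun" "(T - cscal J z) o\<^sub>L resolvent T z = id_blinfun"
proof -
  have "\<exists>B. B o\<^sub>L (T - cscal J z) = id_blinfun \<and> (T - cscal J z) o\<^sub>L B = id_blinfun"
    using assms by (simp add: op_spectrum_def invertible_op_def)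
  from someI_ex[OF this] show "resolvent T z o\<^sub>L (T - cscal J z) = id_blinfun" "(T - cscal J z) o\<^sub>L resolvent T z = id_blinfun"
    unfolding resolvent_def by auto
qed

lemma resolvent_right:
  assumes "z \<notin> op_spectrum J T"
  shows "blinfun_apply T (blinfun_apply (resolvent T z) v) = v + blinfun_apply (cscal J z) (blinfun_apply (resolvent T z) v)"
proof -
  have "blinfun_apply ((T - cscal J z) o\<^sub>L resolvent T z) v = v" using resolvent_inverse(2)[OF assms] by simp
  then show ?thesis by (simp add: blinfun.diff_left algebra_simps)
qed

lemma resolvent_unique:
  assumes "z \<notin> op_spectrum J T" "blinfun_apply T u = v + blinfun_apply (cscal J z) u"
  shows "u = blinfun_apply (resolvent T z) v"
proof -
  have "u = blinfun_apply (resolvent T z o\<^sub>L (T - cscal J z)) u" using resolvent_inverse(1)[OF assms(1)] by simp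
  also have "\<dots> = blinfun_apply (resolvent T z) (blinfun_apply T u - blinfun_apply (cscal J z) u)"
    by (simp add: blinfun.diff_left)
  also have "blinfun_apply T u - blinfun_apply (cscal J z) u = v" using assms(2) by simp
  finally show ?thesis .
qed

text \<open>The vector \<open>R(z) v + (w - z) R(w) R(z) v\<close> is mapped to \<open>v\<close> by
  \<open>T - w\<close>, so it equals \<open>R(w) v\<close>.\<close>

lemma resolvent_identity:
  assumes T: "clinear_op J T" and "w \<notin> op_spectrum J T" "z \<notin> op_spectrum J T"
  shows "blinfun_apply (resolvent T w) v - blinfun_apply (resolvent T z) v =
    blinfun_apply (cscal J (w - z)) (blinfun_apply (resolvent T w) (blinfun_apply (resolvent T z) v))"
proof -
  let ?R = "\<lambda>z. blinfun_apply (resolvent T z)"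
  have "blinfun_apply T (?R z v + blinfun_apply (cscal J (w - z)) (?R w (?R z v)))
     = v + blinfun_apply (cscal J w) (?R z v + blinfun_apply (cscal J (w - z)) (?R w (?R z v)))"
    using resolvent_right[OF assms(2), of "?R z v"] resolvent_right[OF assms(3), of v]
    by (simp add: blinfun.add_right cscal_commute[OF T] cscal_cscal_commute[of w "w - z"])
       (simp add: cscal_diff blinfun.add_right)
  from resolvent_unique[OF assms(2) this] show ?thesis by (simp add: algebra_simps)
qed

text \<open>For \<open>w\<close> close to \<open>z\<close>, the resolvent identity gives
  \<open>norm (R(w) u) \<le> 2 * norm (R(z) u)\<close>; used once more with
  \<open>u = R(z) v\<close>, it makes the difference of order \<open>norm (w - z)\<close>. The
  closed set \<open>K\<close> supplies the neighbourhood of \<open>z\<close> on which the resolvent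
  exists.\<close>

lemma resolvent_tendsto:
  assumes T: "clinear_op J T" and K: "closed K" "op_spectrum J T \<subseteq> K" and z: "z \<notin> K"
  shows "((\<lambda>w. blinfun_apply (resolvent T w) v) \<longlongrightarrow> blinfun_apply (resolvent T z) v) (at z)"
proof -
  let ?R = "\<lambda>z. blinfun_apply (resolvent T z)"
  define C where "C = norm (resolvent T z) + 1"
  have C: "C > 0" by (simp add: C_def add_nonneg_pos)
  have "eventually (\<lambda>w. w \<in> - K) (at z)"
    using K(1) z by (intro eventually_at_in_open') auto
  moreover have "eventually (\<lambda>w. dist w z < 1 / (2 * C)) (at z)"
    using C by (intro eventually_at_ball[THEN eventually_mono]) (auto simp: dist_commute)
  ultimately have "eventually (\<lambda>w. norm (?R w v - ?R z v) \<le> norm (w - z) * (2 * norm (?R z (?R z v)))) (at z)"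
  proof eventually_elim
    case (elim w)
    have wz: "w \<notin> op_spectrum J T" "z \<notin> op_spectrum J T" using elim z K by auto
    have wzC: "norm (z - w) * C \<le> 1 / 2" using elim(2) C by (simp add: dist_norm norm_minus_commute field_simps)
    let ?u = "?R z v"
    have "?R z ?u - ?R w ?u = blinfun_apply (cscal J (z - w)) (?R z (?R w ?u))"
      by (rule resolvent_identity[OF T wz(2,1)])
    then have "norm (?R z ?u - ?R w ?u) = norm (z - w) * norm (?R z (?R w ?u))" by (simp add: norm_cscal)
    also have "\<dots> \<le> norm (z - w) * (norm (resolvent T z) * norm (?R w ?u))"
      by (intro mult_left_mono norm_blinfun) auto
    also have "\<dots> \<le> norm (z - w) * (C * norm (?R w ?u))"
      by (intro mult_left_mono mult_right_mono) (auto simp: C_def)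
    also have "\<dots> \<le> 1 / 2 * norm (?R w ?u)"
      using mult_right_mono[OF wzC, of "norm (?R w ?u)"] by (simp add: mult.assoc)
    finally have "norm (?R w ?u) \<le> 2 * norm (?R z ?u)"
      using norm_triangle_ineq3[of "?R z ?u" "?R w ?u"] by linarith
    then have "norm (w - z) * norm (?R w ?u) \<le> norm (w - z) * (2 * norm (?R z ?u))" by (intro mult_left_mono) auto
    then show ?case unfolding resolvent_identity[OF T wz] norm_cscal .
  qed
  moreover have "((\<lambda>w. norm (w - z) * (2 * norm (?R z (?R z v)))) \<longlongrightarrow> norm (z - z) * (2 * norm (?R z (?R z v)))) (at z)"
    by (intro tendsto_intros)
  then have "((\<lambda>w. norm (w - z) * (2 * norm (?R z (?R z v)))) \<longlongrightarrow> 0) (at z)" by simp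
  ultimately have "((\<lambda>w. ?R w v - ?R z v) \<longlongrightarrow> 0) (at z)"
    by (rule Lim_null_comparison)
  then show ?thesis by (simp add: LIM_zero_iff)
qed

text \<open>By the resolvent identity the difference quotient is the functional applied to
  \<open>- R(w) R(z) x\<close>, and strong continuity of the resolvent gives its limit.\<close>

lemma resolvent_holomorphic:
  assumes T: "clinear_op J T" and K: "closed K" "op_spectrum J T \<subseteq> K" 
    and f: "linear f" "\<And>y. f y \<le> norm y"
  shows "(\<lambda>z. - cfunctional f (blinfun_apply (resolvent T z) x)) holomorphic_on - K"
proof -
  let ?R = "\<lambda>z. blinfun_apply (resolvent T z)"
  let ?l = "cfunctional f"
  have "\<exists>D. ((\<lambda>z. - ?l (?R z x)) has_field_derivative D) (at z)" if z: "z \<in> - K" for z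
  proof
    have "eventually (\<lambda>w. w \<in> - K - {z}) (at z)"
      using K(1) z by (intro eventually_at_in_open) auto
    then have "eventually (\<lambda>w. - ?l (?R w (?R z x)) = (- ?l (?R w x) - - ?l (?R z x)) / (w - z)) (at z)"
    proof eventually_elim
      case (elim w)
      have wz: "w \<notin> op_spectrum J T" "z \<notin> op_spectrum J T" using elim z K by auto
      have "?l (?R w x) = ?l (?R w x - ?R z x) + ?l (?R z x)"
        using cfunctional_add[OF f(1), of "?R w x - ?R z x" "?R z x"] by simp
      also have "?l (?R w x - ?R z x) = (w - z) * ?l (?R w (?R z x))"
        unfolding resolvent_identity[OF T wz] by (rule cfunctional_cscal[OF f(1)])
      finally show ?case using elim by (simp add: field_simps)
    qed
    moreover have "((\<lambda>w. - ?l (?R w (?R z x))) \<longlongrightarrow> - ?l (?R z (?R z x))) (at z)"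
    proof -
      have "((\<lambda>w. ?l (?R w (?R z x) - ?R z (?R z x))) \<longlongrightarrow> 0) (at z)"
      proof (rule Lim_null_comparison)
        show "eventually (\<lambda>w. norm (?l (?R w (?R z x) - ?R z (?R z x))) \<le> 2 * norm (?R w (?R z x) - ?R z (?R z x))) (at z)"
          using norm_cfunctional_le[OF f] by (intro always_eventually allI)
        have "((\<lambda>w. ?R w (?R z x) - ?R z (?R z x)) \<longlongrightarrow> 0) (at z)"
          using resolvent_tendsto[OF T K, of z "?R z x"] z by (simp add: LIM_zero_iff)
        then show "((\<lambda>w. 2 * norm (?R w (?R z x) - ?R z (?R z x))) \<longlongrightarrow> 0) (at z)"
          using tendsto_mult_right_zero tendsto_norm_zero by blast
      qed
      then show ?thesis
        by (intro tendsto_minus) (simp add: cfunctional_diff[OF f(1)] LIM_zero_iff)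
    qed
    ultimately show "((\<lambda>z. - ?l (?R z x)) has_field_derivative - ?l (?R z (?R z x))) (at z)"
      unfolding has_field_derivative_iff by (rule Lim_transform_eventually[rotated])
  qed
  then show ?thesis unfolding holomorphic_on_open[OF open_Compl[OF K(1)]] by blast
qed

text \<open>For \<open>y = (z - T)^-1 x\<close> the relation \<open>z y = x + T y\<close> makes the
  partial sums telescope. The remainder is the functional at \<open>T^n y\<close>, divided by
  \<open>z ^ n\<close>, and it vanishes because \<open>T\<close> is a contraction.\<close>

lemma resolvent_outer_series:
  assumes T: "clinear_op J T" "norm T \<le> 1" and z: "z \<notin> op_spectrum J T" "norm z > 1" 
    and f: "linear f" "\<And>y. f y \<le> norm y"
  shows "(\<lambda>m. cfunctional f (blinfun_apply (op_pow T m) x) / z ^ Suc m) sums (- cfunctional f (blinfun_apply (resolvent T z) x))"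
proof -
  define y where "y = - blinfun_apply (resolvent T z) x"
  have y: "blinfun_apply (cscal J z) y = x + blinfun_apply T y"
    using resolvent_right[OF z(1), of x] by (simp add: y_def blinfun.minus_right)
  have z0: "z \<noteq> 0" using z by auto
  let ?u = "\<lambda>n. cfunctional f (blinfun_apply (op_pow T n) y)"
  have rec: "z * ?u n = cfunctional f (blinfun_apply (op_pow T n) x) + ?u (Suc n)" for n
  proof -
    have "z * ?u n = cfunctional f (blinfun_apply (op_pow T n) (blinfun_apply (cscal J z) y))"
      by (simp add: cfunctional_cscal[OF f(1)] cscal_commute[OF clinear_op_pow[OF T(1)]])
    then show ?thesis by (simp add: y blinfun.add_right cfunctional_add[OF f(1)] op_pow_Suc_apply')
  qed
  have part: "(\<Sum>m<n. cfunctional f (blinfun_apply (op_pow T m) x) / z ^ Suc m) = ?u 0 - ?u n / z ^ n" for n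
  proof (induction n)
    case (Suc n)
    have "cfunctional f (blinfun_apply (op_pow T n) x) = z * ?u n - ?u (Suc n)" using rec[of n] by simp
    then have "cfunctional f (blinfun_apply (op_pow T n) x) / z ^ Suc n = ?u n / z ^ n - ?u (Suc n) / z ^ Suc n"
      using z0 by (simp only: diff_divide_distrib) simp
    then show ?case unfolding sum.lessThan_Suc Suc.IH by (simp only:) simp
  qed simp
  have "(\<lambda>n. ?u n / z ^ n) \<longlonglongrightarrow> 0"
  proof (rule Lim_null_comparison)
    show "eventually (\<lambda>n. norm (?u n / z ^ n) \<le> 2 * norm y * (1 / norm z) ^ n) sequentially"
    proof (intro always_eventually allI)
      fix n
      have "norm (?u n) \<le> 2 * norm (blinfun_apply (op_pow T n) y)" by (rule norm_cfunctional_le[OF f])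
      also have "\<dots> \<le> 2 * norm y" using norm_op_pow_le[OF T(2), of n y] by simp
      finally show "norm (?u n / z ^ n) \<le> 2 * norm y * (1 / norm z) ^ n"
        using z0 by (simp add: norm_divide norm_power power_divide divide_right_mono)
    qed
    show "(\<lambda>n. 2 * norm y * (1 / norm z) ^ n) \<longlonglongrightarrow> 0"
      using z z0 by (intro tendsto_mult_right_zero LIMSEQ_power_zero) (simp add: divide_less_eq)
  qed
  then have "(\<lambda>n. ?u 0 - ?u n / z ^ n) \<longlonglongrightarrow> ?u 0 - 0" by (intro tendsto_intros)
  then show ?thesis unfolding sums_def part by (simp add: y_def cfunctional_minus[OF f(1)])
qed

text \<open>The relation \<open>z y = x + T y\<close>, read after applying powers of
  \<open>S\<close>, telescopes in the other direction. The remainder is at most a multiple of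
  \<open>norm z ^ n * norm (op_pow S n)\<close>.\<close>

lemma resolvent_inner_series:
  assumes T: "clinear_op J T" "S o\<^sub>L T = id_blinfun" "T o\<^sub>L S = id_blinfun" and z: "z \<notin> op_spectrum J T" 
    and S: "(\<lambda>n. norm z ^ n * norm (op_pow S n)) \<longlonglongrightarrow> 0"
    and f: "linear f" "\<And>y. f y \<le> norm y"
  shows "(\<lambda>m. - cfunctional f (blinfun_apply (op_pow S (Suc m)) x) * z ^ m) sums (- cfunctional f (blinfun_apply (resolvent T z) x))"
proof -
  define y where "y = - blinfun_apply (resolvent T z) x"
  have y: "blinfun_apply (cscal J z) y = x + blinfun_apply T y"
    using resolvent_right[OF z(1), of x] by (simp add: y_def blinfun.minus_right)
  let ?u = "\<lambda>n. cfunctional f (blinfun_apply (op_pow S n) y)"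
  have SJ: "clinear_op J S" by (rule clinear_op_inverse[OF T])
  have ST: "blinfun_apply S (blinfun_apply T v) = v" for v
    using T(2) by (metis blinfun_apply_blinfun_compose id_blinfun.rep_eq id_apply)
  have rec: "z * ?u (Suc n) = cfunctional f (blinfun_apply (op_pow S (Suc n)) x) + ?u n" for n
  proof -
    have "z * ?u (Suc n) = cfunctional f (blinfun_apply (op_pow S (Suc n)) (blinfun_apply (cscal J z) y))"
      by (simp add: cfunctional_cscal[OF f(1)] cscal_commute[OF clinear_op_pow[OF SJ]])
    then show ?thesis by (simp add: y blinfun.add_right cfunctional_add[OF f(1)] op_pow_Suc_apply'[of S n "blinfun_apply T y"] ST)
  qed
  have part: "(\<Sum>m<n. - cfunctional f (blinfun_apply (op_pow S (Suc m)) x) * z ^ m) = ?u 0 - ?u n * z ^ n" for n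
  proof (induction n)
    case (Suc n)
    have "cfunctional f (blinfun_apply (op_pow S (Suc n)) x) = z * ?u (Suc n) - ?u n" using rec[of n] by simp
    then have "- cfunctional f (blinfun_apply (op_pow S (Suc n)) x) * z ^ n = ?u n * z ^ n - ?u (Suc n) * z ^ Suc n"
      by (simp only:) (simp add: algebra_simps)
    then show ?case unfolding sum.lessThan_Suc Suc.IH by (simp only:) simp
  qed simp
  have "(\<lambda>n. ?u n * z ^ n) \<longlonglongrightarrow> 0"
  proof (rule Lim_null_comparison)
    show "eventually (\<lambda>n. norm (?u n * z ^ n) \<le> 2 * norm y * (norm z ^ n * norm (op_pow S n))) sequentially"
    proof (intro always_eventually allI)
      fix n
      have "norm (?u n) \<le> 2 * norm (blinfun_apply (op_pow S n) y)" by (rule norm_cfunctional_le[OF f])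
      also have "\<dots> \<le> 2 * (norm (op_pow S n) * norm y)" using norm_blinfun[of "op_pow S n" y] by simp
      finally have "norm (?u n) * norm z ^ n \<le> 2 * (norm (op_pow S n) * norm y) * norm z ^ n"
        by (intro mult_right_mono) auto
      then show "norm (?u n * z ^ n) \<le> 2 * norm y * (norm z ^ n * norm (op_pow S n))"
        by (simp add: norm_mult norm_power mult_ac)
    qed
    show "(\<lambda>n. 2 * norm y * (norm z ^ n * norm (op_pow S n))) \<longlonglongrightarrow> 0"
      using S by (rule tendsto_mult_right_zero)
  qed
  then have "(\<lambda>n. ?u 0 - ?u n * z ^ n) \<longlonglongrightarrow> ?u 0 - 0" by (intro tendsto_intros)
  then show ?thesis unfolding sums_def part by (simp add: y_def cfunctional_minus[OF f(1)])
qed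

end

section \<open>Growth bounds and the theorem\<close>

text \<open>The threshold \<open>\<tau>\<close> solves
  \<open>c * \<tau> powr \<alpha> = y * \<tau>\<close>. Beyond it the linear term dominates; below
  it the left side is at most its value at \<open>\<tau>\<close>, which is the second term. This is
  how \<open>\<alpha> / (1 - \<alpha>)\<close> arises from \<open>\<alpha>\<close>.\<close>

lemma powr_le_linear_plus:
  fixes \<alpha> c y t :: real
  assumes \<alpha>: "0 < \<alpha>" "\<alpha> < 1" and c: "0 < c" and y: "0 < y" and t: "0 \<le> t"
  defines "\<beta> \<equiv> \<alpha> / (1 - \<alpha>)"
  shows "c * t powr \<alpha> \<le> y * t + c * c powr \<beta> * y powr - \<beta>"
proof -
  define \<tau> where "\<tau> = (c / y) powr (1 / (1 - \<alpha>))"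
  have \<tau>: "\<tau> > 0" using c y by (simp add: \<tau>_def)
  show ?thesis
  proof (cases "t \<le> \<tau>")
    case True
    then have "t powr \<alpha> \<le> \<tau> powr \<alpha>" using t \<alpha> by (intro powr_mono2) auto
    also have "\<dots> = (c / y) powr \<beta>" by (simp add: \<tau>_def powr_powr \<beta>_def)
    also have "\<dots> = c powr \<beta> * y powr - \<beta>" using c y by (simp add: powr_divide powr_minus_divide)
    finally have "c * t powr \<alpha> \<le> c * (c powr \<beta> * y powr - \<beta>)" using c by (intro mult_left_mono) auto
    moreover have "0 \<le> y * t" using y t by simp
    ultimately show ?thesis by (simp add: mult.assoc)
  next
    case False
    then have "\<tau> powr (1 - \<alpha>) \<le> t powr (1 - \<alpha>)" using \<tau> \<alpha> by (intro powr_mono2) auto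
    moreover have "\<tau> powr (1 - \<alpha>) = c / y" using \<alpha> c y by (simp add: \<tau>_def powr_powr)
    ultimately have "c \<le> y * t powr (1 - \<alpha>)" using y by (simp add: field_simps)
    then have "c * t powr \<alpha> \<le> y * t powr (1 - \<alpha>) * t powr \<alpha>" by (intro mult_right_mono) auto
    also have "\<dots> = y * (t powr (1 - \<alpha>) * t powr \<alpha>)" by simp
    also have "t powr (1 - \<alpha>) * t powr \<alpha> = t" using False \<tau> by (simp flip: powr_add)
    finally have "c * t powr \<alpha> \<le> y * t" .
    moreover have "0 \<le> c * c powr \<beta> * y powr - \<beta>" using c by simp
    ultimately show ?thesis by linarith
  qed
qed

lemma one_minus_exp_ge:
  assumes "0 < y" "y \<le> (1::real)"
  shows "y / 2 \<le> 1 - exp (- y)"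
proof -
  have "exp (- y) \<le> 1 / (1 + y)" using exp_ge_add_one_self[of y] assms by (simp add: exp_minus field_simps)
  also have "\<dots> \<le> 1 - y / 2" using assms by (simp add: field_simps)
  finally show ?thesis by simp
qed

lemma geometric_exp_le:
  assumes "0 < y" "y \<le> (1::real)"
  shows "(\<lambda>m. exp (- y) ^ m) sums (1 / (1 - exp (- y)))" and "1 / (1 - exp (- y)) \<le> 2 / y"
proof -
  show "(\<lambda>m. exp (- y) ^ m) sums (1 / (1 - exp (- y)))" using assms by (intro geometric_sums) auto
  have "1 / (1 - exp (- y)) \<le> 1 / (y / 2)"
    using one_minus_exp_ge[OF assms] assms by (intro divide_left_mono mult_pos_pos) auto
  then show "1 / (1 - exp (- y)) \<le> 2 / y" by simp
qed

text \<open>Outside the circle \<open>f\<close> is bounded by a geometric series. Inside, the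
  subexponential growth of \<open>b\<close> is split by the preceding inequality into a linear
  exponent, absorbed by the decay of \<open>z ^ m\<close>, and the constant
  \<open>exp (C1 * Y)\<close>.\<close>

lemma hyperfunction_growth:
  fixes f :: "complex \<Rightarrow> complex" and a b :: "nat \<Rightarrow> complex"
  assumes \<alpha>: "0 < \<alpha>" "\<alpha> < 1" and c: "0 < c"
    and outer: "\<And>z. norm z > 1 \<Longrightarrow> (\<lambda>m. a m / z ^ Suc m) sums f z" and a: "\<And>m. norm (a m) \<le> M"
    and inner: "\<And>z. norm z < 1 \<Longrightarrow> (\<lambda>m. - b m * z ^ m) sums f z" 
    and b: "\<And>m. norm (b m) \<le> D * exp (c * real (Suc m) powr \<alpha>)" and D: "0 \<le> D"
  obtains C where "0 \<le> C" "\<And>w. 0 < \<bar>Im w\<bar> \<Longrightarrow> \<bar>Im w\<bar> \<le> 1 \<Longrightarrow> norm (f (char 1 w)) \<le> exp (C * \<bar>Im w\<bar> powr - (\<alpha> / (1 - \<alpha>)))"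
proof -
  define \<beta> where "\<beta> = \<alpha> / (1 - \<alpha>)"
  have \<beta>: "\<beta> > 0" using \<alpha> by (simp add: \<beta>_def)
  define C1 where "C1 = c * c powr \<beta>"
  have C1: "C1 > 0" using c by (simp add: C1_def)
  have M: "M \<ge> 0" using a[of 0] norm_ge_zero order_trans by blast
  define K where "K = 2 * exp 1 * D + 2 * M + 1"
  have K: "K \<ge> 1" using D M by (simp add: K_def)
  define C where "C = ln K + 1 / \<beta> + C1"
  have C: "C \<ge> 0" using K C1 \<beta> by (simp add: C_def)
  have "norm (f (char 1 w)) \<le> exp (C * \<bar>Im w\<bar> powr - \<beta>)" if w: "0 < \<bar>Im w\<bar>" "\<bar>Im w\<bar> \<le> 1" for w
  proof -
    define y where "y = \<bar>Im w\<bar>"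
    have y: "0 < y" "y \<le> 1" using w by (auto simp: y_def)
    define Y where "Y = y powr - \<beta>"
    have Y: "Y \<ge> 1" using y \<beta> powr_mono'[of "- \<beta>" 0 y] by (simp add: Y_def)
    \<comment> \<open>Of the two factors \<open>exp (- y)\<close>, one pays for the linear exponent
      and the other leaves a convergent geometric series.\<close>
    have rpow: "exp (- (2 * pi * y)) \<le> exp (- (2 * y))" using y pi_gt_zero pi_ge_two by (simp add: mult_right_mono)
    have "norm (f (char 1 w)) \<le> K * (1 / y) * exp (C1 * Y)"
    proof (cases "Im w > 0")
      case True
      have nz: "norm (char 1 w) = exp (- (2 * pi * y))" using True by (simp add: norm_char y_def)
      have "norm (char 1 w) < 1" using nz y by simp
      have "norm (f (char 1 w)) \<le> D * exp y * exp (C1 * Y) * (1 / (1 - exp (- y)))"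
      proof (rule norm_sums_le[OF inner[OF \<open>norm (char 1 w) < 1\<close>] sums_mult[OF geometric_exp_le(1)[OF y]]])
        fix m :: nat
        have "c * real (Suc m) powr \<alpha> \<le> y * real (Suc m) + C1 * Y"
          unfolding C1_def Y_def \<beta>_def by (rule powr_le_linear_plus[OF \<alpha> c y(1)]) simp
        then have "D * exp (c * real (Suc m) powr \<alpha>) \<le> D * exp (y * real (Suc m) + C1 * Y)"
          using D by (intro mult_left_mono) auto
        with b[of m] have 1: "norm (b m) \<le> D * exp (y * real (Suc m) + C1 * Y)" by linarith
        have 2: "exp (- (2 * pi * y)) ^ m \<le> exp (- (2 * y)) ^ m" using rpow by (intro power_mono) auto
        have "norm (- b m * char 1 w ^ m) = norm (b m) * exp (- (2 * pi * y)) ^ m"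
          by (simp only: norm_mult norm_power nz norm_minus_cancel)
        also have "\<dots> \<le> (D * exp (y * real (Suc m) + C1 * Y)) * exp (- (2 * y)) ^ m"
          using D by (intro mult_mono 1 2) auto
        also have "\<dots> = D * exp y * exp (C1 * Y) * exp (- y) ^ m"
          by (simp add: algebra_simps flip: exp_add exp_of_nat_mult)
        finally show "norm (- b m * char 1 w ^ m) \<le> D * exp y * exp (C1 * Y) * exp (- y) ^ m" .
      qed
      also have "\<dots> \<le> D * exp 1 * exp (C1 * Y) * (2 / y)"
        using D y one_minus_exp_ge[OF y] by (intro mult_mono geometric_exp_le) auto
      also have "\<dots> = (2 * exp 1 * D) * (1 / y * exp (C1 * Y))" by simp
      also have "\<dots> \<le> K * (1 / y * exp (C1 * Y))"
        using M y by (intro mult_right_mono) (auto simp: K_def)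
      finally show ?thesis by (simp add: mult.assoc)
    next
      case False
      then have Im: "Im w = - y" by (simp add: y_def)
      have nz: "norm (char 1 w) = exp (2 * pi * y)" using Im by (simp add: norm_char)
      have "norm (char 1 w) > 1" using nz y by simp
      have "norm (f (char 1 w)) \<le> M * (1 / (1 - exp (- y)))"
      proof (rule norm_sums_le[OF outer[OF \<open>norm (char 1 w) > 1\<close>] sums_mult[OF geometric_exp_le(1)[OF y]]])
        fix m :: nat
        have "exp (- (2 * pi * y)) \<le> exp (- y)" using rpow y by (smt (verit) exp_le_cancel_iff)
        then have "exp (- (2 * pi * y)) ^ Suc m \<le> exp (- y) ^ Suc m" by (intro power_mono) auto
        also have "\<dots> \<le> exp (- y) ^ m" using y by (intro power_decreasing) auto
        finally have 2: "exp (- (2 * pi * y)) ^ Suc m \<le> exp (- y) ^ m" .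
        have "norm (a m / char 1 w ^ Suc m) = norm (a m) * exp (- (2 * pi * y)) ^ Suc m"
          unfolding norm_divide norm_power nz by (simp add: exp_minus divide_inverse power_inverse)
        also have "\<dots> \<le> M * exp (- y) ^ m" using M by (intro mult_mono a 2) auto
        finally show "norm (a m / char 1 w ^ Suc m) \<le> M * exp (- y) ^ m" .
      qed
      also have "\<dots> \<le> M * (2 / y)" using M by (intro mult_left_mono geometric_exp_le(2) y)
      also have "\<dots> = (2 * M) * (1 / y * 1)" by simp
      also have "\<dots> \<le> K * (1 / y * exp (C1 * Y))"
        using M D y C1 Y by (intro mult_mono) (auto simp: K_def)
      finally show ?thesis by (simp add: mult.assoc)
    qed
    \<comment> \<open>Since \<open>Y \<ge> 1\<close> and
      \<open>ln (1 / y) \<le> Y / \<beta>\<close>, the factors \<open>K\<close> and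
      \<open>1 / y\<close> can be moved into the exponent.\<close>
    also have "\<dots> \<le> exp (ln K * Y) * exp (Y / \<beta>) * exp (C1 * Y)"
    proof (intro mult_right_mono mult_mono)
      have "K = exp (ln K)" using K by simp
      also have "exp (ln K) \<le> exp (ln K * Y)"
        unfolding exp_le_cancel_iff using K Y by (simp add: mult_le_cancel_left1)
      finally show "K \<le> exp (ln K * Y)" .
      have "ln (1 / y) \<le> (1 / y) powr \<beta> / \<beta>" using y \<beta> by (intro ln_powr_bound) auto
      also have "(1 / y) powr \<beta> = Y" using y by (simp add: Y_def powr_divide powr_minus_divide)
      finally have "exp (ln (1 / y)) \<le> exp (Y / \<beta>)" by simp
      then show "1 / y \<le> exp (Y / \<beta>)" using y by simp
    qed (use y in auto)
    also have "\<dots> = exp (C * Y)" by (simp add: C_def algebra_simps flip: exp_add)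
    finally show ?thesis by (simp add: Y_def y_def)
  qed
  then show ?thesis using that C unfolding \<beta>_def by blast
qed

text \<open>The limsup controls all but finitely many terms, and \<open>D\<close> absorbs the
  others. Raising the exponent to \<open>\<alpha>'\<close> is allowed because
  \<open>n \<ge> 1\<close>.\<close>

lemma eventual_growth_bound:
  fixes g :: "nat \<Rightarrow> real" and \<alpha> \<alpha>' :: real
  assumes g: "\<And>n. 0 \<le> g n" and lim: "limsup (\<lambda>n. ereal (log_plus (g n) / real n powr \<alpha>)) < \<infinity>" and \<alpha>': "\<alpha> \<le> \<alpha>'"
  obtains c D where "0 < c" "0 \<le> D" "\<And>n. n \<ge> 1 \<Longrightarrow> g n \<le> D * exp (c * real n powr \<alpha>')"
proof -
  obtain C :: nat where "limsup (\<lambda>n. ereal (log_plus (g n) / real n powr \<alpha>)) < ereal (real C)"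
    using lim less_PInf_Ex_of_nat by auto
  from Limsup_lessD[OF this] obtain N where N: "\<And>n. n \<ge> N \<Longrightarrow> log_plus (g n) / real n powr \<alpha> < real C"
    by (auto simp: eventually_sequentially)
  define c where "c = real C + 1"
  define D where "D = 1 + (\<Sum>n<N. g n)"
  have D: "D \<ge> 1" using g by (simp add: D_def sum_nonneg)
  show ?thesis
  proof
    show "0 < c" "0 \<le> D" using D by (auto simp: c_def)
    fix n :: nat assume n: "n \<ge> 1"
    show "g n \<le> D * exp (c * real n powr \<alpha>')"
    proof (cases "n < N")
      case True
      then have "g n \<le> (\<Sum>n<N. g n)" using g by (intro member_le_sum) auto
      then have "g n \<le> D * 1" by (simp add: D_def)
      also have "\<dots> \<le> D * exp (c * real n powr \<alpha>')" using D by (intro mult_left_mono) (auto simp: c_def)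
      finally show ?thesis .
    next
      case False
      then have "log_plus (g n) / real n powr \<alpha> < real C" using N by simp
      then have "log_plus (g n) < real C * real n powr \<alpha>" using n by (simp add: field_simps)
      also have "\<dots> \<le> c * real n powr \<alpha>'" using n \<alpha>' by (intro mult_mono powr_mono) (auto simp: c_def)
      finally have 1: "log_plus (g n) \<le> c * real n powr \<alpha>'" by simp
      have "g n \<le> exp (log_plus (g n))"
      proof (cases "g n = 0")
        case False
        then have "g n = exp (ln (g n))" using g[of n] by simp
        also have "\<dots> \<le> exp (log_plus (g n))" by (simp add: log_plus_def)
        finally show ?thesis .
      qed simp
      also have "\<dots> \<le> exp (c * real n powr \<alpha>')" using 1 by simp
      also have "\<dots> \<le> D * exp (c * real n powr \<alpha>')" using D by simp
      finally show ?thesis .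
    qed
  qed
qed

text \<open>With \<open>y = (1 - r) / 2\<close> one still has \<open>r * exp y < 1\<close>, and the
  growth is at most a constant times \<open>exp (y * n)\<close>. This serves the remainder of the
  inner series.\<close>

lemma power_times_subexponential_tendsto_0:
  fixes g :: "nat \<Rightarrow> real"
  assumes g: "\<And>n. n \<ge> 1 \<Longrightarrow> g n \<le> D * exp (c * real n powr \<alpha>)" "\<And>n. 0 \<le> g n"
    and \<alpha>: "0 < \<alpha>" "\<alpha> < 1" and c: "0 < c" and r: "0 \<le> r" "r < 1" and D: "0 \<le> D"
  shows "(\<lambda>n. r ^ n * g n) \<longlonglongrightarrow> 0"
proof -
  define y where "y = (1 - r) / 2"
  have y: "y > 0" using r by (simp add: y_def)
  define E where "E = c * c powr (\<alpha> / (1 - \<alpha>)) * y powr - (\<alpha> / (1 - \<alpha>))"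
  have ry: "r * exp y < 1"
  proof -
    have "r < 1 - y" using r by (simp add: y_def field_simps)
    also have "\<dots> \<le> exp (- y)" using exp_ge_add_one_self[of "- y"] by simp
    finally have "r * exp y < exp (- y) * exp y" by (intro mult_strict_right_mono) auto
    then show ?thesis by (simp flip: exp_add)
  qed
  have "(\<lambda>n. D * exp E * (r * exp y) ^ n) \<longlonglongrightarrow> 0"
    using ry r by (intro tendsto_mult_right_zero LIMSEQ_power_zero) auto
  moreover have "eventually (\<lambda>n. norm (r ^ n * g n) \<le> D * exp E * (r * exp y) ^ n) sequentially"
    using eventually_ge_at_top[of 1]
  proof eventually_elim
    case (elim n)
    have "c * real n powr \<alpha> \<le> y * real n + E" unfolding E_def by (rule powr_le_linear_plus[OF \<alpha> c y]) simp
    then have "D * exp (c * real n powr \<alpha>) \<le> D * exp (y * real n + E)" using D by (intro mult_left_mono) auto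
    with g(1)[OF elim] have "g n \<le> D * exp (y * real n + E)" by linarith
    then have "r ^ n * g n \<le> r ^ n * (D * exp (y * real n + E))" using r by (intro mult_left_mono) auto
    also have "\<dots> = D * exp E * (r * exp y) ^ n"
      by (simp add: exp_add power_mult_distrib mult.commute mult.left_commute flip: exp_of_nat_mult)
    finally show ?case using g(2)[of n] r by simp
  qed
  ultimately show ?thesis by (rule Lim_null_comparison[rotated])
qed

theorem theorem5p1:
  fixes J T S :: "'a::banach \<Rightarrow>\<^sub>L 'a" and p :: nat and \<alpha> :: real
  assumes "p \<ge> 3"
    and "complex_structure J"
    and "clinear_op J T"
    and "norm T \<le> 1"
    and "op_spectrum J T \<subseteq> E_set p"
    and "S o\<^sub>L T = id_blinfun" and "T o\<^sub>L S = id_blinfun"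
    and "\<alpha> < (ln p - ln 2) / (2 * ln p - ln 2)"
    and "limsup (\<lambda>n. ereal (log_plus (norm (op_pow S n)) / real n powr \<alpha>)) < \<infinity>"
  shows "\<exists>C. \<forall>n\<ge>1. norm (op_pow S n) \<le> C"
proof -
  have p: "p \<ge> 2" using assms(1) by simp
  define d where "d = (ln (real p) - ln 2) / (2 * ln p - ln 2)"
  have lnp: "ln 2 < ln (real p)" using assms(1) by simp
  have ln2: "0 < ln (2::real)" by simp
  have den: "0 < 2 * ln (real p) - ln 2" using lnp ln2 by linarith
  have d: "0 < d" "d < 1" "\<alpha> < d"
  proof -
    show "0 < d" unfolding d_def using lnp den by (intro divide_pos_pos) linarith+
    have "ln (real p) - ln 2 < 2 * ln (real p) - ln 2" using assms(1) by simp
    then show "d < 1" unfolding d_def pos_divide_less_eq[OF den] by (simp only: mult_1_left)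
    show "\<alpha> < d" unfolding d_def by (rule assms(8))
  qed
  \<comment> \<open>The given \<open>\<alpha>\<close> may be zero or negative, so it is replaced by
    a positive exponent still below \<open>d\<close>.\<close>
  define \<alpha>' where "\<alpha>' = (max \<alpha> 0 + d) / 2"
  have \<alpha>': "0 < \<alpha>'" "\<alpha>' < 1" "\<alpha>' < d" "\<alpha> \<le> \<alpha>'" using d by (auto simp: \<alpha>'_def max_def)
  define \<beta> where "\<beta> = \<alpha>' / (1 - \<alpha>')"
  \<comment> \<open>In terms of \<open>\<beta>\<close>, the condition \<open>\<alpha>' < d\<close>
    becomes \<open>p powr \<beta> < p / 2\<close>. This leaves room for \<open>s < 1 / 2\<close>
    with \<open>p powr \<beta> < s * p\<close>.\<close>
  have "\<alpha>' * (2 * ln p - ln 2) < ln p - ln 2" using \<alpha>'(3) lnp ln2 by (simp add: d_def field_simps)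
  then have "\<alpha>' * ln p < (1 - \<alpha>') * (ln p - ln 2)" by (simp add: algebra_simps)
  then have \<beta>p: "\<beta> * ln p < ln p - ln 2" using \<alpha>' by (simp add: \<beta>_def field_simps)
  have \<beta>0: "0 < \<beta>" using \<alpha>' by (simp add: \<beta>_def)
  have "\<beta> * ln p < 1 * ln p" unfolding mult_1_left using \<beta>p ln2 by linarith
  then have \<beta>1: "\<beta> < 1" by (rule mult_right_less_imp_less) (use assms(1) in simp)
  have "real p powr \<beta> = exp (\<beta> * ln p)" using p by (simp add: powr_def)
  also have "\<dots> < exp (ln p - ln 2)" using \<beta>p by simp
  also have "\<dots> = p / 2" using p by (simp add: exp_diff)
  finally have "real p powr \<beta> / p < 1 / 2" using p by (simp add: field_simps)
  then obtain s where s: "real p powr \<beta> / p < s" "s < 1 / 2" using dense by blast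
  have sp: "real p powr \<beta> < s * p" using s(1) p by (simp add: field_simps)
  have "1 \<le> real p powr \<beta>" using p \<beta>0 by (simp add: ge_one_powr_ge_zero)
  then have s1: "1 / p < s" using sp p by (simp add: field_simps)
  obtain A where A: "\<And>l. summable (\<lambda>n. norm ((deriv ^^ Suc n) (damping p s l) 0 / fact (Suc n)))"
     "\<And>l. (\<Sum>n. norm ((deriv ^^ Suc n) (damping p s l) 0 / fact (Suc n))) \<le> A"
    using damping_coeffs[OF p s1 s(2)] by blast
  have "0 \<le> A" using suminf_nonneg[OF A(1)[of 0]] A(2)[of 0] by (auto simp del: funpow.simps fact_Suc intro: order_trans)
  obtain c D where cD: "0 < c" "0 \<le> D" and growth: "\<And>n. n \<ge> 1 \<Longrightarrow> norm (op_pow S n) \<le> D * exp (c * real n powr \<alpha>')"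
    using eventual_growth_bound[OF _ assms(9) \<alpha>'(4)] by (metis norm_ge_zero)
  have spec: "op_spectrum J T \<subseteq> cantor_hull p" using assms(5) E_set_subset_cantor_hull[OF assms(1)] by blast
  have off: "z \<notin> op_spectrum J T" if "norm z \<noteq> 1" for z using spec that by (auto simp: cantor_hull_def)
  define Q where "Q = exp (1 / (1 - 2 * s)) * (A * 2)"
  have "norm (blinfun_apply (op_pow S (p ^ k)) x) \<le> Q * norm x" for k x
  proof -
    define q where "q = p ^ k"
    have q: "Suc (q - 1) = q" using p by (simp add: q_def)
    \<comment> \<open>The functional norms the vector to be estimated. It depends on
      \<open>x\<close> and \<open>k\<close>, and so does the growth constant \<open>C\<close> below,
      but the final bound involves neither.\<close>
    obtain f where f: "linear f" "\<And>y. f y \<le> norm y" "f (blinfun_apply (op_pow S q) x) = norm (blinfun_apply (op_pow S q) x)"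
      using exists_norming_functional by blast
    define \<phi> where "\<phi> = cfunctional J f"
    note \<phi>_le = norm_cfunctional_le[OF assms(2) f(1,2), folded \<phi>_def]
    \<comment> \<open>This is the functional applied to \<open>(z - T)^-1 x\<close>, whose
      expansions at infinity and at 0 have the coefficients \<open>a\<close> and
      \<open>- b\<close>.\<close>
    define h where "h z = - \<phi> (blinfun_apply (resolvent J T z) x)" for z
    define a where "a m = \<phi> (blinfun_apply (op_pow T m) x)" for m
    define b where "b m = \<phi> (blinfun_apply (op_pow S (Suc m)) x)" for m
    have hol: "h holomorphic_on - cantor_hull p"
      unfolding h_def[abs_def] \<phi>_def
      by (rule resolvent_holomorphic[OF assms(2,3) closed_cantor_hull spec f(1,2)])
    have outer: "(\<lambda>m. a m / z ^ Suc m) sums h z" if "norm z > 1" for z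
      unfolding a_def h_def \<phi>_def
      by (rule resolvent_outer_series[OF assms(2,3,4) off _ f(1,2)]) (use that in auto)
    have inner: "(\<lambda>m. - b m * z ^ m) sums h z" if "norm z < 1" for z
      unfolding b_def h_def \<phi>_def
    proof (rule resolvent_inner_series[OF assms(2,3,6,7) off _ f(1,2)])
      show "(\<lambda>n. norm z ^ n * norm (op_pow S n)) \<longlonglongrightarrow> 0"
        by (rule power_times_subexponential_tendsto_0[OF growth _ \<alpha>'(1,2) cD(1) _ that cD(2)]) auto
    qed (use that in auto)
    have a: "norm (a m) \<le> 2 * norm x" for m
      using \<phi>_le[of "blinfun_apply (op_pow T m) x"] norm_op_pow_le[OF assms(4), of m x] by (simp add: a_def)
    have b: "norm (b m) \<le> (2 * D * norm x) * exp (c * real (Suc m) powr \<alpha>')" for m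
    proof -
      have "norm (b m) \<le> 2 * norm (blinfun_apply (op_pow S (Suc m)) x)" unfolding b_def by (rule \<phi>_le)
      also have "\<dots> \<le> 2 * (norm (op_pow S (Suc m)) * norm x)" by (intro mult_left_mono norm_blinfun) auto
      also have "\<dots> \<le> 2 * ((D * exp (c * real (Suc m) powr \<alpha>')) * norm x)"
        by (intro mult_left_mono mult_right_mono growth) auto
      finally show ?thesis by (simp add: mult_ac)
    qed
    obtain C where C: "0 \<le> C" "\<And>w. 0 < \<bar>Im w\<bar> \<Longrightarrow> \<bar>Im w\<bar> \<le> 1 \<Longrightarrow> norm (h (char 1 w)) \<le> exp (C * \<bar>Im w\<bar> powr - \<beta>)"
      using hyperfunction_growth[OF \<alpha>'(1,2) cD(1) outer a inner b] cD(2) unfolding \<beta>_def by auto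
    have "norm (b (p ^ k - 1)) \<le> exp (1 / (1 - 2 * s)) * (A * (2 * norm x))"
      by (rule hyperfunction_coefficient_bound[OF p s(2) \<beta>0 \<beta>1 sp A hol outer a inner C])
    then have "norm (b (q - 1)) \<le> Q * norm x" by (simp add: Q_def q_def mult_ac)
    moreover have "norm (blinfun_apply (op_pow S q) x) = Re (b (q - 1))"
      unfolding b_def q \<phi>_def by (simp add: cfunctional_def[OF assms(2)] f(3))
    moreover have "Re (b (q - 1)) \<le> norm (b (q - 1))" by (rule complex_Re_le_cmod)
    ultimately show ?thesis by (simp add: q_def)
  qed
  moreover have "0 \<le> Q" using \<open>0 \<le> A\<close> by (simp add: Q_def)
  ultimately have bound: "norm (op_pow S (p ^ k)) \<le> Q" for k by (intro norm_blinfun_bound) auto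
  have "norm (op_pow S n) \<le> Q" for n
  proof -
    \<comment> \<open>The norms increase with the exponent, so a bound along the powers of
      \<open>p\<close> bounds them all.\<close>
    have "n \<le> p ^ n" using power_gt_expt[of p n] p by simp
    then have "norm (op_pow S n) \<le> norm (op_pow S (p ^ n))"
      by (rule norm_op_pow_inverse_mono[OF assms(6,7,4)])
    with bound[of n] show ?thesis by linarith
  qed
  then show ?thesis by blast
qed

end
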